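(* Let $\kappa=(\kappa(j))_{j\in\mathbb Z}$ be i.i.d. real random variables with mean zero and variance $1$, supported in an interval $[-\alpha,\alpha]$, with $\sigma\ge0$, $\sigma\alpha<1$. Let $c_*\in(c_-,c_+)$ and let $\{\mathcal A_{c_*t,c_*}\}_{t\in\mathbb R}$ satisfy the linear stability hypothesis (LS) stated in the context. Let $\overline R$, $(\overline\gamma_2,\overline c_2)$, $M^{1,0}$, $M^{0,2}$ and $M^{1,1}$ be as defined in the context. Then for each $t\ge0$, $$\mathbb E\begin{bmatrix}\dot{\overline\gamma}_2(t)\\ \dot{\overline c}_2(t)\end{bmatrix}=M^{1,0}(c_*t,c_* )+M^{0,2}(c_*t,c_* )\big[\overline R(\cdot,\cdot,t),\overline R(\cdot,\cdot,t)\big]+M^{1,1}(c_*t,c_* )\big[\overline R(\cdot,\cdot,t)\big].$$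
   Context: Notation: $\delta_+f(j)=f(j+1)-f(j)$, $\delta_-f(j)=f(j)-f(j-1)$, $\mathcal J(r,p)^\top=(\delta_+p,\ \delta_-r)^\top$. For $f:\mathbb Z^2\to\mathbb R^2$, $f=(f_r,f_p)^\top$, $\|f\|^2_{\ell^2_a(\mathbb Z^2;\mathbb R^2)}=\sum_{m}\sum_{j}e^{2aj}\big(f_r^2(j,m)+f_p^2(j,m)\big)$, and $\ell^2_a(\mathbb Z^2;\mathbb R^2)$ is the space of $f$ for which this is finite. Solitary waves (Friesecke–Pego): there is $c_+>1$ such that for each $c\in(1,c_+]$ there is a smooth, exponentially decaying profile $\phi_c=(r_c,p_c)^\top:\mathbb R\to\mathbb R^2$ (smooth also in $c$) solving $-c\phi_c'=\mathcal J(r_c+r_c^2,\ p_c)^\top$. Write $\phi_{\xi,c}=(r_{\xi,c},p_{\xi,c})^\top=\phi_c(\cdot-\xi)$; $\partial_\xi,\partial_c$ are derivatives in these parameters (so $\partial_\xi\phi_{\xi,c}=-\phi_c'(\cdot-\xi)$); functions on $\mathbb R$ are restricted to $\mathbb Z$ when used as sequences. Symplectic form: $\delta_+^{-1}f(j)=\sum_{d=-\infty}^{-1}f(j+d)$, $\delta_-^{-1}f(j)=\sum_{d=-\infty}^{0}f(j+d)$, $\mathcal J^{-1}(f_1,f_2)^\top=(\delta_-^{-1}f_2,\ \delta_+^{-1}f_1)^\top$, $\Omega(f,g)=\langle\mathcal J^{-1}f,g\rangle_{\ell^2(\mathbb Z;\mathbb R^2)}$. Known: the matrix with rows $(\Omega(\partial_\xi\phi_{\xi,c},\partial_\xi\phi_{\xi,c}),\Omega(\partial_\xi\phi_{\xi,c},\partial_c\phi_{\xi,c}))$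 and $(\Omega(\partial_c\phi_{\xi,c},\partial_\xi\phi_{\xi,c}),\Omega(\partial_c\phi_{\xi,c},\partial_c\phi_{\xi,c}))$ equals $A(c)=\begin{bmatrix}0&\alpha_0(c)\\-\alpha_0(c)&\alpha_1(c)\end{bmatrix}$, independent of $\xi$, with $\alpha_0(c)=\frac1c\frac{d}{dc}\sum_{j\in\mathbb Z}\big(\frac12p_c(j)^2+\frac12r_c(j)^2+\frac13r_c(j)^3\big)>0$ and $\alpha_1(c)=-\big(\frac{d}{dc}\int_{\mathbb R}r_c\big)\frac{d}{dc}\big(c\int_{\mathbb R}r_c\big)$. Fixed constants: $c_-\in(1,c_+)$, and $a>0$ is the weight of the Friesecke–Pego linear stability theorem: there are $b,K>0$ such that for all $c\in[c_-,c_+]$ and all $w_0$ with $e^{a\cdot}w_0\in\ell^2(\mathbb Z;\mathbb R^2)$ and $\Omega(\partial_\xi\phi_c,w_0)=\Omega(\partial_c\phi_c,w_0)=0$, the solution of $\dot w(t)=\mathcal J\big(w_r+2r_c(\cdot-ct)w_r,\ w_p\big)^\top$, $w(0)=w_0$, satisfies $\|e^{a(\cdot-ct)}w(t)\|_{\ell^2}\le Ke^{-bt}\|e^{a\cdot}w_0\|_{\ell^2}$ for $t\ge0$. The profiles and their derivatives in $\xi$ and $c$ are exponentially localized, with a rate $\beta>a$. Expansion maps. For $f,g\in\ell^\infty(\mathbb Z;\mathbb R)$ and $h=(h_r,h_p)^\top\in\ell^\infty(\mathbb Z;\mathbb R^2)$ (the same formulas being used for the exponentially weighted sequences below), $$V(\xi,c)[f]:=\begin{bmatrix}\Gamma^{1,0}(\xi,c)[f]\\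 C^{1,0}(\xi,c)[f]\end{bmatrix}=-\tfrac12A^{-1}(c)\begin{bmatrix}\langle\partial_\xi(r_{\xi,c}^2),f\rangle_{\ell^2}\\ \langle\partial_c(r_{\xi,c}^2),f\rangle_{\ell^2}\end{bmatrix},\quad \begin{bmatrix}\Gamma^{0,2}(\xi,c)\\ C^{0,2}(\xi,c)\end{bmatrix}[f,g]=-A^{-1}(c)\begin{bmatrix}\langle\partial_\xi r_{\xi,c},fg\rangle_{\ell^2}\\ \langle\partial_cr_{\xi,c},fg\rangle_{\ell^2}\end{bmatrix},$$ $$\begin{bmatrix}\Gamma^{1,1}(\xi,c)\\ C^{1,1}(\xi,c)\end{bmatrix}[f,h]=A^{-1}(c)B(\xi,c)[h]\,V(\xi,c)[f]+\begin{bmatrix}\Gamma^{0,2}(\xi,c)\\ C^{0,2}(\xi,c)\end{bmatrix}[f,h_r],\quad B(\xi,c)[h]=\begin{bmatrix}\Omega(\partial^2_{\xi\xi}\phi_{\xi,c},h)&\Omega(\partial^2_{c\xi}\phi_{\xi,c},h)\\ \Omega(\partial^2_{\xi c}\phi_{\xi,c},h)&\Omega(\partial^2_{cc}\phi_{\xi,c},h)\end{bmatrix},$$ $$T^{1,0}(\xi,c)[f]=-\Gamma^{1,0}(\xi,c)[f]\,\partial_\xi\phi_{\xi,c}-C^{1,0}(\xi,c)[f]\,\partial_c\phi_{\xi,c}+\begin{bmatrix}0\\ \delta_-(f\,r_{\xi,c})\end{bmatrix}.$$ Hypothesis (LS): $c_*\in(c_-,c_+)$ and $\{\mathcal A_{c_*t,c_*}\}_{t\in\mathbb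 R}$ is a family of bounded linear operators on $\ell^2(\mathbb Z;\mathbb R^2)$ with $[\mathcal A_{c_*t,c_*}\eta](j+d)=[\mathcal A_{c_*t-d,c_*}\eta(\cdot+d)](j)$ for all $j,d\in\mathbb Z$, $t\in\mathbb R$. The operators $\{\mathcal J\mathcal A_{c_*t,c_*}\}_{t\in\mathbb R}$ generate an evolution family $\{U_{c_*}(t,s)\}_{t\ge s}$ on $\ell^2(\mathbb Z;\mathbb R^2)$, and there are $K,b>0$ such that $\|e^{a(\cdot-c_*t)}U_{c_*}(t,s)w\|_{\ell^2}\le Ke^{-b(t-s)}\|e^{a(\cdot-c_*s)}w\|_{\ell^2}$ for $t\ge s$, provided $\Omega(\partial_\xi\phi_{c_*}(\cdot-c_*s),w)=\Omega(\partial_c\phi_{c_*}(\cdot-c_*s),w)=0$. Tail and response: $\overline\eta=(\overline\eta_r,\overline\eta_p)^\top$ solves $\dot{\overline\eta}(t)=\mathcal J\mathcal A_{c_*t,c_*}\overline\eta(t)+T^{1,0}(c_*t,c_* )[\kappa]$, $\overline\eta(0)=0$. With $\delta_m$ the sequence equal to $1$ at $m$ and $0$ elsewhere, $\overline R(\cdot,m,t)\in\ell^2(\mathbb Z;\mathbb R^2)$ solves $\dot{\overline R}(\cdot,m,t)=\mathcal J\mathcal A_{c_*t,c_*}\overline R(\cdot,m,t)+T^{1,0}(c_*t,c_* )[\delta_m]$, $\overline R(\cdot,m,0)=0$; one has $\overline R(\cdot,\cdot,t)\in\ell^2_a(\mathbb Z^2;\mathbb R^2)$. Phase and amplitude corrections: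 $(\gamma_1,c_1)$ solves $(\dot\gamma_1(t),\dot c_1(t))^\top=V(c_*t,c_* )[\kappa]$, $\gamma_1(0)=c_1(0)=0$, and $(\overline\gamma_2,\overline c_2)$ solves, with $\overline\gamma_2(0)=\overline c_2(0)=0$, $$\begin{bmatrix}\dot{\overline\gamma}_2(t)\\ \dot{\overline c}_2(t)\end{bmatrix}=\Big(\gamma_1(t)+\int_0^tc_1(s)\,ds\Big)\partial_\xi V(c_*t,c_* )[\kappa]+c_1(t)\,\partial_cV(c_*t,c_* )[\kappa]+\begin{bmatrix}\Gamma^{1,1}(c_*t,c_* )\\ C^{1,1}(c_*t,c_* )\end{bmatrix}[\kappa,\overline\eta(t)]+\begin{bmatrix}\Gamma^{0,2}(c_*t,c_* )\\ C^{0,2}(c_*t,c_* )\end{bmatrix}[\overline\eta_r(t),\overline\eta_r(t)],$$ where $\partial_\xi V(c_*t,c_* )$, $\partial_cV(c_*t,c_* )$ denote the partial derivatives of $V(\xi,c)$ evaluated at $(c_*t,c_* )$. The maps $M$: for $f,g\in\ell^2_a(\mathbb Z^2;\mathbb R^2)$, $$M^{1,1}(\xi,c)[f]=\sum_{m\in\mathbb Z}\begin{bmatrix}\Gamma^{1,1}(\xi,c)\\ C^{1,1}(\xi,c)\end{bmatrix}[\delta_m,f(\cdot,m)],\qquad M^{0,2}(\xi,c)[f,g]=\sum_{m\in\mathbb Z}\begin{bmatrix}\Gamma^{0,2}(\xi,c)\\ C^{0,2}(\xi,c)\end{bmatrix}[f_r(\cdot,m),g_r(\cdot,m)],$$ and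 $M^{1,0}=M^{1,0}_I+M^{1,0}_{II}+M^{1,0}_{III}+M^{1,0}_{IV}$ with (sums over $j\in\mathbb Z$, expectation of the whole product) $$M^{1,0}_I(\xi,c)=-\frac{\alpha_1(c)}{2c\,\alpha_0^2(c)}\,\mathbb E\Big(\sum_{j}\kappa(j)[r_c^2(j-\xi)-r_c^2(j)]\Big)\partial_\xi V(\xi,c)[\kappa],$$ $$M^{1,0}_{II}(\xi,c)=\frac1{2c\,\alpha_0(c)}\,\mathbb E\Big(\sum_j\kappa(j)\int_0^\xi\partial_cr_c^2(j-s)\,ds\Big)\partial_\xi V(\xi,c)[\kappa],$$ $$M^{1,0}_{III}(\xi,c)=-\frac1{2c^2\alpha_0(c)}\,\mathbb E\Big(\sum_j\kappa(j)\Big[\int_0^\xi r_c^2(j-s)\,ds-\xi r_c^2(j)\Big]\Big)\partial_\xi V(\xi,c)[\kappa],$$ $$M^{1,0}_{IV}(\xi,c)=-\frac1{2c\,\alpha_0(c)}\,\mathbb E\Big(\sum_j\kappa(j)[r_c^2(j-\xi)-r_c^2(j)]\Big)\partial_cV(\xi,c)[\kappa].$$ *)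

theory Defs
  imports "HOL-Probability.Probability"
begin

abbreviation vec2 :: "real \<Rightarrow> real \<Rightarrow> real^2"
  where "vec2 x y \<equiv> vector [x, y]"


subsection \<open>Difference operators and the symplectic form\<close>

text \<open>A state \<open>f = (f\<^sub>r, f\<^sub>p)\<close> is a function into \<^typ>\<open>real^2\<close>, with \<open>f\<^sub>r j = f j $ 1\<close> and
  \<open>f\<^sub>p j = f j $ 2\<close>. The difference operators act on functions on the integers and on functions
  on the reals alike.\<close>

definition dplus :: "('i::ring_1 \<Rightarrow> real) \<Rightarrow> 'i \<Rightarrow> real"
  where "dplus f j = f (j + 1) - f j"

definition dminus :: "('i::ring_1 \<Rightarrow> real) \<Rightarrow> 'i \<Rightarrow> real"
  where "dminus f j = f j - f (j - 1)"

definition J :: "('i::ring_1 \<Rightarrow> real^2) \<Rightarrow> 'i \<Rightarrow> real^2"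
  where "J f j = vec2 (dplus (\<lambda>i. f i $ 2) j) (dminus (\<lambda>i. f i $ 1) j)"

definition dplus_inv :: "(int \<Rightarrow> real) \<Rightarrow> int \<Rightarrow> real"
  where "dplus_inv f j = (\<Sum>\<^sub>\<infinity>d\<in>{..-1}. f (j + d))"

definition dminus_inv :: "(int \<Rightarrow> real) \<Rightarrow> int \<Rightarrow> real"
  where "dminus_inv f j = (\<Sum>\<^sub>\<infinity>d\<in>{..0}. f (j + d))"

definition Jinv :: "(int \<Rightarrow> real^2) \<Rightarrow> int \<Rightarrow> real^2"
  where "Jinv f j = vec2 (dminus_inv (\<lambda>i. f i $ 2) j) (dplus_inv (\<lambda>i. f i $ 1) j)"

definition \<Omega> :: "(int \<Rightarrow> real^2) \<Rightarrow> (int \<Rightarrow> real^2) \<Rightarrow> real"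
  where "\<Omega> f g = (\<Sum>\<^sub>\<infinity>j. inner (Jinv f j) (g j))"

definition pairing :: "(int \<Rightarrow> real) \<Rightarrow> (int \<Rightarrow> real) \<Rightarrow> real"
  where "pairing f g = (\<Sum>\<^sub>\<infinity>j. f j * g j)"

definition unit_seq :: "int \<Rightarrow> int \<Rightarrow> real"
  where "unit_seq m j = (if j = m then 1 else 0)"


subsection \<open>Square summable sequences\<close>

definition in_l2 :: "(int \<Rightarrow> real^2) \<Rightarrow> bool"
  where "in_l2 f \<longleftrightarrow> (\<lambda>j. (norm (f j))\<^sup>2) summable_on UNIV"

definition l2_norm :: "(int \<Rightarrow> real^2) \<Rightarrow> real"
  where "l2_norm f = sqrt (\<Sum>\<^sub>\<infinity>j. (norm (f j))\<^sup>2)"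

definition weighted :: "real \<Rightarrow> real \<Rightarrow> (int \<Rightarrow> real^2) \<Rightarrow> int \<Rightarrow> real^2"
  where "weighted a x f j = exp (a * (real_of_int j - x)) *\<^sub>R f j"

definition in_l2a_Z2 :: "real \<Rightarrow> (int \<Rightarrow> int \<Rightarrow> real^2) \<Rightarrow> bool"
  where "in_l2a_Z2 a f \<longleftrightarrow>
    (\<lambda>(j, m). exp (2 * a * real_of_int j) * ((f j m $ 1)\<^sup>2 + (f j m $ 2)\<^sup>2)) summable_on UNIV"

lemma in_l2_0: "in_l2 (\<lambda>_. 0)"
  by (simp add: in_l2_def)

lemma in_l2_scaleR: "in_l2 f \<Longrightarrow> in_l2 (\<lambda>j. c *\<^sub>R f j)"
  unfolding in_l2_def by (simp add: power_mult_distrib summable_on_cmult_right)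

lemma in_l2_add:
  assumes "in_l2 f" "in_l2 g" shows "in_l2 (\<lambda>j. f j + g j)"
  unfolding in_l2_def
proof (rule summable_on_comparison_test)
  show "(\<lambda>j. 2 * (norm (f j))\<^sup>2 + 2 * (norm (g j))\<^sup>2) summable_on UNIV"
    using assms unfolding in_l2_def by (intro summable_on_add summable_on_cmult_right)
  fix j
  have "(norm (f j + g j))\<^sup>2 \<le> (norm (f j) + norm (g j))\<^sup>2"
    by (simp add: norm_triangle_ineq power_mono)
  also have "\<dots> \<le> 2 * (norm (f j))\<^sup>2 + 2 * (norm (g j))\<^sup>2"
    using zero_le_power2[of "norm (f j) - norm (g j)"]
    by (simp add: power2_sum power2_diff)
  finally show "(norm (f j + g j))\<^sup>2 \<le> 2 * (norm (f j))\<^sup>2 + 2 * (norm (g j))\<^sup>2" .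
qed simp

lemma in_l2_minus: "in_l2 f \<Longrightarrow> in_l2 (\<lambda>j. - f j)"
  by (simp add: in_l2_def)

lemma in_l2_diff: "in_l2 f \<Longrightarrow> in_l2 g \<Longrightarrow> in_l2 (\<lambda>j. f j - g j)"
  using in_l2_add[OF _ in_l2_minus, of f g] by simp

lemma in_l2_shift:
  assumes "in_l2 f" shows "in_l2 (\<lambda>j. f (j + d))"
proof -
  have "bij_betw (\<lambda>j. j + d) UNIV (UNIV :: int set)"
    by (rule bij_betw_byWitness[where f' = "\<lambda>j. j - d"]) auto
  from summable_on_reindex_bij_betw[OF this, of "\<lambda>j. (norm (f j))\<^sup>2"]
  show ?thesis using assms by (simp add: in_l2_def)
qed

lemma in_l2_le:
  assumes "in_l2 f" "\<And>j. norm (g j) \<le> norm (f j)" shows "in_l2 g"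
  using assms(1) unfolding in_l2_def
  by (rule summable_on_comparison_test) (auto simp: assms(2) power_mono)

lemma norm_real2: "norm (x :: real^2) = sqrt ((x $ 1)\<^sup>2 + (x $ 2)\<^sup>2)"
  by (simp add: norm_vec_def L2_set_def sum_2)

lemma in_l2_J:
  assumes "in_l2 f" shows "in_l2 (J f)"
proof -
  have p: "in_l2 (\<lambda>j. vec2 (f j $ 2) 0)" and r: "in_l2 (\<lambda>j. vec2 0 (f j $ 1))"
    by (rule in_l2_le[OF assms], simp add: norm_real2)+
  have "J f = (\<lambda>j. (vec2 (f (j + 1) $ 2) 0 - vec2 (f j $ 2) 0)
                 + (vec2 0 (f j $ 1) - vec2 0 (f (j + - 1) $ 1)))"
    by (simp add: fun_eq_iff J_def dplus_def dminus_def vec_eq_iff forall_2)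
  moreover have "in_l2 \<dots>"
    by (rule in_l2_add[OF in_l2_diff[OF in_l2_shift[OF p, of 1] p]
          in_l2_diff[OF r in_l2_shift[OF r, of "-1"]]])
  ultimately show ?thesis by simp
qed

lemma summable_inner_l2:
  assumes "in_l2 f" "in_l2 g" shows "(\<lambda>j. inner (f j) (g j)) summable_on UNIV"
proof (rule abs_summable_summable[OF Infinite_Sum.abs_summable_on_comparison_test'])
  show "(\<lambda>j. (norm (f j))\<^sup>2 + (norm (g j))\<^sup>2) summable_on UNIV"
    using assms unfolding in_l2_def by (rule summable_on_add)
  fix j
  have "norm (inner (f j) (g j)) \<le> norm (f j) * norm (g j)"
    using Cauchy_Schwarz_ineq2[of "f j" "g j"] by simp
  also have "\<dots> \<le> (norm (f j))\<^sup>2 + (norm (g j))\<^sup>2"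
    using zero_le_power2[of "norm (f j) - norm (g j)"] 
      zero_le_power2[of "norm (f j)"] zero_le_power2[of "norm (g j)"]
    unfolding power2_diff by linarith
  finally show "norm (inner (f j) (g j)) \<le> (norm (f j))\<^sup>2 + (norm (g j))\<^sup>2" .
qed


subsection \<open>The Hilbert space of square summable sequences\<close>

typedef ell2 = "{f. in_l2 f}" morphisms seq Abs_ell2
  using in_l2_0 by blast

setup_lifting type_definition_ell2

instantiation ell2 :: real_vector
begin

lift_definition zero_ell2 :: ell2 is "\<lambda>_. 0" by (rule in_l2_0)
lift_definition plus_ell2 :: "ell2 \<Rightarrow> ell2 \<Rightarrow> ell2" is "\<lambda>f g j. f j + g j" by (rule in_l2_add)
lift_definition uminus_ell2 :: "ell2 \<Rightarrow> ell2" is "\<lambda>f j. - f j" by (rule in_l2_minus)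
lift_definition minus_ell2 :: "ell2 \<Rightarrow> ell2 \<Rightarrow> ell2" is "\<lambda>f g j. f j - g j" by (rule in_l2_diff)
lift_definition scaleR_ell2 :: "real \<Rightarrow> ell2 \<Rightarrow> ell2" is "\<lambda>c f j. c *\<^sub>R f j" by (rule in_l2_scaleR)

instance
  by standard (transfer; simp add: algebra_simps scaleR_add_right scaleR_add_left)+

end

instantiation ell2 :: real_inner
begin

lift_definition inner_ell2 :: "ell2 \<Rightarrow> ell2 \<Rightarrow> real" is "\<lambda>f g. \<Sum>\<^sub>\<infinity>j. inner (f j) (g j)" .
lift_definition norm_ell2 :: "ell2 \<Rightarrow> real" is l2_norm .
definition sgn_ell2 :: "ell2 \<Rightarrow> ell2" where "sgn_ell2 x = x /\<^sub>R norm x"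
definition dist_ell2 :: "ell2 \<Rightarrow> ell2 \<Rightarrow> real" where "dist_ell2 x y = norm (x - y)"
definition uniformity_ell2 :: "(ell2 \<times> ell2) filter"
  where "uniformity_ell2 = (INF e\<in>{0<..}. principal {(x, y). dist x y < e})"
definition open_ell2 :: "ell2 set \<Rightarrow> bool"
  where "open_ell2 U \<longleftrightarrow> (\<forall>x\<in>U. \<forall>\<^sub>F (x', y) in uniformity. x' = x \<longrightarrow> y \<in> U)"

instance
proof
  fix x y z :: ell2 and c :: real and U :: "ell2 set"
  show "dist x y = norm (x - y)" by (rule dist_ell2_def)
  show "sgn x = x /\<^sub>R norm x" by (rule sgn_ell2_def)
  show "uniformity = (INF e\<in>{0<..}. principal {(x, y :: ell2). dist x y < e})"
    by (rule uniformity_ell2_def)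
  show "open U \<longleftrightarrow> (\<forall>x\<in>U. \<forall>\<^sub>F (x', y) in uniformity. x' = x \<longrightarrow> y \<in> U)"
    by (rule open_ell2_def)
  show "inner x y = inner y x" by transfer (simp add: inner_commute)
  show "inner (x + y) z = inner x z + inner y z"
    by transfer (simp add: inner_add_left infsum_add summable_inner_l2)
  show "inner (c *\<^sub>R x) y = c * inner x y"
    by transfer (simp add: infsum_cmult_right')
  show "0 \<le> inner x x" by transfer (simp add: infsum_nonneg)
  show "inner x x = 0 \<longleftrightarrow> x = 0"
  proof transfer
    fix f :: "int \<Rightarrow> real^2" assume f: "in_l2 f"
    show "(\<Sum>\<^sub>\<infinity>j. inner (f j) (f j)) = 0 \<longleftrightarrow> f = (\<lambda>_. 0)"
    proof
      assume "(\<Sum>\<^sub>\<infinity>j. inner (f j) (f j)) = 0"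
      then have "inner (f j) (f j) = 0" for j
        using nonneg_infsum_le_0D[OF _ summable_inner_l2[OF f f], of j] by simp
      then show "f = (\<lambda>_. 0)" by auto
    qed simp
  qed
  show "norm x = sqrt (inner x x)"
    by transfer (simp add: l2_norm_def dot_square_norm)
qed

end

lemma norm_seq_le: "norm (seq x j) \<le> norm (x :: ell2)"
proof transfer
  fix f :: "int \<Rightarrow> real^2" and j assume "in_l2 f"
  then have "sum (\<lambda>j. (norm (f j))\<^sup>2) {j} \<le> (\<Sum>\<^sub>\<infinity>j. (norm (f j))\<^sup>2)"
    unfolding in_l2_def by (intro finite_sum_le_infsum) auto
  then show "norm (f j) \<le> l2_norm f"
    unfolding l2_norm_def by (intro real_le_rsqrt) simp
qed

lemma sum_norm_seq_le:
  assumes "finite F" shows "(\<Sum>j\<in>F. (norm (seq x j))\<^sup>2) \<le> (norm (x :: ell2))\<^sup>2"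
  using assms
proof transfer
  fix F :: "int set" and f :: "int \<Rightarrow> real^2" assume "finite F" "in_l2 f"
  then have "(\<Sum>j\<in>F. (norm (f j))\<^sup>2) \<le> (\<Sum>\<^sub>\<infinity>j. (norm (f j))\<^sup>2)"
    unfolding in_l2_def by (intro finite_sum_le_infsum) auto
  then show "(\<Sum>j\<in>F. (norm (f j))\<^sup>2) \<le> (l2_norm f)\<^sup>2"
    unfolding l2_norm_def by (simp add: infsum_nonneg)
qed

instance ell2 :: banach
proof
  fix X :: "nat \<Rightarrow> ell2" assume C: "Cauchy X"
  have diff: "seq (x - y) j = seq x j - seq y j" for x y j
    by (simp add: minus_ell2.rep_eq)
  have "convergent (\<lambda>n. seq (X n) j)" for j
  proof (rule Cauchy_convergent, rule metric_CauchyI)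
    fix e :: real assume "e > 0"
    with C obtain N where N: "\<And>m n. m \<ge> N \<Longrightarrow> n \<ge> N \<Longrightarrow> dist (X m) (X n) < e"
      unfolding Cauchy_def by blast
    have "dist (seq (X m) j) (seq (X n) j) < e" if "m \<ge> N" "n \<ge> N" for m n
      using N[OF that] norm_seq_le[of "X m - X n" j] by (simp add: dist_norm diff)
    then show "\<exists>N. \<forall>m\<ge>N. \<forall>n\<ge>N. dist (seq (X m) j) (seq (X n) j) < e" by blast
  qed
  then obtain g where g: "\<And>j. (\<lambda>n. seq (X n) j) \<longlonglongrightarrow> g j"
    unfolding convergent_def by metis
  have tail: "\<exists>N. \<forall>n\<ge>N. \<forall>F. finite F \<longrightarrow> (\<Sum>j\<in>F. (norm (seq (X n) j - g j))\<^sup>2) \<le> e\<^sup>2"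
    if "e > 0" for e :: real
  proof -
    from C that obtain N where N: "\<And>m n. m \<ge> N \<Longrightarrow> n \<ge> N \<Longrightarrow> dist (X m) (X n) < e"
      unfolding Cauchy_def by blast
    have "(\<Sum>j\<in>F. (norm (seq (X n) j - g j))\<^sup>2) \<le> e\<^sup>2" if "n \<ge> N" "finite F" for n F
    proof (rule LIMSEQ_le_const2)
      show "(\<lambda>m. \<Sum>j\<in>F. (norm (seq (X n) j - seq (X m) j))\<^sup>2)
              \<longlonglongrightarrow> (\<Sum>j\<in>F. (norm (seq (X n) j - g j))\<^sup>2)"
        by (intro tendsto_intros g)
      have "(\<Sum>j\<in>F. (norm (seq (X n) j - seq (X m) j))\<^sup>2) \<le> e\<^sup>2" if "m \<ge> N" for m
      proof -
        have "(\<Sum>j\<in>F. (norm (seq (X n) j - seq (X m) j))\<^sup>2) \<le> (norm (X n - X m))\<^sup>2"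
          using sum_norm_seq_le[OF \<open>finite F\<close>, of "X n - X m"] by (simp add: diff)
        also have "\<dots> \<le> e\<^sup>2"
          using N[OF \<open>n \<ge> N\<close> that] by (intro power_mono) (auto simp: dist_norm)
        finally show ?thesis .
      qed
      then show "\<exists>N. \<forall>m\<ge>N. (\<Sum>j\<in>F. (norm (seq (X n) j - seq (X m) j))\<^sup>2) \<le> e\<^sup>2" by blast
    qed
    then show ?thesis by blast
  qed
  have l2: "in_l2 h \<and> l2_norm h \<le> e"
    if "e > 0" "\<And>F. finite F \<Longrightarrow> (\<Sum>j\<in>F. (norm (h j))\<^sup>2) \<le> e\<^sup>2" for h and e :: real
  proof -
    have s: "(\<lambda>j. (norm (h j))\<^sup>2) summable_on UNIV"
      by (rule nonneg_bdd_above_summable_on) (auto intro!: bdd_aboveI[where M = "e\<^sup>2"] that(2))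
    then have "(\<Sum>\<^sub>\<infinity>j. (norm (h j))\<^sup>2) \<le> e\<^sup>2"
      by (rule infsum_le_finite_sums) (rule that(2))
    then show ?thesis
      using s \<open>e > 0\<close> unfolding in_l2_def l2_norm_def by (simp add: real_le_lsqrt infsum_nonneg)
  qed
  obtain n1 where "\<And>F. finite F \<Longrightarrow> (\<Sum>j\<in>F. (norm (seq (X n1) j - g j))\<^sup>2) \<le> 1\<^sup>2"
    using tail[of 1] by auto
  then have "in_l2 (\<lambda>j. seq (X n1) j - g j)" using l2[of 1] by simp
  then have "in_l2 (\<lambda>j. seq (X n1) j - (seq (X n1) j - g j))"
    by (rule in_l2_diff[OF seq[simplified]])
  then have ing: "in_l2 g" by simp
  have "X \<longlonglongrightarrow> Abs_ell2 g"
  proof (rule metric_LIMSEQ_I)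
    fix e :: real assume "e > 0"
    then obtain N where N: "\<And>n F. n \<ge> N \<Longrightarrow> finite F \<Longrightarrow>
        (\<Sum>j\<in>F. (norm (seq (X n) j - g j))\<^sup>2) \<le> (e / 2)\<^sup>2"
      using tail[of "e / 2"] by auto
    have "dist (X n) (Abs_ell2 g) < e" if "n \<ge> N" for n
    proof -
      have "l2_norm (\<lambda>j. seq (X n) j - g j) \<le> e / 2"
        using l2[of "e / 2"] \<open>e > 0\<close> N[OF that] by simp
      then show ?thesis
        using \<open>e > 0\<close> ing
        by (simp add: dist_norm norm_ell2.rep_eq minus_ell2.rep_eq Abs_ell2_inverse)
    qed
    then show "\<exists>N. \<forall>n\<ge>N. dist (X n) (Abs_ell2 g) < e" by blast
  qed
  then show "convergent X" unfolding convergent_def by blast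
qed

lift_definition J_ell2 :: "ell2 \<Rightarrow> ell2" is J
  by (rule in_l2_J)

lift_definition shift_ell2 :: "int \<Rightarrow> ell2 \<Rightarrow> ell2" is "\<lambda>d f j. f (j + d)"
  by (rule in_l2_shift)


subsection \<open>Evolution families\<close>

definition evolution_family :: "(real \<Rightarrow> real \<Rightarrow> 'a::real_normed_vector \<Rightarrow> 'a) \<Rightarrow> bool"
  where "evolution_family U \<longleftrightarrow>
    (\<forall>s t. s \<le> t \<longrightarrow> bounded_linear (U t s)) \<and>
    (\<forall>s w. U s s w = w) \<and>
    (\<forall>s r t w. s \<le> r \<longrightarrow> r \<le> t \<longrightarrow> U t r (U r s w) = U t s w) \<and>
    (\<forall>w. continuous_on {(t, s). s \<le> t} (\<lambda>(t, s). U t s w))"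

definition generates :: "(real \<Rightarrow> 'a::real_normed_vector \<Rightarrow> 'a) \<Rightarrow> (real \<Rightarrow> real \<Rightarrow> 'a \<Rightarrow> 'a) \<Rightarrow> bool"
  where "generates G U \<longleftrightarrow> evolution_family U \<and>
    (\<forall>s t w. s \<le> t \<longrightarrow> ((\<lambda>\<tau>. U \<tau> s w) has_vector_derivative G t (U t s w)) (at t within {s..}))"


subsection \<open>Expectation\<close>

text \<open>Solutions of the random differential equations are determined only almost surely, so
  expectations are taken over the completion. For measurable random variables this is the usual
  integral, by \<open>integral_completion\<close>.\<close>

abbreviation expect :: "'w measure \<Rightarrow> ('w \<Rightarrow> 'b::{banach, second_countable_topology}) \<Rightarrow> 'b"
  where "expect P X \<equiv> (\<integral>\<omega>. X \<omega> \<partial>completion P)"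


subsection \<open>Families of solitary waves\<close>

text \<open>\<open>\<phi> c x\<close> is the profile with speed \<open>c\<close> at \<open>x\<close>, and \<open>cp\<close> is the largest admissible speed. The
  locale only fixes the two parameters; the properties of the family are collected in the predicates
  \<open>solitary_waves\<close> and \<open>localized\<close>.

  Speeds range over \<open>{1<..cp}\<close>, so \<open>c\<close>-derivatives are taken within this set: one-sided at \<open>cp\<close>,
  two-sided elsewhere.\<close>

locale waves =
  fixes cp :: real and \<phi> :: "real \<Rightarrow> real \<Rightarrow> real^2"
begin

definition r :: "real \<Rightarrow> real \<Rightarrow> real" where "r c x = \<phi> c x $ 1"
definition p :: "real \<Rightarrow> real \<Rightarrow> real" where "p c x = \<phi> c x $ 2"

definition D\<xi> :: "(real \<Rightarrow> real \<Rightarrow> 'b::real_normed_vector) \<Rightarrow> real \<Rightarrow> real \<Rightarrow> 'b"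
  where "D\<xi> F \<xi> c = vector_derivative (\<lambda>x. F x c) (at \<xi>)"

definition Dc :: "(real \<Rightarrow> real \<Rightarrow> 'b::real_normed_vector) \<Rightarrow> real \<Rightarrow> real \<Rightarrow> 'b"
  where "Dc F \<xi> c = vector_derivative (\<lambda>s. F \<xi> s) (at c within {1<..cp})"

definition wave :: "int \<Rightarrow> real \<Rightarrow> real \<Rightarrow> real^2"
  where "wave j \<xi> c = \<phi> c (real_of_int j - \<xi>)"

definition rwave :: "int \<Rightarrow> real \<Rightarrow> real \<Rightarrow> real"
  where "rwave j \<xi> c = r c (real_of_int j - \<xi>)"

definition \<phi>\<xi> :: "real \<Rightarrow> real \<Rightarrow> int \<Rightarrow> real^2" where "\<phi>\<xi> \<xi> c j = D\<xi> (wave j) \<xi> c"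
definition \<phi>c :: "real \<Rightarrow> real \<Rightarrow> int \<Rightarrow> real^2" where "\<phi>c \<xi> c j = Dc (wave j) \<xi> c"
definition \<phi>\<xi>\<xi> :: "real \<Rightarrow> real \<Rightarrow> int \<Rightarrow> real^2" where "\<phi>\<xi>\<xi> \<xi> c j = D\<xi> (D\<xi> (wave j)) \<xi> c"
definition \<phi>c\<xi> :: "real \<Rightarrow> real \<Rightarrow> int \<Rightarrow> real^2" where "\<phi>c\<xi> \<xi> c j = Dc (D\<xi> (wave j)) \<xi> c"
definition \<phi>\<xi>c :: "real \<Rightarrow> real \<Rightarrow> int \<Rightarrow> real^2" where "\<phi>\<xi>c \<xi> c j = D\<xi> (Dc (wave j)) \<xi> c"
definition \<phi>cc :: "real \<Rightarrow> real \<Rightarrow> int \<Rightarrow> real^2" where "\<phi>cc \<xi> c j = Dc (Dc (wave j)) \<xi> c"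

definition \<alpha>0 :: "real \<Rightarrow> real"
  where "\<alpha>0 c = 1 / c * vector_derivative
    (\<lambda>s. \<Sum>\<^sub>\<infinity>j::int. 1/2 * (p s (real_of_int j))\<^sup>2 + 1/2 * (r s (real_of_int j))\<^sup>2
                         + 1/3 * (r s (real_of_int j))^3)
    (at c within {1<..cp})"

definition \<alpha>1 :: "real \<Rightarrow> real"
  where "\<alpha>1 c = - vector_derivative (\<lambda>s. LBINT x. r s x) (at c within {1<..cp})
    * vector_derivative (\<lambda>s. s * (LBINT x. r s x)) (at c within {1<..cp})"

definition A :: "real \<Rightarrow> real^2^2"
  where "A c = vector [vec2 0 (\<alpha>0 c), vec2 (- \<alpha>0 c) (\<alpha>1 c)]"

text \<open>\<open>d k l c x\<close> is the mixed derivative of \<open>\<phi> c x\<close> of order \<open>k\<close> in \<open>x\<close> and \<open>l\<close> in \<open>c\<close>; such a \<open>d\<close>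
  exists iff \<open>\<phi>\<close> is jointly smooth, and it is then unique on the admissible speeds.\<close>

definition all_derivatives :: "(nat \<Rightarrow> nat \<Rightarrow> real \<Rightarrow> real \<Rightarrow> real^2) \<Rightarrow> bool"
  where "all_derivatives d \<longleftrightarrow>
    (\<forall>c\<in>{1<..cp}. \<forall>x. d 0 0 c x = \<phi> c x) \<and>
    (\<forall>k l. continuous_on ({1<..cp} \<times> UNIV) (\<lambda>(c, x). d k l c x)) \<and>
    (\<forall>k l. \<forall>c\<in>{1<..cp}. \<forall>x.
       ((\<lambda>y. d k l c y) has_vector_derivative d (Suc k) l c x) (at x) \<and>
       ((\<lambda>s. d k l s x) has_vector_derivative d k (Suc l) c x) (at c within {1<..cp}))"

text \<open>The last clause says that the matrix of symplectic products of the tangent vectors is \<open>A c\<close>.\<close>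

definition solitary_waves :: bool
  where "solitary_waves \<longleftrightarrow>
    cp > 1 \<and>
    (\<exists>d. all_derivatives d) \<and>
    (\<forall>c\<in>{1<..cp}. \<exists>K. \<exists>\<beta>>0. \<forall>x. norm (\<phi> c x) \<le> K * exp (- \<beta> * \<bar>x\<bar>)) \<and>
    (\<forall>c\<in>{1<..cp}. \<forall>x. - c *\<^sub>R vector_derivative (\<phi> c) (at x)
                         = J (\<lambda>y. vec2 (r c y + (r c y)\<^sup>2) (p c y)) x) \<and>
    (\<forall>c\<in>{1<..cp}. \<alpha>0 c > 0) \<and>
    (\<forall>c\<in>{1<..cp}. \<forall>\<xi>.
       vector [vec2 (\<Omega> (\<phi>\<xi> \<xi> c) (\<phi>\<xi> \<xi> c)) (\<Omega> (\<phi>\<xi> \<xi> c) (\<phi>c \<xi> c)),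
               vec2 (\<Omega> (\<phi>c \<xi> c) (\<phi>\<xi> \<xi> c)) (\<Omega> (\<phi>c \<xi> c) (\<phi>c \<xi> c))] = A c)"

text \<open>The rate \<open>\<beta>\<close> and the constants \<open>K\<close> are uniform in the speeds from \<open>cm\<close> to \<open>cp\<close>.\<close>

definition localized :: "real \<Rightarrow> real \<Rightarrow> bool"
  where "localized a cm \<longleftrightarrow>
    (\<exists>d \<beta>. all_derivatives d \<and> \<beta> > a \<and>
       (\<forall>k l. \<exists>K. \<forall>c\<in>{cm..cp}. \<forall>x. norm (d k l c x) \<le> K * exp (- \<beta> * \<bar>x\<bar>)))"

text \<open>The linear stability theorem with weight \<open>a\<close>. The solution \<open>w\<close> lives in the weighted space only:
  \<open>W t\<close> is the sequence \<open>e\<^sup>a\<^sup>\<cdot> w t\<close>, and the equation is differentiated in the norm of that space.\<close>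

definition stability_weight :: "real \<Rightarrow> real \<Rightarrow> bool"
  where "stability_weight a cm \<longleftrightarrow>
    (\<exists>b>0. \<exists>K>0. \<forall>c\<in>{cm..cp}. \<forall>(w :: real \<Rightarrow> int \<Rightarrow> real^2) (W :: real \<Rightarrow> ell2).
       (\<forall>t\<ge>0. seq (W t) = weighted a 0 (w t)) \<longrightarrow>
       (\<forall>t\<ge>0. \<exists>W'. (W has_vector_derivative W') (at t within {0..}) \<and>
          seq W' = weighted a 0
            (J (\<lambda>j. vec2 (w t j $ 1 + 2 * r c (real_of_int j - c * t) * w t j $ 1) (w t j $ 2)))) \<longrightarrow>
       \<Omega> (\<phi>\<xi> 0 c) (w 0) = 0 \<longrightarrow> \<Omega> (\<phi>c 0 c) (w 0) = 0 \<longrightarrow>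
       (\<forall>t\<ge>0. l2_norm (weighted a (c * t) (w t)) \<le> K * exp (- b * t) * l2_norm (weighted a 0 (w 0))))"


subsection \<open>Expansion maps\<close>

definition V :: "real \<Rightarrow> real \<Rightarrow> (int \<Rightarrow> real) \<Rightarrow> real^2"
  where "V \<xi> c f = - (1/2) *\<^sub>R (matrix_inv (A c) *v
    vec2 (pairing (\<lambda>j. D\<xi> (\<lambda>\<xi> c. (rwave j \<xi> c)\<^sup>2) \<xi> c) f)
         (pairing (\<lambda>j. Dc (\<lambda>\<xi> c. (rwave j \<xi> c)\<^sup>2) \<xi> c) f))"

definition \<Gamma>10 :: "real \<Rightarrow> real \<Rightarrow> (int \<Rightarrow> real) \<Rightarrow> real" where "\<Gamma>10 \<xi> c f = V \<xi> c f $ 1"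
definition C10 :: "real \<Rightarrow> real \<Rightarrow> (int \<Rightarrow> real) \<Rightarrow> real" where "C10 \<xi> c f = V \<xi> c f $ 2"

text \<open>\<open>\<Gamma>C02\<close> and \<open>\<Gamma>C11\<close> are the vectors with components \<open>\<Gamma>, C\<close> of the indicated order.\<close>

definition \<Gamma>C02 :: "real \<Rightarrow> real \<Rightarrow> (int \<Rightarrow> real) \<Rightarrow> (int \<Rightarrow> real) \<Rightarrow> real^2"
  where "\<Gamma>C02 \<xi> c f g = - (matrix_inv (A c) *v
    vec2 (pairing (\<lambda>j. D\<xi> (rwave j) \<xi> c) (\<lambda>j. f j * g j))
         (pairing (\<lambda>j. Dc (rwave j) \<xi> c) (\<lambda>j. f j * g j)))"

definition B :: "real \<Rightarrow> real \<Rightarrow> (int \<Rightarrow> real^2) \<Rightarrow> real^2^2"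
  where "B \<xi> c h = vector [vec2 (\<Omega> (\<phi>\<xi>\<xi> \<xi> c) h) (\<Omega> (\<phi>c\<xi> \<xi> c) h),
                          vec2 (\<Omega> (\<phi>\<xi>c \<xi> c) h) (\<Omega> (\<phi>cc \<xi> c) h)]"

definition \<Gamma>C11 :: "real \<Rightarrow> real \<Rightarrow> (int \<Rightarrow> real) \<Rightarrow> (int \<Rightarrow> real^2) \<Rightarrow> real^2"
  where "\<Gamma>C11 \<xi> c f h =
    matrix_inv (A c) *v (B \<xi> c h *v V \<xi> c f) + \<Gamma>C02 \<xi> c f (\<lambda>j. h j $ 1)"

definition T10 :: "real \<Rightarrow> real \<Rightarrow> (int \<Rightarrow> real) \<Rightarrow> int \<Rightarrow> real^2"
  where "T10 \<xi> c f j = - \<Gamma>10 \<xi> c f *\<^sub>R \<phi>\<xi> \<xi> c j - C10 \<xi> c f *\<^sub>R \<phi>c \<xi> c j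
    + vec2 0 (dminus (\<lambda>i. f i * rwave i \<xi> c) j)"


subsection \<open>The linear stability hypothesis\<close>

text \<open>\<open>\<A> \<xi>\<close> is the operator with index \<open>\<xi>, cs\<close>; only \<open>\<xi> = cs * t\<close> occurs.\<close>

definition LS :: "real \<Rightarrow> real \<Rightarrow> (real \<Rightarrow> ell2 \<Rightarrow> ell2) \<Rightarrow> bool"
  where "LS a cs \<A> \<longleftrightarrow>
    (\<forall>t. bounded_linear (\<A> (cs * t))) \<and>
    (\<forall>t \<eta> j d. seq (\<A> (cs * t) \<eta>) (j + d) = seq (\<A> (cs * t - real_of_int d) (shift_ell2 d \<eta>)) j) \<and>
    (\<exists>U. generates (\<lambda>t w. J_ell2 (\<A> (cs * t) w)) U \<and>
      (\<exists>K>0. \<exists>b>0. \<forall>s t w. s \<le> t \<longrightarrow> in_l2 (weighted a (cs * s) (seq w)) \<longrightarrow>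
         \<Omega> (\<phi>\<xi> (cs * s) cs) (seq w) = 0 \<longrightarrow> \<Omega> (\<phi>c (cs * s) cs) (seq w) = 0 \<longrightarrow>
         in_l2 (weighted a (cs * t) (seq (U t s w))) \<and>
         l2_norm (weighted a (cs * t) (seq (U t s w)))
           \<le> K * exp (- b * (t - s)) * l2_norm (weighted a (cs * s) (seq w))))"


subsection \<open>Tail, phase and amplitude equations\<close>

definition solves_tail :: "real \<Rightarrow> (real \<Rightarrow> ell2 \<Rightarrow> ell2) \<Rightarrow> (int \<Rightarrow> real) \<Rightarrow> (real \<Rightarrow> ell2) \<Rightarrow> bool"
  where "solves_tail cs \<A> f x \<longleftrightarrow> x 0 = 0 \<and>
    (\<forall>t\<ge>0. \<exists>x'. (x has_vector_derivative x') (at t within {0..}) \<and>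
       seq x' = (\<lambda>j. seq (J_ell2 (\<A> (cs * t) (x t))) j + T10 (cs * t) cs f j))"

definition solves_first :: "real \<Rightarrow> (int \<Rightarrow> real) \<Rightarrow> (real \<Rightarrow> real) \<Rightarrow> (real \<Rightarrow> real) \<Rightarrow> bool"
  where "solves_first cs f \<gamma>1 c1 \<longleftrightarrow> \<gamma>1 0 = 0 \<and> c1 0 = 0 \<and>
    (\<forall>t\<ge>0. ((\<lambda>s. vec2 (\<gamma>1 s) (c1 s)) has_vector_derivative V (cs * t) cs f) (at t within {0..}))"

definition solves_second ::
    "real \<Rightarrow> (int \<Rightarrow> real) \<Rightarrow> (real \<Rightarrow> ell2) \<Rightarrow> (real \<Rightarrow> real) \<Rightarrow> (real \<Rightarrow> real)
      \<Rightarrow> (real \<Rightarrow> real) \<Rightarrow> (real \<Rightarrow> real) \<Rightarrow> bool"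
  where "solves_second cs f \<eta> \<gamma>1 c1 \<gamma>2 c2 \<longleftrightarrow> \<gamma>2 0 = 0 \<and> c2 0 = 0 \<and>
    (\<forall>t\<ge>0. ((\<lambda>s. vec2 (\<gamma>2 s) (c2 s)) has_vector_derivative
       (\<gamma>1 t + (LBINT s=0..t. c1 s)) *\<^sub>R D\<xi> (\<lambda>\<xi> c. V \<xi> c f) (cs * t) cs
       + c1 t *\<^sub>R Dc (\<lambda>\<xi> c. V \<xi> c f) (cs * t) cs
       + \<Gamma>C11 (cs * t) cs f (seq (\<eta> t))
       + \<Gamma>C02 (cs * t) cs (\<lambda>j. seq (\<eta> t) j $ 1) (\<lambda>j. seq (\<eta> t) j $ 1)) (at t within {0..}))"


subsection \<open>The maps in the expected drift\<close>

definition M11 :: "real \<Rightarrow> real \<Rightarrow> (int \<Rightarrow> int \<Rightarrow> real^2) \<Rightarrow> real^2"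
  where "M11 \<xi> c f = (\<Sum>\<^sub>\<infinity>m. \<Gamma>C11 \<xi> c (unit_seq m) (\<lambda>j. f j m))"

definition M02 :: "real \<Rightarrow> real \<Rightarrow> (int \<Rightarrow> int \<Rightarrow> real^2) \<Rightarrow> (int \<Rightarrow> int \<Rightarrow> real^2) \<Rightarrow> real^2"
  where "M02 \<xi> c f g = (\<Sum>\<^sub>\<infinity>m. \<Gamma>C02 \<xi> c (\<lambda>j. f j m $ 1) (\<lambda>j. g j m $ 1))"

text \<open>Below, \<open>\<kappa> j \<omega>\<close> is the random coefficient at site \<open>j\<close>; \<open>LBINT s=0..\<xi>\<close> is an oriented integral.\<close>

definition M10_I :: "'w measure \<Rightarrow> (int \<Rightarrow> 'w \<Rightarrow> real) \<Rightarrow> real \<Rightarrow> real \<Rightarrow> real^2"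
  where "M10_I P \<kappa> \<xi> c = - (\<alpha>1 c / (2 * c * (\<alpha>0 c)\<^sup>2)) *\<^sub>R expect P (\<lambda>\<omega>.
    (\<Sum>\<^sub>\<infinity>j. \<kappa> j \<omega> * ((r c (real_of_int j - \<xi>))\<^sup>2 - (r c (real_of_int j))\<^sup>2))
      *\<^sub>R D\<xi> (\<lambda>\<xi> c. V \<xi> c (\<lambda>j. \<kappa> j \<omega>)) \<xi> c)"

definition M10_II :: "'w measure \<Rightarrow> (int \<Rightarrow> 'w \<Rightarrow> real) \<Rightarrow> real \<Rightarrow> real \<Rightarrow> real^2"
  where "M10_II P \<kappa> \<xi> c = (1 / (2 * c * \<alpha>0 c)) *\<^sub>R expect P (\<lambda>\<omega>.
    (\<Sum>\<^sub>\<infinity>j. \<kappa> j \<omega> * (LBINT s=0..\<xi>. Dc (\<lambda>x c. (r c x)\<^sup>2) (real_of_int j - s) c))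
      *\<^sub>R D\<xi> (\<lambda>\<xi> c. V \<xi> c (\<lambda>j. \<kappa> j \<omega>)) \<xi> c)"

definition M10_III :: "'w measure \<Rightarrow> (int \<Rightarrow> 'w \<Rightarrow> real) \<Rightarrow> real \<Rightarrow> real \<Rightarrow> real^2"
  where "M10_III P \<kappa> \<xi> c = - (1 / (2 * c\<^sup>2 * \<alpha>0 c)) *\<^sub>R expect P (\<lambda>\<omega>.
    (\<Sum>\<^sub>\<infinity>j. \<kappa> j \<omega> * ((LBINT s=0..\<xi>. (r c (real_of_int j - s))\<^sup>2) - \<xi> * (r c (real_of_int j))\<^sup>2))
      *\<^sub>R D\<xi> (\<lambda>\<xi> c. V \<xi> c (\<lambda>j. \<kappa> j \<omega>)) \<xi> c)"

definition M10_IV :: "'w measure \<Rightarrow> (int \<Rightarrow> 'w \<Rightarrow> real) \<Rightarrow> real \<Rightarrow> real \<Rightarrow> real^2"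
  where "M10_IV P \<kappa> \<xi> c = - (1 / (2 * c * \<alpha>0 c)) *\<^sub>R expect P (\<lambda>\<omega>.
    (\<Sum>\<^sub>\<infinity>j. \<kappa> j \<omega> * ((r c (real_of_int j - \<xi>))\<^sup>2 - (r c (real_of_int j))\<^sup>2))
      *\<^sub>R Dc (\<lambda>\<xi> c. V \<xi> c (\<lambda>j. \<kappa> j \<omega>)) \<xi> c)"

definition M10 :: "'w measure \<Rightarrow> (int \<Rightarrow> 'w \<Rightarrow> real) \<Rightarrow> real \<Rightarrow> real \<Rightarrow> real^2"
  where "M10 P \<kappa> \<xi> c = M10_I P \<kappa> \<xi> c + M10_II P \<kappa> \<xi> c + M10_III P \<kappa> \<xi> c + M10_IV P \<kappa> \<xi> c"

end

end

theory Submission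
  imports Defs
begin

text \<open>By linearity the tail is \<open>\<eta> t = (\<Sum>m. \<kappa> m *\<^sub>R R m t)\<close>. To justify this, let \<open>z\<close> solve the tail
  equation with coefficients \<open>f\<close>. The right difference quotients of \<open>s \<mapsto> U t s (z s)\<close> are controlled
  by the inhomogeneity alone, because \<open>U t (s + h) \<circ> U (s + h) s = U t s\<close>, and the evolution family is
  locally bounded by the uniform boundedness principle. Hence
  \<open>norm (z t) \<le> C * (\<Sum>j. \<bar>f j\<bar> * exp (- \<beta> * \<bar>j\<bar>))\<close>, so \<open>R m t\<close> decays exponentially in \<open>m\<close> and the series
  converges absolutely. Interpolating this bound with the weighted one on \<open>R\<close> gives decay to the
  right in \<open>j\<close> as well, which makes the symplectic products with \<open>R m t\<close> absolutely convergent.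

  The terms with \<open>\<Gamma>C11\<close> and \<open>\<Gamma>C02\<close> are therefore absolutely convergent double series in
  \<open>\<kappa> m * \<kappa> n\<close>, of which the expectation keeps the diagonal; these diagonals are \<open>M11\<close> and \<open>M02\<close>.
  In the remaining terms, the inverse of \<open>A c\<close> is explicit, and integrating \<open>V\<close> along \<open>\<xi> = c * t\<close>
  produces the four integrands of \<open>M10\<close> for almost every realization. The \<open>c\<close>-derivative of
  \<open>V\<close> requires that \<open>\<alpha>0\<close> and \<open>\<alpha>1\<close> be differentiable, which follows by differentiating the defining
  sum and integral.\<close>

section \<open>Absolutely convergent sums\<close>

text \<open>The coefficients are bounded but do not decay, so all convergence comes from the waves.
  Dependence on the coefficients is measured by \<open>wsum f\<close>, which equals
  \<open>weight m\<close> on \<open>unit_seq m\<close> and tends to zero when the coefficients are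
  set to zero on growing finite sets. The series for the tail therefore needs no limit passage in
  the equation: the remainder after finitely many terms solves the same equation with truncated
  coefficients, and one bound, with a constant independent of the coefficients, makes it small.

  The matrices of the quadratic forms do not depend on the realization and are dominated by
  \<open>h m * h n\<close>. This single dominating series justifies both the rearrangements for a
  fixed realization and the exchange with the expectation. The rate in \<open>h\<close> is only
  \<open>\<beta> / 2\<close>, the price of the interpolation; on the diagonal the two factors
  restore the rate \<open>\<beta>\<close>.

  Everything derived from \<open>V\<close> is written in lattice sums \<open>Q\<close>, on which
  differentiation only shifts indices. The correction equations are then solved by naming an
  antiderivative and invoking uniqueness.\<close>

lemma
  fixes f :: "'i \<Rightarrow> 'b::banach"
  assumes "b summable_on I" "\<And>i. i \<in> I \<Longrightarrow> norm (f i) \<le> b i"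
  shows summable_on_dominated: "f summable_on I"
    and norm_infsum_le_infsum: "norm (infsum f I) \<le> infsum b I"
proof -
  show *: "f summable_on I"
    by (rule abs_summable_summable, rule Infinite_Sum.abs_summable_on_comparison_test'[OF assms(1)]) (rule assms)
  show "norm (infsum f I) \<le> infsum b I"
    by (rule norm_infsum_le[OF has_sum_infsum[OF *] has_sum_infsum[OF assms(1)] assms(2)])
qed

lemma infsum_bounded_linear_image:
  assumes "bounded_linear h" "f summable_on I"
  shows "infsum (\<lambda>i. h (f i)) I = h (infsum f I)"
  using has_sum_bounded_linear[OF assms(1) has_sum_infsum[OF assms(2)]] by (rule infsumI)

lemma summable_on_product:
  fixes f :: "'i \<Rightarrow> real" and g :: "'j \<Rightarrow> real"
  assumes "f summable_on UNIV" "g summable_on UNIV" "\<And>i. 0 \<le> f i" "\<And>j. 0 \<le> g j"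
  shows "(\<lambda>(i, j). f i * g j) summable_on UNIV"
proof -
  have "(\<lambda>(i, j). f i * g j) summable_on UNIV \<times> UNIV"
  proof (rule summable_on_SigmaI)
    show "((\<lambda>j. case (i, j) of (i, j) \<Rightarrow> f i * g j) has_sum f i * infsum g UNIV) UNIV" for i
      using assms(2) by (auto intro!: has_sum_cmult_right)
    show "(\<lambda>i. f i * infsum g UNIV) summable_on UNIV"
      using assms(1) by (rule summable_on_cmult_left)
  qed (use assms in auto)
  then show ?thesis by simp
qed

lemma bounded_bilinear_infsum:
  fixes x :: "'i \<Rightarrow> 'a::banach" and y :: "'j \<Rightarrow> 'b::banach" and h :: "'a \<Rightarrow> 'b \<Rightarrow> 'c::banach"
  assumes h: "bounded_bilinear h"
    and b: "b summable_on UNIV" "\<And>i. norm (x i) \<le> b i"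
    and e: "e summable_on UNIV" "\<And>j. norm (y j) \<le> e j"
  shows "(\<lambda>(i, j). h (x i) (y j)) summable_on UNIV"
    and "h (\<Sum>\<^sub>\<infinity>i. x i) (\<Sum>\<^sub>\<infinity>j. y j) = (\<Sum>\<^sub>\<infinity>(i, j). h (x i) (y j))"
proof -
  interpret bounded_bilinear h by fact
  obtain K where K: "0 < K" "\<And>a b. norm (h a b) \<le> norm a * norm b * K"
    using pos_bounded by blast
  have b0: "0 \<le> b i" for i using b(2)[of i] norm_ge_zero[of "x i"] by linarith
  have e0: "0 \<le> e j" for j using e(2)[of j] norm_ge_zero[of "y j"] by linarith
  have "(\<lambda>(i, j). b i * (K * e j)) summable_on UNIV"
    by (intro summable_on_product b summable_on_cmult_right e b0 mult_nonneg_nonneg e0)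
       (use K in auto)
  then show s: "(\<lambda>(i, j). h (x i) (y j)) summable_on UNIV"
  proof (rule summable_on_dominated)
    fix ij :: "'i \<times> 'j"
    obtain i j where [simp]: "ij = (i, j)" by fastforce
    have "norm (h (x i) (y j)) \<le> norm (x i) * norm (y j) * K" by (rule K)
    also have "\<dots> \<le> b i * e j * K"
      using K b(2) e(2) b0 by (intro mult_right_mono mult_mono) auto
    finally show "norm (case ij of (i, j) \<Rightarrow> h (x i) (y j)) \<le> (case ij of (i, j) \<Rightarrow> b i * (K * e j))"
      by (simp add: ac_simps)
  qed
  have xs: "x summable_on UNIV" and ys: "y summable_on UNIV"
    using summable_on_dominated[OF b(1)] b(2) summable_on_dominated[OF e(1)] e(2) by auto
  have "h (\<Sum>\<^sub>\<infinity>i. x i) (\<Sum>\<^sub>\<infinity>j. y j) = (\<Sum>\<^sub>\<infinity>i. h (x i) (\<Sum>\<^sub>\<infinity>j. y j))"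
    by (rule infsum_bounded_linear_image[OF bounded_linear_left xs, symmetric])
  also have "\<dots> = (\<Sum>\<^sub>\<infinity>i. \<Sum>\<^sub>\<infinity>j. h (x i) (y j))"
    by (intro infsum_cong infsum_bounded_linear_image[OF bounded_linear_right ys, symmetric])
  also have "\<dots> = (\<Sum>\<^sub>\<infinity>(i, j). h (x i) (y j))"
    using infsum_Sigma'_banach[of "\<lambda>i j. h (x i) (y j)" UNIV "\<lambda>_. UNIV"] s by simp
  finally show "h (\<Sum>\<^sub>\<infinity>i. x i) (\<Sum>\<^sub>\<infinity>j. y j) = (\<Sum>\<^sub>\<infinity>(i, j). h (x i) (y j))" .
qed

lemma summable_on_exp_abs_int:
  assumes "0 < \<beta>" shows "(\<lambda>j. exp (- \<beta> * \<bar>real_of_int j\<bar>)) summable_on UNIV"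
proof -
  have n: "(\<lambda>n::nat. exp (- \<beta> * real n)) summable_on UNIV"
  proof -
    have "summable (\<lambda>n. exp (- \<beta>) ^ n)" using assms by (intro summable_geometric) auto
    also have "(\<lambda>n. exp (- \<beta>) ^ n) = (\<lambda>n. exp (- \<beta> * real n))"
      by (simp add: exp_of_nat_mult[symmetric] ac_simps)
    finally show ?thesis by (subst summable_on_UNIV_nonneg_real_iff) auto
  qed
  have "bij_betw int UNIV {0..}" by (rule bij_betw_byWitness[where f' = nat]) auto
  from summable_on_reindex_bij_betw[OF this, of "\<lambda>j. exp (- \<beta> * \<bar>real_of_int j\<bar>)"] n
  have 1: "(\<lambda>j. exp (- \<beta> * \<bar>real_of_int j\<bar>)) summable_on {0..}" by simp
  have "bij_betw (\<lambda>n. - int n) UNIV {..0}"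
    by (rule bij_betw_byWitness[where f' = "\<lambda>j. nat (- j)"]) auto
  from summable_on_reindex_bij_betw[OF this, of "\<lambda>j. exp (- \<beta> * \<bar>real_of_int j\<bar>)"] n
  have "(\<lambda>j. exp (- \<beta> * \<bar>real_of_int j\<bar>)) summable_on {..0}" by simp
  from summable_on_union[OF 1 this] show ?thesis
    by (rule back_subst[of "\<lambda>S. _ summable_on S"]) auto
qed

lemma bij_betw_int_shift: "bij_betw (\<lambda>d. j + d) UNIV (UNIV :: int set)"
  by (rule bij_betw_byWitness[where f' = "\<lambda>i. i - j"]) auto

lemma
  fixes f :: "int \<Rightarrow> 'b::{comm_monoid_add, t2_space}"
  shows summable_on_int_shift: "(\<lambda>d. f (j + d)) summable_on UNIV \<longleftrightarrow> f summable_on UNIV"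
    and infsum_int_shift: "(\<Sum>\<^sub>\<infinity>d. f (j + d)) = infsum f UNIV"
  using summable_on_reindex_bij_betw[OF bij_betw_int_shift, of f j]
    infsum_reindex_bij_betw[OF bij_betw_int_shift, of f j] by auto

lemma exp_abs_shift_le:
  fixes x \<xi> T :: real
  assumes "0 \<le> \<beta>" "\<bar>\<xi>\<bar> \<le> T"
  shows "exp (- \<beta> * \<bar>x - \<xi>\<bar>) \<le> exp (\<beta> * T) * exp (- \<beta> * \<bar>x\<bar>)"
proof -
  have "\<beta> * \<bar>x\<bar> \<le> \<beta> * (\<bar>x - \<xi>\<bar> + T)" using assms by (intro mult_left_mono) auto
  then show ?thesis by (simp add: exp_add[symmetric] algebra_simps)
qed

section \<open>Differentiation with respect to a parameter\<close>

text \<open>By the mean value theorem \<open>b x\<close> is a Lipschitz constant in \<open>s\<close>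
  at each \<open>x\<close>. Hence integrability spreads from the single parameter \<open>s0\<close>
  to all of \<open>S\<close>, and the difference quotients are dominated by \<open>b\<close>. The
  measure is left general: counting measure serves the lattice sums, Lebesgue measure the integrals
  in \<open>\<alpha>1\<close>.\<close>

lemma has_real_derivative_integral:
  fixes F F' :: "real \<Rightarrow> 'a \<Rightarrow> real"
  assumes S: "convex S" "open S" "s0 \<in> S" "s \<in> S"
    and meas: "\<And>s. s \<in> S \<Longrightarrow> F s \<in> borel_measurable M"
    and F: "\<And>s x. s \<in> S \<Longrightarrow> ((\<lambda>s. F s x) has_real_derivative F' s x) (at s)"
    and b: "integrable M b" "\<And>s x. s \<in> S \<Longrightarrow> \<bar>F' s x\<bar> \<le> b x"
    and F0: "integrable M (F s0)"
  shows "integrable M (F s)"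
    and "((\<lambda>s. integral\<^sup>L M (F s)) has_real_derivative integral\<^sup>L M (F' s)) (at s)"
proof -
  have lip: "\<bar>F u x - F v x\<bar> \<le> b x * \<bar>u - v\<bar>" if "u \<in> S" "v \<in> S" for u v x
  proof -
    have "norm (F u x - F v x) \<le> b x * norm (u - v)"
    proof (rule field_differentiable_bound[OF S(1) _ _ that])
      show "((\<lambda>s. F s x) has_real_derivative F' z x) (at z within S)" if "z \<in> S" for z
        using F[OF that] by (rule has_field_derivative_at_within)
    qed (use b in auto)
    then show ?thesis by simp
  qed
  have int: "integrable M (F u)" if "u \<in> S" for u
  proof (rule Bochner_Integration.integrable_bound)
    show "integrable M (\<lambda>x. \<bar>F s0 x\<bar> + b x * \<bar>u - s0\<bar>)" using F0 b by auto
    show "AE x in M. norm (F u x) \<le> norm (\<bar>F s0 x\<bar> + b x * \<bar>u - s0\<bar>)"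
    proof (rule AE_I2)
      fix x show "norm (F u x) \<le> norm (\<bar>F s0 x\<bar> + b x * \<bar>u - s0\<bar>)"
        using lip[OF that S(3), of x] by (simp add: abs_if split: if_splits)
    qed
  qed (use meas that in auto)
  then show "integrable M (F s)" using S by auto
  show "((\<lambda>s. integral\<^sup>L M (F s)) has_real_derivative integral\<^sup>L M (F' s)) (at s)"
    unfolding DERIV_def has_field_derivative_iff
  proof (subst tendsto_at_iff_sequentially, intro allI impI)
    fix X :: "nat \<Rightarrow> real" assume X: "\<forall>i. X i \<in> UNIV - {s}" "X \<longlonglongrightarrow> s"
    \<comment> \<open>The domination holds only inside \<open>S\<close>, so the early terms of the
      sequence are dropped by an index shift.\<close>
    from X(2) S have "\<forall>\<^sub>F i in sequentially. X i \<in> S" by (simp add: topological_tendstoD)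
    then obtain N where N: "\<And>i. X (i + N) \<in> S"
      unfolding eventually_sequentially by (metis le_add2)
    let ?q = "\<lambda>i x. (F (X (i + N)) x - F s x) / (X (i + N) - s)"
    have pt: "(\<lambda>i. ?q i x) \<longlonglongrightarrow> F' s x" for x
    proof -
      have "(\<lambda>i. (F (X i) x - F s x) / (X i - s)) \<longlonglongrightarrow> F' s x"
        using F[OF S(4), of x] X unfolding has_field_derivative_iff tendsto_at_iff_sequentially comp_def
        by auto
      then show ?thesis by (rule LIMSEQ_ignore_initial_segment)
    qed
    have "(\<lambda>i. integral\<^sup>L M (?q i)) \<longlonglongrightarrow> integral\<^sup>L M (F' s)"
    proof (rule integral_dominated_convergence[OF _ _ b(1)])
      show "?q i \<in> borel_measurable M" for i
        using meas[OF N] meas[OF S(4)] by measurable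
      then show "F' s \<in> borel_measurable M"
        using pt by (rule borel_measurable_LIMSEQ_real[rotated])
      show "AE x in M. (\<lambda>i. ?q i x) \<longlonglongrightarrow> F' s x" using pt by simp
      show "AE x in M. norm (?q i x) \<le> b x" for i
        using lip[OF N S(4)] X(1) by (intro AE_I2) (simp add: divide_le_eq)
    qed
    also have "(\<lambda>i. integral\<^sup>L M (?q i))
        = (\<lambda>i. (integral\<^sup>L M (F (X (i + N))) - integral\<^sup>L M (F s)) / (X (i + N) - s))"
      using int[OF N] int[OF S(4)] by (simp add: fun_eq_iff Bochner_Integration.integral_diff)
    finally have "(\<lambda>i. (integral\<^sup>L M (F (X (i + N))) - integral\<^sup>L M (F s)) / (X (i + N) - s))
        \<longlonglongrightarrow> integral\<^sup>L M (F' s)" .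
    then show "((\<lambda>u. (integral\<^sup>L M (F u) - integral\<^sup>L M (F s)) / (u - s)) \<circ> X) \<longlonglongrightarrow> integral\<^sup>L M (F' s)"
      unfolding comp_def by (rule LIMSEQ_offset)
  qed
qed

lemma infsum_eq_integral_count_space:
  fixes f :: "'a \<Rightarrow> real"
  assumes "integrable (count_space UNIV) f"
  shows "f summable_on UNIV" "infsum f UNIV = integral\<^sup>L (count_space UNIV) f"
proof -
  have *: "Infinite_Set_Sum.abs_summable_on f UNIV"
    using assms by (simp add: Infinite_Set_Sum.abs_summable_on_def)
  then show "f summable_on UNIV"
    by (simp add: abs_summable_equivalent[symmetric] abs_summable_summable)
  show "infsum f UNIV = integral\<^sup>L (count_space UNIV) f"
    using infsetsum_infsum[OF *] by (simp add: infsetsum_def)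
qed

lemma integrable_count_space_real:
  fixes f :: "'a \<Rightarrow> real"
  assumes "f summable_on UNIV"
  shows "integrable (count_space UNIV) f"
  using assms summable_on_iff_abs_summable_on_real[of f UNIV] abs_summable_equivalent[of f UNIV]
  by (simp add: Infinite_Set_Sum.abs_summable_on_def)

lemma has_real_derivative_infsum:
  fixes F F' :: "real \<Rightarrow> 'a \<Rightarrow> real"
  assumes S: "convex S" "open S" "s0 \<in> S" "s \<in> S"
    and F: "\<And>s x. s \<in> S \<Longrightarrow> ((\<lambda>s. F s x) has_real_derivative F' s x) (at s)"
    and b: "b summable_on UNIV" "\<And>s x. s \<in> S \<Longrightarrow> \<bar>F' s x\<bar> \<le> b x"
    and F0: "F s0 summable_on UNIV"
  shows "F s summable_on UNIV"
    and "((\<lambda>s. infsum (F s) UNIV) has_real_derivative infsum (F' s) UNIV) (at s)"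
proof -
  note * = has_real_derivative_integral[of S s0 _ F "count_space UNIV" F' b, OF S(1-3) _ _ F
      integrable_count_space_real[OF b(1)] b(2) integrable_count_space_real[OF F0]]
  have int: "integrable (count_space UNIV) (F u)" if "u \<in> S" for u
    using *(1)[OF that] by auto
  show "F s summable_on UNIV" by (rule infsum_eq_integral_count_space[OF int[OF S(4)]])
  have "F' s summable_on UNIV"
    using summable_on_dominated[OF b(1), of "F' s"] b(2)[OF S(4)] by auto
  then have "((\<lambda>s. integral\<^sup>L (count_space UNIV) (F s)) has_real_derivative infsum (F' s) UNIV) (at s)"
    using *(2)[OF S(4)] infsum_eq_integral_count_space(2)[OF integrable_count_space_real, of "F' s"] by simp
  then show "((\<lambda>s. infsum (F s) UNIV) has_real_derivative infsum (F' s) UNIV) (at s)"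
    by (rule DERIV_cong_ev[THEN iffD1, rotated -1, OF _ refl _ refl])
       (use S infsum_eq_integral_count_space(2)[OF int] eventually_nhds_in_open[OF S(2,4)]
        in \<open>auto elim: eventually_mono\<close>)
qed

section \<open>Inhomogeneous evolution equations\<close>

text \<open>A mean value inequality that looks only forward from each point, because increments of
  \<open>U t s (z s)\<close> will be known only for times after \<open>s\<close>. If the bound with
  slope \<open>L + e\<close> failed, take the infimum \<open>c\<close> of the points where it fails:
  \<open>c\<close> itself obeys it by closedness, and the quotient bound at \<open>c\<close> carries
  it a little beyond \<open>c\<close>.\<close>

lemma right_quotient_bound:
  fixes g :: "real \<Rightarrow> 'a::real_normed_vector"
  assumes "a \<le> b" and cont: "continuous_on {a..b} g"
    and quot: "\<And>s e. a \<le> s \<Longrightarrow> s < b \<Longrightarrow> 0 < e \<Longrightarrow>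
      \<forall>\<^sub>F u in at_right s. norm (g u - g s) \<le> (L + e) * (u - s)"
  shows "norm (g b - g a) \<le> L * (b - a)"
proof -
  have "norm (g b - g a) \<le> (L + e) * (b - a)" if e: "0 < e" for e
  proof (rule ccontr)
    define h where "h s = norm (g s - g a) - (L + e) * (s - a)" for s
    define Z where "Z = {a..b} \<inter> h -` {..0}"
    define T where "T = {a..b} - Z"
    assume "\<not> norm (g b - g a) \<le> (L + e) * (b - a)"
    then have bT: "b \<in> T" using \<open>a \<le> b\<close> by (auto simp: T_def Z_def h_def)
    define c where "c = Inf T"
    have bdd: "bdd_below T" by (auto simp: T_def)
    have c_le: "c \<le> s" if "s \<in> T" for s unfolding c_def by (rule cInf_lower[OF that bdd])
    have ac: "a \<le> c" unfolding c_def using bT by (intro cInf_greatest) (auto simp: T_def)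
    have cb: "c \<le> b" using c_le[OF bT] .
    have below: "s \<in> Z" if "a \<le> s" "s < c" for s
      using c_le[of s] that cb by (auto simp: T_def)
    have "closed Z" unfolding Z_def h_def
      by (intro continuous_closed_preimage continuous_intros cont)
    \<comment> \<open>Either \<open>c = a\<close>, where the bound is trivial, or \<open>c\<close>
      is approached from the left by points of the closed set \<open>Z\<close>.\<close>
    have cZ: "c \<in> Z"
    proof (cases "c = a")
      case True
      then show ?thesis using \<open>a \<le> b\<close> by (simp add: Z_def h_def)
    next
      case False
      show ?thesis
      proof (rule ccontr)
        assume "c \<notin> Z"
        then obtain d where d: "0 < d" "ball c d \<subseteq> - Z"
          using \<open>closed Z\<close> by (metis ComplI open_Compl openE)
        let ?s = "max a (c - d / 2)"
        have "?s \<in> ball c d" using d ac by (auto simp: dist_real_def)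
        then show False using d below[of ?s] False ac by auto
      qed
    qed
    with bT cb have cb: "c < b" by (auto simp: T_def le_less)
    from quot[OF ac cb e] obtain d where d: "c < d"
      "\<And>u. c < u \<Longrightarrow> u < d \<Longrightarrow> norm (g u - g c) \<le> (L + e) * (u - c)"
      unfolding eventually_at_right_field by blast
    have "min d b \<le> s" if "s \<in> T" for s
    proof (rule ccontr)
      assume s: "\<not> min d b \<le> s"
      with c_le[OF that] cZ that have "c < s" "s < d" by (auto simp: T_def le_less)
      then have "norm (g s - g c) \<le> (L + e) * (s - c)" by (rule d)
      moreover have "norm (g c - g a) \<le> (L + e) * (c - a)" using cZ by (simp add: Z_def h_def)
      moreover have "norm (g s - g a) \<le> norm (g s - g c) + norm (g c - g a)"
        using norm_triangle_ineq[of "g s - g c" "g c - g a"] by simp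
      ultimately have "norm (g s - g a) \<le> (L + e) * (s - a)" by (simp add: algebra_simps)
      then show False using that by (auto simp: T_def Z_def h_def)
    qed
    then have "min d b \<le> c" unfolding c_def using bT by (intro cInf_greatest) auto
    then show False using d cb by auto
  qed
  note * = this
  show ?thesis
  proof (rule field_le_epsilon)
    fix e :: real assume e: "0 < e"
    \<comment> \<open>The \<open>+ 1\<close> keeps the denominator positive when
      \<open>a = b\<close>, and the resulting error is still at most \<open>e\<close>.\<close>
    have "norm (g b - g a) \<le> (L + e / (b - a + 1)) * (b - a)"
      by (rule *) (use e \<open>a \<le> b\<close> in auto)
    also have "\<dots> = L * (b - a) + e * ((b - a) / (b - a + 1))"
      by (simp add: distrib_right)
    also have "\<dots> \<le> L * (b - a) + e"
      using e \<open>a \<le> b\<close> by (intro add_left_mono mult_left_le) (auto simp: divide_simps)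
    finally show "norm (g b - g a) \<le> L * (b - a) + e" .
  qed
qed

text \<open>Banach-Steinhaus by Baire category: the closed sets \<open>E n\<close> cover the space,
  so one of them contains a ball around some \<open>w0\<close>. The later index set is the interval
  \<open>{0..t}\<close>, where strong continuity gives only pointwise bounds.\<close>

lemma uniform_boundedness:
  fixes U :: "'i \<Rightarrow> 'a::banach \<Rightarrow> 'b::real_normed_vector"
  assumes lin: "\<And>i. i \<in> I \<Longrightarrow> bounded_linear (U i)"
    and bdd: "\<And>w. \<exists>C. \<forall>i\<in>I. norm (U i w) \<le> C"
  shows "\<exists>M\<ge>0. \<forall>i\<in>I. \<forall>w. norm (U i w) \<le> M * norm w"
proof -
  define E where "E n = {w. \<forall>i\<in>I. norm (U i w) \<le> real n}" for n :: nat
  have closed: "closed (E n)" for n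
  proof -
    have "E n = (\<Inter>i\<in>I. {w. norm (U i w) \<le> real n})" by (auto simp: E_def)
    also have "closed \<dots>"
      by (intro closed_INT ballI)
         (rule closed_Collect_le[OF continuous_on_norm[OF linear_continuous_on[OF lin]] continuous_on_const])
    finally show ?thesis .
  qed
  have cover: "(\<Union>n. E n) = UNIV"
  proof -
    have "\<exists>n. w \<in> E n" for w
    proof -
      obtain C where C: "\<forall>i\<in>I. norm (U i w) \<le> C" using bdd by blast
      obtain n where "C \<le> real n" using real_arch_simple by blast
      with C have "w \<in> E n" unfolding E_def by fastforce
      then show ?thesis ..
    qed
    then show ?thesis by auto
  qed
  have "\<exists>n. interior (E n) \<noteq> {}"
  proof (rule ccontr)
    assume *: "\<nexists>n. interior (E n) \<noteq> {}"
    have "Met_TC.mtopology interior_of \<Union>(range E) = {}"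
      by (rule Met_TC.metric_Baire_category_alt) (use * closed in \<open>auto simp: complete_UNIV\<close>)
    then show False using cover by simp
  qed
  then obtain n w0 e where e: "0 < e" "cball w0 e \<subseteq> E n"
    by (meson ex_in_conv interior_subset mem_interior_cball subset_trans)
  have "norm (U i w) \<le> (2 * real n / e) * norm w" if i: "i \<in> I" for i w
  proof (cases "w = 0")
    case True
    then show ?thesis using linear_0[OF bounded_linear.linear[OF lin[OF i]]] by simp
  next
    case False
    \<comment> \<open>Rescaled to length \<open>e\<close>, \<open>h\<close> keeps
      \<open>w0 + h\<close> in the ball. Its image is a difference of two vectors of norm at most
      \<open>n\<close>, whence the factor 2.\<close>
    define h where "h = (e / norm w) *\<^sub>R w"
    interpret bounded_linear "U i" by (rule lin[OF i])
    have "w0 \<in> E n" "w0 + h \<in> E n" using e False by (auto simp: h_def dist_norm subset_iff)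
    then have "norm (U i w0) \<le> real n" "norm (U i (w0 + h)) \<le> real n" using i by (auto simp: E_def)
    moreover have "U i h = U i (w0 + h) - U i w0" by (simp add: add)
    ultimately have "norm (U i h) \<le> 2 * real n"
      using norm_triangle_ineq4[of "U i (w0 + h)" "U i w0"] by simp
    moreover have "norm (U i h) = e / norm w * norm (U i w)"
      using e by (simp add: h_def scaleR)
    ultimately show ?thesis using e False by (simp add: field_simps)
  qed
  then show ?thesis using e by (intro exI[of _ "2 * real n / e"]) auto
qed

text \<open>Variation of constants as an estimate, without forming an integral: the curve
  \<open>g s = U t s (z s)\<close> has right slopes at most \<open>M * B\<close>, where
  \<open>M\<close> bounds \<open>U t s\<close> on \<open>{0..t}\<close>, and it runs from 0 to
  \<open>z t\<close>. The constant is chosen before \<open>z\<close>, \<open>f\<close> and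
  \<open>B\<close> because it must serve all unit responses and all remainders of the series at
  once.\<close>

lemma inhomogeneous_evolution_bound:
  fixes G :: "real \<Rightarrow> 'a::banach \<Rightarrow> 'a"
  assumes gen: "generates G U" and t: "0 \<le> t"
  shows "\<exists>M\<ge>0. \<forall>z f B. z 0 = 0 \<longrightarrow>
    (\<forall>s\<in>{0..t}. (z has_vector_derivative G s (z s) + f s) (at s within {0..})) \<longrightarrow>
    (\<forall>s\<in>{0..t}. norm (f s) \<le> B) \<longrightarrow> norm (z t) \<le> M * B"
proof -
  have lin: "bounded_linear (U t s)" if "s \<le> t" for s t
    using gen that by (auto simp: generates_def evolution_family_def)
  have id: "U s s w = w" for s w using gen by (auto simp: generates_def evolution_family_def)
  have comp: "U t r (U r s w) = U t s w" if "s \<le> r" "r \<le> t" for t r s w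
    using gen that unfolding generates_def evolution_family_def by blast
  have cont: "continuous_on {0..t} (\<lambda>s. U t s w)" for w
  proof -
    have "continuous_on {(t, s). s \<le> t} (\<lambda>(t, s). U t s w)"
      using gen by (auto simp: generates_def evolution_family_def)
    then have "continuous_on {0..t} ((\<lambda>(t, s). U t s w) \<circ> (\<lambda>s. (t, s)))"
      by (intro continuous_on_compose continuous_intros) (auto elim: continuous_on_subset)
    then show ?thesis by (simp add: o_def)
  qed
  have "\<exists>M\<ge>0. \<forall>s\<in>{0..t}. \<forall>w. norm (U t s w) \<le> M * norm w"
  proof (rule uniform_boundedness)
    fix w
    have "bounded ((\<lambda>s. U t s w) ` {0..t})"
      by (intro compact_imp_bounded compact_continuous_image cont) auto
    then show "\<exists>C. \<forall>s\<in>{0..t}. norm (U t s w) \<le> C" by (auto simp: bounded_iff)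
  qed (use lin in auto)
  then obtain M where M: "M \<ge> 0" "\<And>s w. 0 \<le> s \<Longrightarrow> s \<le> t \<Longrightarrow> norm (U t s w) \<le> M * norm w"
    by auto
  have "norm (z t) \<le> (M * t) * B"
    if z0: "z 0 = 0"
      and z: "\<And>s. s \<in> {0..t} \<Longrightarrow> (z has_vector_derivative G s (z s) + f s) (at s within {0..})"
      and B: "\<And>s. s \<in> {0..t} \<Longrightarrow> norm (f s) \<le> B" for z f B
  proof -
    define g where "g s = U t s (z s)" for s
    have zcont: "continuous_on {0..t} z"
    proof (subst continuous_on_eq_continuous_within, rule ballI)
      fix s assume "s \<in> {0..t}"
      from has_vector_derivative_continuous[OF z[OF this]]
      show "continuous (at s within {0..t}) z" by (rule continuous_within_subset) auto
    qed
    have "continuous_on {0..t} g"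
      unfolding continuous_on_def
    proof
      fix s assume s: "s \<in> {0..t}"
      have "((\<lambda>u. U t u (z u - z s)) \<longlongrightarrow> 0) (at s within {0..t})"
      proof (rule Lim_null_comparison)
        show "\<forall>\<^sub>F u in at s within {0..t}. norm (U t u (z u - z s)) \<le> M * norm (z u - z s)"
          using M(2) by (auto simp: eventually_at_filter)
        have "(z \<longlongrightarrow> z s) (at s within {0..t})" using zcont s by (auto simp: continuous_on_def)
        then show "((\<lambda>u. M * norm (z u - z s)) \<longlongrightarrow> 0) (at s within {0..t})"
          by (intro tendsto_mult_right_zero tendsto_norm_zero LIM_zero)
      qed
      moreover have "((\<lambda>u. U t u (z s)) \<longlongrightarrow> U t s (z s)) (at s within {0..t})"
        using cont s by (auto simp: continuous_on_def)
      ultimately have "((\<lambda>u. U t u (z u - z s) + U t u (z s)) \<longlongrightarrow> 0 + g s) (at s within {0..t})"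
        unfolding g_def by (rule tendsto_add)
      moreover have "\<forall>\<^sub>F u in at s within {0..t}. U t u (z u - z s) + U t u (z s) = g u"
        using lin by (auto simp: eventually_at_filter g_def bounded_linear.linear linear_diff)
      ultimately show "(g \<longlongrightarrow> g s) (at s within {0..t})"
        by (simp add: tendsto_cong)
    qed
    then have "norm (g t - g 0) \<le> (M * B) * (t - 0)"
    proof (rule right_quotient_bound[OF t])
      fix s e :: real assume s: "0 \<le> s" "s < t" and e: "0 < e"
      \<comment> \<open>Deviation of \<open>z\<close> from the homogeneous solution restarted at
        \<open>s\<close>. The generator terms of the two agree at \<open>s\<close>, so the right
        derivative of the deviation there is \<open>f s\<close>; the composition law gives
        \<open>g u - g s = U t u (?D u)\<close>.\<close>
      let ?D = "\<lambda>u. z u - U u s (z s)"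
      have "((\<lambda>u. U u s (z s)) has_vector_derivative G s (U s s (z s))) (at s within {s..})"
        using gen unfolding generates_def by blast
      moreover have "(z has_vector_derivative G s (z s) + f s) (at s within {s..})"
        using z[of s] s by (auto elim: has_vector_derivative_within_subset)
      ultimately have "(?D has_vector_derivative f s) (at s within {s..})"
        using has_vector_derivative_diff by (fastforce simp: id)
      \<comment> \<open>\<open>M\<close> may be zero, hence \<open>M + 1\<close>; the factor
        \<open>M / (M + 1)\<close> that appears below is at most 1.\<close>
      moreover have e': "0 < e / (M + 1)" using e M by auto
      ultimately obtain d where d: "0 < d" "\<And>u. u \<in> {s..} \<Longrightarrow> norm (u - s) < d \<Longrightarrow>
          norm (?D u - ?D s - (u - s) *\<^sub>R f s) \<le> e / (M + 1) * norm (u - s)"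
        unfolding has_vector_derivative_def has_derivative_within_alt by blast
      have "norm (g u - g s) \<le> (M * B + e) * (u - s)" if u: "s < u" "u < s + min d (t - s)" for u
      proof -
        have D: "norm (?D u) \<le> (B + e / (M + 1)) * (u - s)"
        proof -
          have "norm (?D u) \<le> norm ((u - s) *\<^sub>R f s) + norm (?D u - ?D s - (u - s) *\<^sub>R f s)"
            using norm_triangle_ineq[of "(u - s) *\<^sub>R f s" "?D u - (u - s) *\<^sub>R f s"] by (simp add: id)
          also have "norm ((u - s) *\<^sub>R f s) \<le> B * (u - s)"
            using B[of s] s u by (simp add: mult.commute mult_left_mono)
          also have "norm (?D u - ?D s - (u - s) *\<^sub>R f s) \<le> e / (M + 1) * (u - s)"
            using d(2)[of u] u by auto
          finally show ?thesis by (simp add: algebra_simps)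
        qed
        have "g u - g s = U t u (?D u)"
          using u comp[of s u t "z s"] lin[of u t] by (simp add: g_def bounded_linear.linear linear_diff)
        also have "norm \<dots> \<le> M * norm (?D u)" using M(2)[of u] u s by auto
        also have "\<dots> \<le> M * ((B + e / (M + 1)) * (u - s))" using D M by (intro mult_left_mono)
        also have "\<dots> = (M * B + M / (M + 1) * e) * (u - s)" by (simp add: algebra_simps)
        also have "\<dots> \<le> (M * B + e) * (u - s)"
          using u e M by (intro mult_right_mono add_left_mono) (auto simp: divide_simps)
        finally show ?thesis .
      qed
      then show "\<forall>\<^sub>F u in at_right s. norm (g u - g s) \<le> (M * B + e) * (u - s)"
        unfolding eventually_at_right_field using d(1) s
        by (intro exI[of _ "s + min d (t - s)"]) auto
    qed
    moreover have "g 0 = 0" using linear_0[OF bounded_linear.linear[OF lin[OF t]]] by (simp add: g_def z0)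
    ultimately show ?thesis by (simp add: g_def id ac_simps)
  qed
  note * = this
  show ?thesis
  proof (intro exI[of _ "M * t"] conjI allI impI)
    fix z f B assume "z 0 = 0"
      "\<forall>s\<in>{0..t}. (z has_vector_derivative G s (z s) + f s) (at s within {0..})"
      "\<forall>s\<in>{0..t}. norm (f s) \<le> B"
    then show "norm (z t) \<le> (M * t) * B" by (intro *) auto
  qed (use M t in auto)
qed

section \<open>Square summable sequences\<close>

lemma vec2_nth [simp]: "vec2 x y $ 1 = x" "vec2 x y $ 2 = y"
  by (simp_all add: vector_2)

lemma vec2_eq_iff: "v = w \<longleftrightarrow> v $ 1 = w $ 1 \<and> v $ 2 = w $ 2" for v w :: "real^2"
  by (simp add: vec_eq_iff forall_2)

lemma vec2_scaleR: "vec2 x y = x *\<^sub>R vec2 1 0 + y *\<^sub>R vec2 0 1"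
  by (simp add: vec2_eq_iff)

lemma norm_vec2_le: "norm v \<le> \<bar>v $ 1\<bar> + \<bar>v $ 2\<bar>" for v :: "real^2"
  unfolding norm_real2 by (rule sqrt_sum_squares_le_sum_abs)

text \<open>Each \<open>b j\<close> is at most the total sum, so the sum of squares is at most the
  square of the sum: the l1 norm dominates the l2 norm.\<close>

lemma norm_ell2_le_infsum:
  assumes b: "b summable_on UNIV" "\<And>j. norm (seq x j) \<le> b j"
  shows "norm (x :: ell2) \<le> infsum b UNIV"
proof -
  have b0: "0 \<le> b j" for j using b(2)[of j] norm_ge_zero[of "seq x j"] by linarith
  have le: "b j \<le> infsum b UNIV" for j
    using finite_sum_le_infsum[OF b(1), of "{j}"] b0 by simp
  have "(norm x)\<^sup>2 = (\<Sum>\<^sub>\<infinity>j. (norm (seq x j))\<^sup>2)"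
    by (simp add: norm_ell2.rep_eq l2_norm_def infsum_nonneg)
  also have "\<dots> \<le> (\<Sum>\<^sub>\<infinity>j. b j * infsum b UNIV)"
  proof (rule infsum_mono)
    show "(\<lambda>j. (norm (seq x j))\<^sup>2) summable_on UNIV" using seq[of x] by (simp add: in_l2_def)
    show "(\<lambda>j. b j * infsum b UNIV) summable_on UNIV" by (rule summable_on_cmult_left[OF b(1)])
    show "(norm (seq x j))\<^sup>2 \<le> b j * infsum b UNIV" for j
      unfolding power2_eq_square using b(2)[of j] le[of j] b0[of j]
      by (intro mult_mono) auto
  qed
  also have "\<dots> = (infsum b UNIV)\<^sup>2"
    by (simp add: infsum_cmult_left' power2_eq_square)
  finally show ?thesis
    using infsum_nonneg[of UNIV b] b0 by (auto intro: power2_le_imp_le)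
qed

lemma bounded_linear_seq: "bounded_linear (\<lambda>x. seq x j)"
  by (rule bounded_linear_intro[where K = 1])
     (simp_all add: plus_ell2.rep_eq scaleR_ell2.rep_eq norm_seq_le)

lemma seq_add [simp]: "seq (x + y) j = seq x j + seq y j"
  and seq_diff [simp]: "seq (x - y) j = seq x j - seq y j"
  and seq_scaleR [simp]: "seq (k *\<^sub>R x) j = k *\<^sub>R seq x j"
  by (simp_all add: plus_ell2.rep_eq minus_ell2.rep_eq scaleR_ell2.rep_eq)

lemma linear_J_ell2: "linear J_ell2"
proof
  show "J_ell2 (x + y) = J_ell2 x + J_ell2 y" for x y
    by transfer (simp add: fun_eq_iff J_def dplus_def dminus_def vec2_eq_iff)
  show "J_ell2 (k *\<^sub>R x) = k *\<^sub>R J_ell2 x" for k x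
    by transfer (simp add: fun_eq_iff J_def dplus_def dminus_def vec2_eq_iff algebra_simps)
qed

text \<open>Cauchy-Schwarz on finite sets of sites. Boundedness on \<open>ell2\<close> is what lets
  the term quadratic in the tail be expanded from the norm-convergent series of the tail
  alone.\<close>

lemma bounded_bilinear_pairing:
  assumes w: "\<And>j. \<bar>w j\<bar> \<le> C"
  shows "bounded_bilinear (\<lambda>x y. pairing w (\<lambda>j. seq x j $ i * seq y j $ i))"
proof -
  have C: "0 \<le> C" using w[of 0] by linarith
  have le: "\<bar>w j * (seq x j $ i * seq y j $ i)\<bar> \<le> C * (norm (seq x j) * norm (seq y j))" for x y j
    unfolding abs_mult using w[of j] C
    by (intro mult_mono component_le_norm_cart mult_nonneg_nonneg) auto
  have prod: "norm (seq x j) * norm (seq y j) \<le> (norm (seq x j))\<^sup>2 + (norm (seq y j))\<^sup>2" for x y j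
    using zero_le_power2[of "norm (seq x j) - norm (seq y j)"]
      zero_le_power2[of "norm (seq x j)"] zero_le_power2[of "norm (seq y j)"]
    unfolding power2_diff by linarith
  have sq: "(\<lambda>j. (norm (seq x j))\<^sup>2) summable_on UNIV" for x
    using seq[of x] by (simp add: in_l2_def)
  have s1: "(\<lambda>j. norm (seq x j) * norm (seq y j)) summable_on UNIV" for x y
    by (rule summable_on_comparison_test[OF summable_on_add[OF sq[of x] sq[of y]]]) (use prod in auto)
  have s2: "(\<lambda>j. w j * (seq x j $ i * seq y j $ i)) summable_on UNIV" for x y
    by (rule summable_on_dominated[OF summable_on_cmult_right[OF s1, of C x y]]) (use le in auto)
  have CS: "(\<Sum>\<^sub>\<infinity>j. norm (seq x j) * norm (seq y j)) \<le> norm x * norm y" for x y :: ell2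
  proof (rule infsum_le_finite_sums[OF s1])
    fix F :: "int set" assume F: "finite F"
    have "(\<Sum>j\<in>F. norm (seq x j) * norm (seq y j))
        \<le> L2_set (\<lambda>j. norm (seq x j)) F * L2_set (\<lambda>j. norm (seq y j)) F"
      using L2_set_mult_ineq[of "\<lambda>j. norm (seq x j)" "\<lambda>j. norm (seq y j)" F] by simp
    also have "\<dots> \<le> norm x * norm y"
      unfolding L2_set_def
      by (intro mult_mono real_le_lsqrt sum_norm_seq_le F sum_nonneg real_sqrt_ge_zero) auto
    finally show "(\<Sum>j\<in>F. norm (seq x j) * norm (seq y j)) \<le> norm x * norm y" .
  qed
  show ?thesis
    unfolding pairing_def
  proof
    show "\<exists>K. \<forall>x y. norm (\<Sum>\<^sub>\<infinity>j. w j * (seq x j $ i * seq y j $ i)) \<le> norm x * norm y * K"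
    proof (intro exI[of _ C] allI)
      fix x y :: ell2
      have "norm (\<Sum>\<^sub>\<infinity>j. w j * (seq x j $ i * seq y j $ i))
          \<le> (\<Sum>\<^sub>\<infinity>j. C * (norm (seq x j) * norm (seq y j)))"
        by (rule norm_infsum_le_infsum[OF summable_on_cmult_right[OF s1]]) (use le in auto)
      also have "\<dots> \<le> norm x * norm y * C"
        using CS[of x y] C by (simp add: infsum_cmult_right' mult.commute mult_left_mono)
      finally show "norm (\<Sum>\<^sub>\<infinity>j. w j * (seq x j $ i * seq y j $ i)) \<le> norm x * norm y * C" .
    qed
  qed (simp_all add: distrib_left distrib_right infsum_add s2 infsum_cmult_right' mult.left_commute
       ac_simps flip: infsum_cmult_right' )
qed

lemma pairing_cmult: "pairing (\<lambda>j. k * w j) f = k * pairing w f"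
  by (simp add: pairing_def mult.assoc infsum_cmult_right')

lemma matrix_inv_unique:
  fixes M N :: "real^'n^'n"
  assumes "M ** N = mat 1" "N ** M = mat 1"
  shows "matrix_inv M = N"
  unfolding matrix_inv_def
proof (rule some_equality)
  fix N' assume N': "M ** N' = mat 1 \<and> N' ** M = mat 1"
  have "N' = N' ** (M ** N)" by (simp add: assms)
  also have "\<dots> = N" using N' by (simp add: matrix_mul_assoc)
  finally show "N' = N" .
qed (use assms in auto)

section \<open>Localized solitary waves\<close>

text \<open>The witnesses hidden in \<open>localized\<close> become parameters: \<open>d\<close> is
  the table of mixed derivatives, \<open>K k l\<close> the decay constant of its entries,
  \<open>\<beta>\<close> their common rate. Most results below take a speed strictly between
  \<open>cm\<close> and \<open>cp\<close>, where derivatives in the speed are two-sided and the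
  bounds hold in a neighbourhood.\<close>

locale localized_waves = waves cp \<phi> for cp :: real and \<phi> :: "real \<Rightarrow> real \<Rightarrow> real^2" +
  fixes cm a \<beta> :: real
    and d :: "nat \<Rightarrow> nat \<Rightarrow> real \<Rightarrow> real \<Rightarrow> real^2"
    and K :: "nat \<Rightarrow> nat \<Rightarrow> real"
  assumes speeds: "1 < cm" "cm < cp"
    and rates: "0 < a" "a < \<beta>"
    and derivs: "all_derivatives d"
    and decay: "\<And>k l c x. c \<in> {cm..cp} \<Longrightarrow> norm (d k l c x) \<le> K k l * exp (- \<beta> * \<bar>x\<bar>)"
    and \<alpha>0_pos: "\<And>c. c \<in> {1<..cp} \<Longrightarrow> 0 < \<alpha>0 c"
begin

lemma \<beta>_pos: "0 < \<beta>" using rates by simp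

lemma K_nonneg: "0 \<le> K k l"
  using order_trans[OF norm_ge_zero decay[of cp k l 0]] speeds by simp

lemma d_00: "c \<in> {1<..cp} \<Longrightarrow> d 0 0 c x = \<phi> c x"
  using derivs by (simp add: all_derivatives_def)

lemma d_x: "c \<in> {1<..cp} \<Longrightarrow> ((\<lambda>y. d k l c y) has_vector_derivative d (Suc k) l c x) (at x)"
  using derivs by (simp add: all_derivatives_def)

lemma d_c:
  "c \<in> {1<..cp} \<Longrightarrow> ((\<lambda>s. d k l s x) has_vector_derivative d k (Suc l) c x) (at c within {1<..cp})"
  using derivs by (simp add: all_derivatives_def)

lemma at_within_speeds: "c \<in> {1<..<cp} \<Longrightarrow> at c within {1<..cp} = at c"
  by (rule at_within_open_subset[of c "{1<..<cp}"]) auto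

lemma d_shift:
  assumes "c \<in> {1<..cp}"
  shows "((\<lambda>\<xi>. d k l c (x - \<xi>)) has_vector_derivative - d (Suc k) l c (x - \<xi>)) (at \<xi>)"
proof -
  have "((\<lambda>\<xi>. x - \<xi>) has_vector_derivative - 1) (at \<xi>)"
    by (auto simp: has_real_derivative_iff_has_vector_derivative[symmetric] intro!: derivative_eq_intros)
  from vector_diff_chain_at[OF this d_x[OF assms]] show ?thesis by (simp add: o_def)
qed

lemma D\<xi>_eq: "((\<lambda>x. F x c) has_vector_derivative F') (at \<xi>) \<Longrightarrow> D\<xi> F \<xi> c = F'"
  unfolding D\<xi>_def by (rule vector_derivative_at)

text \<open>The profile is controlled only at admissible speeds, so \<open>F\<close> and
  \<open>G\<close> are compared only there. The filter lies above \<open>at_left c\<close>, hence is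
  nontrivial and determines the derivative, even at \<open>cp\<close>.\<close>

lemma Dc_eq:
  assumes c: "c \<in> {1<..cp}" and eq: "\<And>s. s \<in> {1<..cp} \<Longrightarrow> F \<xi> s = G s"
    and G: "(G has_vector_derivative G') (at c within {1<..cp})"
  shows "Dc F \<xi> c = G'"
proof -
  have "at c within {1<..cp} \<noteq> bot"
  proof -
    have "at_left c \<noteq> bot" by simp
    moreover have "at_left c = at c within {1<..<c}"
      using c by (intro at_within_nhd[of _ "{1<..}"]) auto
    ultimately show ?thesis
      using at_le[of "{1<..<c}" "{1<..cp}" c] c by (auto simp: subset_iff bot_unique)
  qed
  moreover have "((\<lambda>s. F \<xi> s) has_vector_derivative G') (at c within {1<..cp})"
    by (rule has_vector_derivative_transform[OF c eq G])
  ultimately show ?thesis unfolding Dc_def by (rule vector_derivative_within)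
qed

lemma wave_eq: "c \<in> {1<..cp} \<Longrightarrow> wave j \<xi> c = d 0 0 c (real_of_int j - \<xi>)"
  by (simp add: wave_def d_00)

lemma rwave_eq: "c \<in> {1<..cp} \<Longrightarrow> rwave j \<xi> c = d 0 0 c (real_of_int j - \<xi>) $ 1"
  by (simp add: rwave_def r_def d_00)

lemma D\<xi>_wave: "c \<in> {1<..cp} \<Longrightarrow> D\<xi> (wave j) \<xi> c = - d 1 0 c (real_of_int j - \<xi>)"
  using d_shift[of c 0 0 "real_of_int j" \<xi>] by (intro D\<xi>_eq) (simp add: wave_eq)

lemma Dc_wave: "c \<in> {1<..cp} \<Longrightarrow> Dc (wave j) \<xi> c = d 0 1 c (real_of_int j - \<xi>)"
  using d_c[of c 0 0 "real_of_int j - \<xi>"] by (intro Dc_eq[of c]) (auto simp: wave_eq)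

lemma tangent_eq:
  assumes "c \<in> {1<..cp}"
  shows "\<phi>\<xi> \<xi> c j = - d 1 0 c (real_of_int j - \<xi>)" "\<phi>c \<xi> c j = d 0 1 c (real_of_int j - \<xi>)"
    "\<phi>\<xi>\<xi> \<xi> c j = d 2 0 c (real_of_int j - \<xi>)" "\<phi>c\<xi> \<xi> c j = - d 1 1 c (real_of_int j - \<xi>)"
    "\<phi>\<xi>c \<xi> c j = - d 1 1 c (real_of_int j - \<xi>)" "\<phi>cc \<xi> c j = d 0 2 c (real_of_int j - \<xi>)"
proof -
  show "\<phi>\<xi> \<xi> c j = - d 1 0 c (real_of_int j - \<xi>)" "\<phi>c \<xi> c j = d 0 1 c (real_of_int j - \<xi>)"
    using assms by (simp_all add: \<phi>\<xi>_def \<phi>c_def D\<xi>_wave Dc_wave)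
  show "\<phi>\<xi>\<xi> \<xi> c j = d 2 0 c (real_of_int j - \<xi>)"
    unfolding \<phi>\<xi>\<xi>_def
    using has_vector_derivative_minus[OF d_shift[OF assms, of 1 0 "real_of_int j" \<xi>]]
    using assms by (intro D\<xi>_eq) (simp add: D\<xi>_wave numeral_2_eq_2)
  show "\<phi>c\<xi> \<xi> c j = - d 1 1 c (real_of_int j - \<xi>)"
    unfolding \<phi>c\<xi>_def
    using has_vector_derivative_minus[OF d_c[OF assms, of 1 0 "real_of_int j - \<xi>"]]
    by (intro Dc_eq[OF assms]) (auto simp: D\<xi>_wave)
  show "\<phi>\<xi>c \<xi> c j = - d 1 1 c (real_of_int j - \<xi>)"
    unfolding \<phi>\<xi>c_def using d_shift[OF assms, of 0 1 "real_of_int j" \<xi>]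
    using assms by (intro D\<xi>_eq) (simp add: Dc_wave)
  show "\<phi>cc \<xi> c j = d 0 2 c (real_of_int j - \<xi>)"
    unfolding \<phi>cc_def using d_c[OF assms, of 0 1 "real_of_int j - \<xi>"]
    by (intro Dc_eq[OF assms]) (auto simp: Dc_wave numeral_2_eq_2)
qed

lemma d_nth_le:
  assumes "c \<in> {cm..cp}" shows "\<bar>d k l c x $ i\<bar> \<le> K k l * exp (- \<beta> * \<bar>x\<bar>)"
  using component_le_norm_cart[of "d k l c x" i] decay[OF assms, of k l x] by simp

lemma d_nth_x: "c \<in> {1<..cp} \<Longrightarrow> ((\<lambda>y. d k l c y $ i) has_real_derivative d (Suc k) l c x $ i) (at x)"
  unfolding has_real_derivative_iff_has_vector_derivative
  by (rule bounded_linear.has_vector_derivative[OF bounded_linear_vec_nth d_x])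

lemma d_nth_c: "c \<in> {1<..<cp} \<Longrightarrow> ((\<lambda>s. d k l s x $ i) has_real_derivative d k (Suc l) c x $ i) (at c)"
  unfolding has_real_derivative_iff_has_vector_derivative
  using bounded_linear.has_vector_derivative[OF bounded_linear_vec_nth d_c[of c k l x]]
  by (simp add: at_within_speeds)

section \<open>Lattice sums of products of wave derivatives\<close>

text \<open>All quantities in the expansion are sums over the lattice of such products of derivatives of
  the first component, with \<open>q 0 0 0 0\<close> the square of the profile.\<close>

definition q :: "nat \<Rightarrow> nat \<Rightarrow> nat \<Rightarrow> nat \<Rightarrow> real \<Rightarrow> real \<Rightarrow> real"
  where "q k l k' l' c x = d k l c x $ 1 * d k' l' c x $ 1"

text \<open>The product would decay at twice the rate. One factor is estimated by its constant
  alone, so that products of any length keep the rate \<open>\<beta>\<close> and fit under the same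
  weight.\<close>

lemma exp_decay_mult:
  assumes "\<bar>u\<bar> \<le> C * exp (- \<beta> * \<bar>x\<bar>)" "\<bar>v\<bar> \<le> D * exp (- \<beta> * \<bar>x\<bar>)" "0 \<le> D"
  shows "\<bar>u * v\<bar> \<le> (C * D) * exp (- \<beta> * \<bar>x :: real\<bar>)"
proof -
  have "exp (- \<beta> * \<bar>x\<bar>) \<le> 1" using \<beta>_pos by simp
  then have "D * exp (- \<beta> * \<bar>x\<bar>) \<le> D" using assms(3) by (simp add: mult_left_le)
  then have "\<bar>v\<bar> \<le> D" using assms(2) by linarith
  then have "\<bar>u\<bar> * \<bar>v\<bar> \<le> (C * exp (- \<beta> * \<bar>x\<bar>)) * D"
    using assms(1) order_trans[OF abs_ge_zero assms(1)] by (intro mult_mono) auto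
  then show ?thesis by (simp add: abs_mult ac_simps)
qed

lemma q_le: "c \<in> {cm..cp} \<Longrightarrow> \<bar>q k l k' l' c x\<bar> \<le> (K k l * K k' l') * exp (- \<beta> * \<bar>x\<bar>)"
  unfolding q_def by (intro exp_decay_mult d_nth_le K_nonneg) auto

lemma q_x:
  assumes "c \<in> {1<..cp}"
  shows "((\<lambda>y. q k l k' l' c y) has_real_derivative
    q (Suc k) l k' l' c x + q k l (Suc k') l' c x) (at x)"
  unfolding q_def 
  using DERIV_mult[OF d_nth_x[OF assms, of k l 1 x] d_nth_x[OF assms, of k' l' 1 x]]
  by (simp add: ac_simps)

lemma q_c:
  assumes "c \<in> {1<..<cp}"
  shows "((\<lambda>s. q k l k' l' s x) has_real_derivative
    q k (Suc l) k' l' c x + q k l k' (Suc l') c x) (at c)"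
  unfolding q_def 
  using DERIV_mult[OF d_nth_c[OF assms, of k l x 1] d_nth_c[OF assms, of k' l' x 1]]
  by (simp add: ac_simps)

lemma q_shift:
  assumes "c \<in> {1<..cp}"
  shows "((\<lambda>\<xi>. q k l k' l' c (x - \<xi>)) has_real_derivative
    - (q (Suc k) l k' l' c (x - \<xi>) + q k l (Suc k') l' c (x - \<xi>))) (at \<xi>)"
proof -
  have "((\<lambda>\<xi>. x - \<xi>) has_real_derivative - 1) (at \<xi>)" by (auto intro!: derivative_eq_intros)
  from DERIV_chain2[OF q_x[OF assms] this] show ?thesis by simp
qed

text \<open>This family is closed under differentiation: the derivatives in \<open>\<xi>\<close> and
  \<open>c\<close> only raise one of the four indices. \<open>V\<close> and its derivatives are
  combinations of such sums.\<close>

definition Q :: "nat \<Rightarrow> nat \<Rightarrow> nat \<Rightarrow> nat \<Rightarrow> real \<Rightarrow> real \<Rightarrow> (int \<Rightarrow> real) \<Rightarrow> real"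
  where "Q k l k' l' \<xi> c f = pairing (\<lambda>j. q k l k' l' c (real_of_int j - \<xi>)) f"

text \<open>Centred at the origin wherever the wave is; moving the wave by at most \<open>T\<close>
  costs the factor \<open>exp (\<beta> * T)\<close>. One weight therefore serves all times up to a
  given one.\<close>

definition weight :: "int \<Rightarrow> real" where "weight j = exp (- \<beta> * \<bar>real_of_int j\<bar>)"

lemma weight_pos: "0 < weight j" by (simp add: weight_def)

lemma summable_weight: "weight summable_on UNIV"
  unfolding weight_def using summable_on_exp_abs_int[OF \<beta>_pos] .

lemma q_shift_le:
  assumes "c \<in> {cm..cp}" "\<bar>\<xi>\<bar> \<le> T"
  shows "\<bar>q k l k' l' c (real_of_int j - \<xi>)\<bar> \<le> (K k l * K k' l' * exp (\<beta> * T)) * weight j"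
proof -
  have "\<bar>q k l k' l' c (real_of_int j - \<xi>)\<bar> \<le> (K k l * K k' l') * exp (- \<beta> * \<bar>real_of_int j - \<xi>\<bar>)"
    by (rule q_le[OF assms(1)])
  also have "\<dots> \<le> (K k l * K k' l') * (exp (\<beta> * T) * exp (- \<beta> * \<bar>real_of_int j\<bar>))"
    using \<beta>_pos assms(2) by (intro mult_left_mono exp_abs_shift_le mult_nonneg_nonneg K_nonneg) auto
  finally show ?thesis by (simp add: weight_def ac_simps)
qed

lemma summable_weight_bounded:
  assumes "\<And>j. \<bar>f j\<bar> \<le> \<alpha>" shows "(\<lambda>j. C * (\<bar>f j\<bar> * weight j)) summable_on UNIV"
proof (intro summable_on_cmult_right, rule summable_on_dominated)
  show "(\<lambda>j. \<alpha> * weight j) summable_on UNIV" by (intro summable_on_cmult_right summable_weight)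
  show "norm (\<bar>f j\<bar> * weight j) \<le> \<alpha> * weight j" for j
    using assms[of j] weight_pos[of j] by (simp add: abs_mult)
qed

lemma
  assumes f: "\<And>j. \<bar>f j\<bar> \<le> \<alpha>" and w: "\<And>j. \<bar>w j\<bar> \<le> C * weight j"
  shows summable_pairing: "(\<lambda>j. w j * f j) summable_on UNIV"
    and pairing_le: "\<bar>pairing w f\<bar> \<le> C * (\<Sum>\<^sub>\<infinity>j. \<bar>f j\<bar> * weight j)"
proof -
  have *: "norm (w j * f j) \<le> C * (\<bar>f j\<bar> * weight j)" for j
    using mult_right_mono[OF w[of j], of "\<bar>f j\<bar>"] by (simp add: abs_mult ac_simps)
  note s = summable_weight_bounded[OF f, where C = C]
  show "(\<lambda>j. w j * f j) summable_on UNIV" by (rule summable_on_dominated[OF s *])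
  show "\<bar>pairing w f\<bar> \<le> C * (\<Sum>\<^sub>\<infinity>j. \<bar>f j\<bar> * weight j)"
    using norm_infsum_le_infsum[OF s *] by (simp add: pairing_def infsum_cmult_right')
qed

lemma pairing_diff:
  assumes "\<And>j. \<bar>f j\<bar> \<le> \<alpha>" "\<And>j. \<bar>g j\<bar> \<le> \<alpha>'" "\<And>j. \<bar>w j\<bar> \<le> C * weight j"
  shows "pairing w (\<lambda>j. f j - k * g j) = pairing w f - k * pairing w g"
proof -
  have "(\<lambda>j. w j * (f j - k * g j)) = (\<lambda>j. w j * f j + (- k) * (w j * g j))"
    by (simp add: fun_eq_iff algebra_simps)
  then have "pairing w (\<lambda>j. f j - k * g j) = (\<Sum>\<^sub>\<infinity>j. w j * f j + (- k) * (w j * g j))"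
    by (simp add: pairing_def)
  also have "\<dots> = pairing w f + (- k) * pairing w g"
    unfolding pairing_def
    by (simp only: infsum_add[OF summable_pairing[OF assms(1,3)]
          summable_on_cmult_right[OF summable_pairing[OF assms(2,3)]]] infsum_cmult_right')
  finally show ?thesis by simp
qed

text \<open>Termwise differentiation needs one dominating series near the point: for the position it
  holds on a window of radius \<open>T\<close>, for the speed on the whole interval from
  \<open>cm\<close> to \<open>cp\<close>.\<close>

lemma
  assumes f: "\<And>j. \<bar>f j\<bar> \<le> \<alpha>" and c: "c \<in> {cm<..<cp}"
  shows Q_\<xi>: "((\<lambda>\<xi>. Q k l k' l' \<xi> c f) has_real_derivative
            - (Q (Suc k) l k' l' \<xi> c f + Q k l (Suc k') l' \<xi> c f)) (at \<xi>)" (is ?x)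
    and Q_c: "((\<lambda>s. Q k l k' l' \<xi> s f) has_real_derivative
            Q k (Suc l) k' l' \<xi> c f + Q k l k' (Suc l') \<xi> c f) (at c)" (is ?c)
proof -
  define T where "T = \<bar>\<xi>\<bar> + 1"
  have s: "(\<lambda>j. q k l k' l' s (real_of_int j - \<zeta>) * f j) summable_on UNIV"
    if "s \<in> {cm..cp}" "\<bar>\<zeta>\<bar> \<le> T" for \<zeta> s k l k' l'
    by (rule summable_pairing[OF f q_shift_le]) (use that c in auto)
  have bound: "\<bar>(q k1 l1 k2 l2 s (real_of_int j - \<zeta>) + q k3 l3 k4 l4 s (real_of_int j - \<zeta>)) * f j\<bar>
      \<le> ((K k1 l1 * K k2 l2 + K k3 l3 * K k4 l4) * exp (\<beta> * T)) * (\<bar>f j\<bar> * weight j)"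
    if "s \<in> {cm..cp}" "\<bar>\<zeta>\<bar> \<le> T" for k1 l1 k2 l2 k3 l3 k4 l4 s \<zeta> j
  proof -
    have "\<bar>q k1 l1 k2 l2 s (real_of_int j - \<zeta>) + q k3 l3 k4 l4 s (real_of_int j - \<zeta>)\<bar>
      \<le> ((K k1 l1 * K k2 l2 + K k3 l3 * K k4 l4) * exp (\<beta> * T)) * weight j"
      using q_shift_le[OF that, of k1 l1 k2 l2 j] q_shift_le[OF that, of k3 l3 k4 l4 j]
      by (simp add: algebra_simps)
    from mult_right_mono[OF this, of "\<bar>f j\<bar>"] show ?thesis by (simp add: abs_mult ac_simps)
  qed
  have c': "c \<in> {1<..cp}" "c \<in> {cm..cp}" using c speeds by auto
  have "((\<lambda>\<xi>. \<Sum>\<^sub>\<infinity>j. q k l k' l' c (real_of_int j - \<xi>) * f j) has_real_derivative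
     (\<Sum>\<^sub>\<infinity>j. - (q (Suc k) l k' l' c (real_of_int j - \<xi>) + q k l (Suc k') l' c (real_of_int j - \<xi>)) * f j)) (at \<xi>)"
  proof (rule has_real_derivative_infsum(2)[where S = "{-T<..<T}" and ?s0.0 = \<xi>
        and b = "\<lambda>j. ((K (Suc k) l * K k' l' + K k l * K (Suc k') l') * exp (\<beta> * T)) * (\<bar>f j\<bar> * weight j)"])
    show "((\<lambda>\<zeta>. q k l k' l' c (real_of_int j - \<zeta>) * f j) has_real_derivative
      - (q (Suc k) l k' l' c (real_of_int j - \<zeta>) + q k l (Suc k') l' c (real_of_int j - \<zeta>)) * f j) (at \<zeta>)"
      for \<zeta> j by (rule DERIV_cmult_right[OF q_shift[OF c'(1)]])
    show "\<bar>- (q (Suc k) l k' l' c (real_of_int j - \<zeta>) + q k l (Suc k') l' c (real_of_int j - \<zeta>)) * f j\<bar>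
      \<le> ((K (Suc k) l * K k' l' + K k l * K (Suc k') l') * exp (\<beta> * T)) * (\<bar>f j\<bar> * weight j)"
      if "\<zeta> \<in> {-T<..<T}" for \<zeta> j
      unfolding mult_minus_left abs_minus_cancel using that by (intro bound c') auto
  qed (use summable_weight_bounded[OF f] s c' in \<open>auto simp: T_def\<close>)
  also have "(\<lambda>j. - (q (Suc k) l k' l' c (real_of_int j - \<xi>) + q k l (Suc k') l' c (real_of_int j - \<xi>)) * f j)
    = (\<lambda>j. - (q (Suc k) l k' l' c (real_of_int j - \<xi>) * f j + q k l (Suc k') l' c (real_of_int j - \<xi>) * f j))"
    by (simp add: fun_eq_iff algebra_simps)
  finally show ?x
    unfolding Q_def pairing_def infsum_uminus using s c' by (simp add: T_def infsum_add)
  have "((\<lambda>c. \<Sum>\<^sub>\<infinity>j. q k l k' l' c (real_of_int j - \<xi>) * f j) has_real_derivative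
     (\<Sum>\<^sub>\<infinity>j. (q k (Suc l) k' l' c (real_of_int j - \<xi>) + q k l k' (Suc l') c (real_of_int j - \<xi>)) * f j)) (at c)"
  proof (rule has_real_derivative_infsum(2)[where S = "{cm<..<cp}" and ?s0.0 = c
        and b = "\<lambda>j. ((K k (Suc l) * K k' l' + K k l * K k' (Suc l')) * exp (\<beta> * T)) * (\<bar>f j\<bar> * weight j)"])
    show "((\<lambda>s. q k l k' l' s (real_of_int j - \<xi>) * f j) has_real_derivative
      (q k (Suc l) k' l' s (real_of_int j - \<xi>) + q k l k' (Suc l') s (real_of_int j - \<xi>)) * f j) (at s)"
      if "s \<in> {cm<..<cp}" for s j using that speeds by (intro DERIV_cmult_right q_c) auto
    show "\<bar>(q k (Suc l) k' l' s (real_of_int j - \<xi>) + q k l k' (Suc l') s (real_of_int j - \<xi>)) * f j\<bar>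
      \<le> ((K k (Suc l) * K k' l' + K k l * K k' (Suc l')) * exp (\<beta> * T)) * (\<bar>f j\<bar> * weight j)"
      if "s \<in> {cm<..<cp}" for s j using that by (intro bound) (auto simp: T_def)
  qed (use summable_weight_bounded[OF f] s c c' in \<open>auto simp: T_def\<close>)
  then show ?c
    unfolding Q_def pairing_def using s c' by (simp add: T_def distrib_right infsum_add)
qed

section \<open>The expansion map \<open>V\<close> as an explicit combination of lattice sums\<close>

lemma D\<xi>_rwave_sq: "c \<in> {1<..cp} \<Longrightarrow>
    D\<xi> (\<lambda>\<xi> c. (rwave j \<xi> c)\<^sup>2) \<xi> c = - 2 * q 0 0 1 0 c (real_of_int j - \<xi>)"
  using q_shift[of c 0 0 0 0 "real_of_int j" \<xi>]
  by (intro D\<xi>_eq) (simp add: rwave_eq q_def power2_eq_square has_real_derivative_iff_has_vector_derivative)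

lemma Dc_rwave_sq: "c \<in> {1<..<cp} \<Longrightarrow>
    Dc (\<lambda>\<xi> c. (rwave j \<xi> c)\<^sup>2) \<xi> c = 2 * q 0 0 0 1 c (real_of_int j - \<xi>)"
  using q_c[of c 0 0 0 0 "real_of_int j - \<xi>"]
  by (intro Dc_eq[of c])
     (auto simp: rwave_eq q_def power2_eq_square at_within_speeds simp flip: has_real_derivative_iff_has_vector_derivative)

lemma D\<xi>_rwave: "c \<in> {1<..cp} \<Longrightarrow> D\<xi> (rwave j) \<xi> c = - d 1 0 c (real_of_int j - \<xi>) $ 1"
  using bounded_linear.has_vector_derivative[OF bounded_linear_vec_nth d_shift[of c 0 0 "real_of_int j" \<xi>], of 1]
  by (intro D\<xi>_eq) (simp add: rwave_eq)

lemma Dc_rwave: "c \<in> {1<..<cp} \<Longrightarrow> Dc (rwave j) \<xi> c = d 0 1 c (real_of_int j - \<xi>) $ 1"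
  using d_nth_c[of c 0 0 "real_of_int j - \<xi>" 1]
  by (intro Dc_eq[of c]) (auto simp: rwave_eq at_within_speeds has_real_derivative_iff_has_vector_derivative)

lemma matrix_inv_A:
  assumes "c \<in> {1<..cp}"
  shows "matrix_inv (A c) = vector [vec2 (\<alpha>1 c / (\<alpha>0 c)\<^sup>2) (- 1 / \<alpha>0 c), vec2 (1 / \<alpha>0 c) 0]" (is "_ = ?B")
  by (rule matrix_inv_unique)
     (use \<alpha>0_pos[OF assms] in \<open>auto simp: A_def matrix_matrix_mult_def vec_eq_iff forall_2 sum_2
       mat_def power2_eq_square field_simps\<close>)

lemma matrix_inv_A_mult:
  assumes "c \<in> {1<..cp}"
  shows "matrix_inv (A c) *v v = vec2 (\<alpha>1 c / (\<alpha>0 c)\<^sup>2 * v $ 1 - v $ 2 / \<alpha>0 c) (v $ 1 / \<alpha>0 c)"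
  by (simp add: matrix_inv_A[OF assms] matrix_vector_mult_def vec2_eq_iff sum_2)

text \<open>The factors -2 and 2 from differentiating the square cancel the prefactor -1/2, so the
  explicit inverse of \<open>A c\<close> acts on the vector with entries \<open>Q 0 0 1 0\<close>
  and \<open>- Q 0 0 0 1\<close>.\<close>

lemma V_eq:
  assumes "c \<in> {1<..<cp}"
  shows "V \<xi> c f = vec2 (\<alpha>1 c / (\<alpha>0 c)\<^sup>2 * Q 0 0 1 0 \<xi> c f + Q 0 0 0 1 \<xi> c f / \<alpha>0 c)
                      (Q 0 0 1 0 \<xi> c f / \<alpha>0 c)"
proof -
  have c: "c \<in> {1<..cp}" using assms by auto
  have 1: "pairing (\<lambda>j. D\<xi> (\<lambda>\<xi> c. (rwave j \<xi> c)\<^sup>2) \<xi> c) f = - 2 * Q 0 0 1 0 \<xi> c f"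
    unfolding D\<xi>_rwave_sq[OF c] Q_def pairing_cmult ..
  have 2: "pairing (\<lambda>j. Dc (\<lambda>\<xi> c. (rwave j \<xi> c)\<^sup>2) \<xi> c) f = 2 * Q 0 0 0 1 \<xi> c f"
    unfolding Dc_rwave_sq[OF assms] Q_def pairing_cmult ..
  show ?thesis
    unfolding V_def 1 2 matrix_inv_A_mult[OF c] by (simp add: vec2_eq_iff field_simps)
qed

text \<open>The size of the coefficients as seen by a localized wave. All estimates linear in the
  coefficients are stated in it, with constants independent of the coefficients.\<close>

definition wsum :: "(int \<Rightarrow> real) \<Rightarrow> real"
  where "wsum f = (\<Sum>\<^sub>\<infinity>j. \<bar>f j\<bar> * weight j)"

lemma wsum_nonneg: "0 \<le> wsum f"
  unfolding wsum_def using weight_pos by (intro infsum_nonneg mult_nonneg_nonneg) (auto simp: less_imp_le)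

lemma wsum_unit_seq: "wsum (unit_seq m) = weight m"
proof -
  have "wsum (unit_seq m) = (\<Sum>\<^sub>\<infinity>j\<in>{m}. \<bar>unit_seq m j\<bar> * weight j)"
    unfolding wsum_def by (rule infsum_cong_neutral) (auto simp: unit_seq_def)
  then show ?thesis by (simp add: unit_seq_def)
qed

lemma Q_le:
  assumes "c \<in> {cm..cp}" "\<bar>\<xi>\<bar> \<le> T" "\<And>j. \<bar>f j\<bar> \<le> \<alpha>"
  shows "\<bar>Q k l k' l' \<xi> c f\<bar> \<le> (K k l * K k' l' * exp (\<beta> * T)) * wsum f"
  unfolding Q_def wsum_def by (rule pairing_le[OF assms(3) q_shift_le[OF assms(1,2)]])

lemma Q_diff:
  assumes "c \<in> {cm..cp}" "\<And>j. \<bar>f j\<bar> \<le> \<alpha>" "\<And>j. \<bar>g j\<bar> \<le> \<alpha>'"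
  shows "Q k l k' l' \<xi> c (\<lambda>j. f j - x * g j) = Q k l k' l' \<xi> c f - x * Q k l k' l' \<xi> c g"
  unfolding Q_def by (rule pairing_diff[OF assms(2,3) q_shift_le[OF assms(1) order_refl]])

lemma V_diff:
  assumes "c \<in> {cm<..<cp}" "\<And>j. \<bar>f j\<bar> \<le> \<alpha>" "\<And>j. \<bar>g j\<bar> \<le> \<alpha>'"
  shows "V \<xi> c (\<lambda>j. f j - x * g j) = V \<xi> c f - x *\<^sub>R V \<xi> c g"
proof -
  have c: "c \<in> {1<..<cp}" "c \<in> {cm..cp}" using assms(1) speeds by auto
  show ?thesis
    unfolding V_eq[OF c(1)] Q_diff[OF c(2) assms(2,3)]
    by (simp add: vec2_eq_iff algebra_simps diff_divide_distrib)
qed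

lemma V_le:
  assumes c: "c \<in> {cm<..<cp}" and T: "0 \<le> T"
  shows "\<exists>C\<ge>0. \<forall>\<xi> f \<alpha> i. \<bar>\<xi>\<bar> \<le> T \<longrightarrow> (\<forall>j. \<bar>f j\<bar> \<le> \<alpha>) \<longrightarrow> \<bar>V \<xi> c f $ i\<bar> \<le> C * wsum f"
proof -
  have c': "c \<in> {1<..<cp}" "c \<in> {cm..cp}" using c speeds by auto
  have \<alpha>0: "0 < \<alpha>0 c" using \<alpha>0_pos[of c] c' by auto
  let ?A = "K 0 0 * K 1 0 * exp (\<beta> * T)" and ?B = "K 0 0 * K 0 1 * exp (\<beta> * T)"
  have nn: "0 \<le> ?A" "0 \<le> ?B" using K_nonneg by auto
  define C where "C = \<bar>\<alpha>1 c / (\<alpha>0 c)\<^sup>2\<bar> * ?A + ?B / \<alpha>0 c + ?A / \<alpha>0 c"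
  have "\<bar>V \<xi> c f $ i\<bar> \<le> C * wsum f" if "\<bar>\<xi>\<bar> \<le> T" "\<And>j. \<bar>f j\<bar> \<le> \<alpha>" for \<xi> f \<alpha> i
  proof -
    have A: "\<bar>Q 0 0 1 0 \<xi> c f\<bar> \<le> ?A * wsum f" and B: "\<bar>Q 0 0 0 1 \<xi> c f\<bar> \<le> ?B * wsum f"
      using Q_le[OF c'(2) that] by auto
    have 1: "\<bar>\<alpha>1 c / (\<alpha>0 c)\<^sup>2 * Q 0 0 1 0 \<xi> c f\<bar> \<le> \<bar>\<alpha>1 c / (\<alpha>0 c)\<^sup>2\<bar> * (?A * wsum f)"
      unfolding abs_mult by (intro mult_left_mono A) auto
    have 2: "\<bar>Q 0 0 0 1 \<xi> c f / \<alpha>0 c\<bar> \<le> ?B * wsum f / \<alpha>0 c"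
      using B \<alpha>0 by (simp add: divide_right_mono)
    have 3: "\<bar>Q 0 0 1 0 \<xi> c f / \<alpha>0 c\<bar> \<le> ?A * wsum f / \<alpha>0 c"
      using A \<alpha>0 by (simp add: divide_right_mono)
    have C: "C * wsum f = \<bar>\<alpha>1 c / (\<alpha>0 c)\<^sup>2\<bar> * (?A * wsum f) + ?B * wsum f / \<alpha>0 c + ?A * wsum f / \<alpha>0 c"
      by (simp add: C_def algebra_simps)
    have nn': "0 \<le> \<bar>\<alpha>1 c / (\<alpha>0 c)\<^sup>2\<bar> * (?A * wsum f)" "0 \<le> ?B * wsum f / \<alpha>0 c" "0 \<le> ?A * wsum f / \<alpha>0 c"
      using nn wsum_nonneg \<alpha>0 by (auto intro!: mult_nonneg_nonneg divide_nonneg_nonneg less_imp_le)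
    consider "i = 1" | "i = 2" using exhaust_2 by blast
    then show ?thesis
    proof cases
      case i: 1
      show ?thesis unfolding C V_eq[OF c'(1)] i vec2_nth
        using 1 2 nn'(3) abs_triangle_ineq[of "\<alpha>1 c / (\<alpha>0 c)\<^sup>2 * Q 0 0 1 0 \<xi> c f" "Q 0 0 0 1 \<xi> c f / \<alpha>0 c"]
        by linarith
    next
      case i: 2
      show ?thesis unfolding C V_eq[OF c'(1)] i vec2_nth using 3 nn' by linarith
    qed
  qed
  moreover have "0 \<le> C"
    using nn \<alpha>0 by (auto simp: C_def intro!: add_nonneg_nonneg mult_nonneg_nonneg divide_nonneg_nonneg)
  ultimately show ?thesis by blast
qed

section \<open>The tail equation: bound for the inhomogeneity, bound for the solution,
  superposition\<close>

lemma T10_diff: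
  assumes "c \<in> {cm<..<cp}" "\<And>j. \<bar>f j\<bar> \<le> \<alpha>" "\<And>j. \<bar>g j\<bar> \<le> \<alpha>'"
  shows "T10 \<xi> c (\<lambda>j. f j - x * g j) j = T10 \<xi> c f j - x *\<^sub>R T10 \<xi> c g j"
  by (simp add: T10_def \<Gamma>10_def C10_def V_diff[OF assms] vec2_eq_iff dminus_def algebra_simps)

lemma d_shift_le:
  assumes "c \<in> {cm..cp}" "\<bar>\<xi>\<bar> \<le> T"
  shows "norm (d k l c (real_of_int j - \<xi>)) \<le> K k l * exp (\<beta> * T) * weight j"
proof -
  have "norm (d k l c (real_of_int j - \<xi>)) \<le> K k l * exp (- \<beta> * \<bar>real_of_int j - \<xi>\<bar>)"
    by (rule decay[OF assms(1)])
  also have "\<dots> \<le> K k l * (exp (\<beta> * T) * exp (- \<beta> * \<bar>real_of_int j\<bar>))"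
    using \<beta>_pos assms(2) by (intro mult_left_mono exp_abs_shift_le K_nonneg) auto
  finally show ?thesis by (simp add: weight_def ac_simps)
qed

text \<open>An l1 estimate over the sites: the two tangent vectors are localized with amplitudes
  bounded by \<open>wsum f\<close>, and the difference operator contributes the localized
  coefficients and their shift by one site, each with sum \<open>wsum f\<close>. Speaking of an
  \<open>x\<close> with \<open>seq x = T10 \<xi> c f\<close> avoids a separate proof that the
  inhomogeneity is square summable.\<close>

lemma T10_le:
  assumes c: "c \<in> {cm<..<cp}" and T: "0 \<le> T"
  shows "\<exists>C\<ge>0. \<forall>\<xi> f \<alpha> x. \<bar>\<xi>\<bar> \<le> T \<longrightarrow> (\<forall>j. \<bar>f j\<bar> \<le> \<alpha>) \<longrightarrow> seq x = T10 \<xi> c f \<longrightarrow> norm x \<le> C * wsum f"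
proof -
  have c': "c \<in> {1<..<cp}" "c \<in> {cm..cp}" "c \<in> {1<..cp}" using c speeds by auto
  obtain C where C: "0 \<le> C" "\<And>\<xi> f \<alpha> i. \<bar>\<xi>\<bar> \<le> T \<Longrightarrow> (\<And>j. \<bar>f j\<bar> \<le> \<alpha>) \<Longrightarrow> \<bar>V \<xi> c f $ i\<bar> \<le> C * wsum f"
    using V_le[OF c T] by blast
  let ?e = "exp (\<beta> * T)"
  note d = d_shift_le[OF c'(2)]
  define D where "D = C * (K 1 0 + K 0 1) * ?e"
  define E where "E = K 0 0 * ?e"
  define C' where "C' = D * infsum weight UNIV + 2 * E"
  have DE: "0 \<le> D" "0 \<le> E" using C(1) K_nonneg by (auto simp: D_def E_def)
  have "norm x \<le> C' * wsum f"
    if \<xi>: "\<bar>\<xi>\<bar> \<le> T" and f: "\<And>j. \<bar>f j\<bar> \<le> \<alpha>" and x: "seq x = T10 \<xi> c f" for \<xi> f \<alpha> x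
  proof -
    let ?b = "\<lambda>j. \<bar>f j\<bar> * weight j"
    have sb: "?b summable_on UNIV" using summable_weight_bounded[OF f, of 1] by simp
    have sb': "(\<lambda>j. ?b (j - 1)) summable_on UNIV" "(\<Sum>\<^sub>\<infinity>j. ?b (j - 1)) = wsum f"
      using summable_on_int_shift[of ?b "- 1"] infsum_int_shift[of ?b "- 1"] sb by (simp_all add: wsum_def)
    have fr: "\<bar>f j * rwave j \<xi> c\<bar> \<le> E * ?b j" for j
    proof -
      have "\<bar>rwave j \<xi> c\<bar> \<le> E * weight j"
        unfolding rwave_eq[OF c'(3)] E_def by (rule order_trans[OF component_le_norm_cart d[OF \<xi>]])
      then show ?thesis
        using mult_left_mono[of "\<bar>rwave j \<xi> c\<bar>" "E * weight j" "\<bar>f j\<bar>"] by (simp add: abs_mult ac_simps)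
    qed
    have le: "norm (seq x j) \<le> (D * wsum f) * weight j + E * ?b j + E * ?b (j - 1)" for j
    proof -
      have "norm (seq x j) \<le> norm (- V \<xi> c f $ 1 *\<^sub>R \<phi>\<xi> \<xi> c j - V \<xi> c f $ 2 *\<^sub>R \<phi>c \<xi> c j)
          + norm (vec2 0 (dminus (\<lambda>i. f i * rwave i \<xi> c) j))"
        unfolding x T10_def \<Gamma>10_def C10_def by (rule norm_triangle_ineq)
      also have "norm (- V \<xi> c f $ 1 *\<^sub>R \<phi>\<xi> \<xi> c j - V \<xi> c f $ 2 *\<^sub>R \<phi>c \<xi> c j)
          \<le> \<bar>V \<xi> c f $ 1\<bar> * norm (d 1 0 c (real_of_int j - \<xi>)) + \<bar>V \<xi> c f $ 2\<bar> * norm (d 0 1 c (real_of_int j - \<xi>))"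
        unfolding tangent_eq[OF c'(3)] by (rule order_trans[OF norm_triangle_ineq4]) simp
      also have "\<dots> \<le> (C * wsum f) * (K 1 0 * ?e * weight j) + (C * wsum f) * (K 0 1 * ?e * weight j)"
        using C(1) wsum_nonneg by (intro add_mono mult_mono C(2)[OF \<xi> f] d[OF \<xi>]) auto
      also have "norm (vec2 0 (dminus (\<lambda>i. f i * rwave i \<xi> c) j)) \<le> E * ?b j + E * ?b (j - 1)"
        using norm_vec2_le[of "vec2 0 (dminus (\<lambda>i. f i * rwave i \<xi> c) j)"]  fr[of j] fr[of "j - 1"]
        unfolding dminus_def by simp
      finally show ?thesis by (simp add: D_def algebra_simps)
    qed
    have s: "(\<lambda>j. (D * wsum f) * weight j + E * ?b j + E * ?b (j - 1)) summable_on UNIV"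
      by (intro summable_on_add summable_on_cmult_right summable_weight sb sb')
    have "norm x \<le> (\<Sum>\<^sub>\<infinity>j. (D * wsum f) * weight j + E * ?b j + E * ?b (j - 1))"
      by (rule norm_ell2_le_infsum[OF s le])
    also have "\<dots> = (D * wsum f) * infsum weight UNIV + E * wsum f + E * wsum f"
      by (simp only: infsum_add[OF summable_on_add] infsum_add summable_on_cmult_right[OF summable_weight]
          summable_on_cmult_right[OF sb] summable_on_cmult_right[OF sb'(1)] infsum_cmult_right' sb'(2) wsum_def[symmetric])
    finally show ?thesis by (simp add: C'_def algebra_simps)
  qed
  moreover have "0 \<le> C'"
    using DE infsum_nonneg[of UNIV weight] weight_pos by (auto simp: C'_def less_imp_le)
  ultimately show ?thesis by blast
qed

lemma solves_tail_diff:
  assumes c: "c \<in> {cm<..<cp}" and f: "\<And>j. \<bar>f j\<bar> \<le> \<alpha>" and g: "\<And>j. \<bar>g j\<bar> \<le> \<alpha>'"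
    and \<A>: "\<And>t. linear (\<A> (c * t))"
    and x: "solves_tail c \<A> f x" and y: "solves_tail c \<A> g y"
  shows "solves_tail c \<A> (\<lambda>j. f j - k * g j) (\<lambda>s. x s - k *\<^sub>R y s)"
  unfolding solves_tail_def
proof (intro conjI allI impI)
  show "x 0 - k *\<^sub>R y 0 = 0" using x y by (simp add: solves_tail_def)
  fix t :: real assume "0 \<le> t"
  then obtain x' y' where x': "(x has_vector_derivative x') (at t within {0..})"
      "seq x' = (\<lambda>j. seq (J_ell2 (\<A> (c * t) (x t))) j + T10 (c * t) c f j)"
    and y': "(y has_vector_derivative y') (at t within {0..})"
      "seq y' = (\<lambda>j. seq (J_ell2 (\<A> (c * t) (y t))) j + T10 (c * t) c g j)"
    using x y unfolding solves_tail_def by blast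
  have "((\<lambda>s. x s - k *\<^sub>R y s) has_vector_derivative x' - k *\<^sub>R y') (at t within {0..})"
    by (intro has_vector_derivative_diff x'
        bounded_linear.has_vector_derivative[OF bounded_linear_scaleR_right y'(1)])
  moreover have "seq (x' - k *\<^sub>R y') = (\<lambda>j. seq (J_ell2 (\<A> (c * t) (x t - k *\<^sub>R y t))) j
      + T10 (c * t) c (\<lambda>j. f j - k * g j) j)"
    using x'(2) y'(2)
    by (simp add: fun_eq_iff T10_diff[OF c f g] linear_diff[OF \<A>] linear_cmul[OF \<A>]
        linear_diff[OF linear_J_ell2] linear_cmul[OF linear_J_ell2] algebra_simps)
  ultimately show "\<exists>x'. ((\<lambda>s. x s - k *\<^sub>R y s) has_vector_derivative x') (at t within {0..}) \<and>
      seq x' = (\<lambda>j. seq (J_ell2 (\<A> (c * t) (x t - k *\<^sub>R y t))) j + T10 (c * t) c (\<lambda>j. f j - k * g j) j)"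
    by blast
qed

text \<open>The inhomogeneity is recovered as the derivative of \<open>x\<close> minus the generator
  term, which is an element of \<open>ell2\<close> by construction. The window radius
  \<open>c * t\<close> covers every wave position up to time \<open>t\<close>.\<close>

lemma solves_tail_le:
  assumes c: "c \<in> {cm<..<cp}" and gen: "generates (\<lambda>t w. J_ell2 (\<A> (c * t) w)) U" and t: "0 \<le> t"
  shows "\<exists>C\<ge>0. \<forall>f \<alpha> x. (\<forall>j. \<bar>f j\<bar> \<le> \<alpha>) \<longrightarrow> solves_tail c \<A> f x \<longrightarrow> norm (x t) \<le> C * wsum f"
proof -
  have c0: "0 < c" using c speeds by auto
  obtain C where C: "0 \<le> C" "\<And>\<xi> f \<alpha> x. \<bar>\<xi>\<bar> \<le> c * t \<Longrightarrow> (\<And>j. \<bar>f j\<bar> \<le> \<alpha>) \<Longrightarrow> seq x = T10 \<xi> c f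
      \<Longrightarrow> norm x \<le> C * wsum f"
    using T10_le[OF c, of "c * t"] c0 t by (metis mult_nonneg_nonneg less_imp_le)
  obtain M where M: "0 \<le> M" "\<And>z f B. z 0 = 0 \<Longrightarrow>
      (\<And>s. s \<in> {0..t} \<Longrightarrow> (z has_vector_derivative J_ell2 (\<A> (c * s) (z s)) + f s) (at s within {0..})) \<Longrightarrow>
      (\<And>s. s \<in> {0..t} \<Longrightarrow> norm (f s) \<le> B) \<Longrightarrow> norm (z t) \<le> M * B"
    using inhomogeneous_evolution_bound[OF gen t] by blast
  have "norm (x t) \<le> (M * C) * wsum f" if f: "\<And>j. \<bar>f j\<bar> \<le> \<alpha>" and x: "solves_tail c \<A> f x" for f \<alpha> x
  proof -
    have "\<exists>x'. (x has_vector_derivative x') (at s within {0..}) \<and>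
       seq x' = (\<lambda>j. seq (J_ell2 (\<A> (c * s) (x s))) j + T10 (c * s) c f j)" if "s \<in> {0..t}" for s
      using x that by (simp add: solves_tail_def)
    then obtain x' where x': "\<And>s. s \<in> {0..t} \<Longrightarrow> (x has_vector_derivative x' s) (at s within {0..})"
      "\<And>s. s \<in> {0..t} \<Longrightarrow> seq (x' s) = (\<lambda>j. seq (J_ell2 (\<A> (c * s) (x s))) j + T10 (c * s) c f j)"
      by metis
    have "norm (x t) \<le> M * (C * wsum f)"
    proof (rule M(2)[of x "\<lambda>s. x' s - J_ell2 (\<A> (c * s) (x s))"])
      fix s assume s: "s \<in> {0..t}"
      show "(x has_vector_derivative J_ell2 (\<A> (c * s) (x s)) + (x' s - J_ell2 (\<A> (c * s) (x s)))) (at s within {0..})"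
        using x'(1)[OF s] by simp
      show "norm (x' s - J_ell2 (\<A> (c * s) (x s))) \<le> C * wsum f"
        by (rule C(2)[of "c * s" _ \<alpha>]) (use s c0 f x'(2)[OF s] in \<open>auto simp: fun_eq_iff abs_mult\<close>)
    qed (use x in \<open>simp add: solves_tail_def\<close>)
    then show ?thesis by simp
  qed
  then show ?thesis using C M by (intro exI[of _ "M * C"]) auto
qed

text \<open>Subtracting the responses at the sites of a finite set \<open>F\<close> leaves a
  solution whose coefficients vanish on \<open>F\<close>. Its norm is at most a constant times the
  part of the convergent series \<open>wsum f\<close> outside \<open>F\<close>, which tends to zero.
  On a unit sequence the same bound is the decay in \<open>m\<close>.\<close>

lemma tail_expansion:
  assumes c: "c \<in> {cm<..<cp}" and gen: "generates (\<lambda>t w. J_ell2 (\<A> (c * t) w)) U" and t: "0 \<le> t"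
    and \<A>: "\<And>t. linear (\<A> (c * t))"
    and R: "\<And>m. solves_tail c \<A> (unit_seq m) (R m)"
  shows "\<exists>C. \<forall>m. norm (R m t) \<le> C * weight m"
    and "(\<And>j. \<bar>f j\<bar> \<le> \<alpha>) \<Longrightarrow> solves_tail c \<A> f x \<Longrightarrow> ((\<lambda>m. f m *\<^sub>R R m t) has_sum x t) UNIV"
proof -
  obtain C where C: "0 \<le> C" "\<And>f \<alpha> x. (\<And>j. \<bar>f j\<bar> \<le> \<alpha>) \<Longrightarrow> solves_tail c \<A> f x \<Longrightarrow> norm (x t) \<le> C * wsum f"
    using solves_tail_le[OF c gen t] by blast
  have unit: "\<bar>unit_seq m j\<bar> \<le> 1" for m j by (simp add: unit_seq_def)
  show "\<exists>C. \<forall>m. norm (R m t) \<le> C * weight m"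
    using C(2)[OF unit R] by (auto simp: wsum_unit_seq)
  assume f: "\<And>j. \<bar>f j\<bar> \<le> \<alpha>" and x: "solves_tail c \<A> f x"
  have \<alpha>: "0 \<le> \<alpha>" using f[of 0] by linarith
  have part: "solves_tail c \<A> (\<lambda>j. if j \<in> F then 0 else f j) (\<lambda>s. x s - (\<Sum>m\<in>F. f m *\<^sub>R R m s))"
    if "finite F" for F
    using that
  proof induction
    case empty
    then show ?case using x by simp
  next
    case (insert m F)
    have "(\<lambda>j. if j \<in> insert m F then 0 else f j) = (\<lambda>j. (if j \<in> F then 0 else f j) - f m * unit_seq m j)"
      using insert by (auto simp: fun_eq_iff unit_seq_def)
    moreover have "\<bar>if j \<in> F then 0 else f j\<bar> \<le> \<alpha>" for j using f \<alpha> by auto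
    ultimately show ?case
      using solves_tail_diff[OF c _ unit \<A> insert.IH R[of m], of \<alpha> "f m"] insert.hyps
      by (simp add: algebra_simps)
  qed
  have b: "(\<lambda>j. \<bar>f j\<bar> * weight j) summable_on UNIV" using summable_weight_bounded[OF f, of 1] by simp
  have rest: "wsum (\<lambda>j. if j \<in> F then 0 else f j) = wsum f - (\<Sum>j\<in>F. \<bar>f j\<bar> * weight j)" if "finite F" for F
  proof -
    have "wsum (\<lambda>j. if j \<in> F then 0 else f j) = (\<Sum>\<^sub>\<infinity>j\<in>UNIV - F. \<bar>f j\<bar> * weight j)"
      unfolding wsum_def by (rule infsum_cong_neutral) auto
    also have "\<dots> = wsum f - (\<Sum>\<^sub>\<infinity>j\<in>F. \<bar>f j\<bar> * weight j)"
      unfolding wsum_def using b that by (intro infsum_Diff) auto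
    finally show ?thesis using that by simp
  qed
  show "((\<lambda>m. f m *\<^sub>R R m t) has_sum x t) UNIV"
    unfolding has_sum_def
  proof (rule iffD2[OF Lim_null], rule Lim_null_comparison)
    show "\<forall>\<^sub>F F in finite_subsets_at_top UNIV. norm ((\<Sum>m\<in>F. f m *\<^sub>R R m t) - x t)
        \<le> C * (wsum f - (\<Sum>j\<in>F. \<bar>f j\<bar> * weight j))"
    proof (rule eventually_finite_subsets_at_top_weakI)
      fix F :: "int set" assume F: "finite F"
      have "norm (x t - (\<Sum>m\<in>F. f m *\<^sub>R R m t)) \<le> C * wsum (\<lambda>j. if j \<in> F then 0 else f j)"
        by (rule C(2)[OF _ part[OF F], of \<alpha>]) (use f \<alpha> in auto)
      then show "norm ((\<Sum>m\<in>F. f m *\<^sub>R R m t) - x t) \<le> C * (wsum f - (\<Sum>j\<in>F. \<bar>f j\<bar> * weight j))"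
        by (simp add: rest[OF F] norm_minus_commute)
    qed
    have "((\<lambda>F. \<Sum>j\<in>F. \<bar>f j\<bar> * weight j) \<longlongrightarrow> wsum f) (finite_subsets_at_top UNIV)"
      using has_sum_infsum[OF b] by (simp add: has_sum_def wsum_def)
    then show "((\<lambda>F. C * (wsum f - (\<Sum>j\<in>F. \<bar>f j\<bar> * weight j))) \<longlongrightarrow> 0) (finite_subsets_at_top UNIV)"
      by (intro tendsto_mult_right_zero) (auto intro!: tendsto_eq_intros)
  qed
qed

end

section \<open>Differentiability of \<open>\<alpha>0\<close> and \<open>\<alpha>1\<close> in the
  speed\<close>

lemma integrable_exp_abs:
  assumes "0 < \<beta>" shows "integrable lborel (\<lambda>x::real. exp (- \<beta> * \<bar>x\<bar>))"
proof -
  have pos: "integrable lborel (\<lambda>x::real. indicator {0<..} x * exp (- (x * \<beta>)))"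
    using integrable_I0i_exp_mscale[OF assms] by (simp add: set_integrable_def)
  have neg: "integrable lborel (\<lambda>x::real. indicator {0<..} (0 + (- 1) * x) * exp (- ((0 + (- 1) * x) * \<beta>)))"
    by (rule lborel_integrable_real_affine[OF pos]) simp
  have "integrable lborel (\<lambda>x::real. indicator {0<..} x * exp (- (x * \<beta>))
      + indicator {0<..} (0 + (- 1) * x) * exp (- ((0 + (- 1) * x) * \<beta>)))"
    by (rule Bochner_Integration.integrable_add[OF pos neg])
  then show ?thesis
  proof (rule integrable_cong_AE_imp)
    show "AE x in lborel. indicator {0<..} x * exp (- (x * \<beta>))
      + indicator {0<..} (0 + (- 1) * x) * exp (- ((0 + (- 1) * x) * \<beta>)) = exp (- \<beta> * \<bar>x\<bar>)"
      using AE_lborel_singleton[of 0] by eventually_elim (simp add: indicator_def abs_if mult.commute[of \<beta>])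
  qed auto
qed

context localized_waves
begin

lemma deriv_within_speeds_eq:
  assumes "c \<in> {cm<..<cp}" "\<And>s. s \<in> {1<..cp} \<Longrightarrow> F s = G s" "(G has_real_derivative G') (at c)"
  shows "vector_derivative F (at c within {1<..cp}) = G'"
proof -
  have "Dc (\<lambda>_. F) 0 c = G'"
  proof (rule Dc_eq[of c _ 0 G])
    show "(G has_vector_derivative G') (at c within {1<..cp})"
      by (rule has_vector_derivative_at_within)
         (rule assms(3)[unfolded has_real_derivative_iff_has_vector_derivative])
    show "c \<in> {1<..cp}" using assms(1) speeds by auto
  qed (rule assms(2))
  then show ?thesis by (simp add: Dc_def)
qed

lemma DERIV_transform_speeds:
  assumes "(G has_real_derivative G') (at c)" "c \<in> {cm<..<cp}" "\<And>s. s \<in> {cm<..<cp} \<Longrightarrow> F s = G s"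
  shows "(F has_real_derivative G') (at c)"
  by (rule has_field_derivative_transform_within_open[OF assms(1) open_greaterThanLessThan assms(2)])
     (rule assms(3)[symmetric])

text \<open>Up to the factor \<open>1 / c\<close>, \<open>\<alpha>0\<close> is already the speed
  derivative of the energy sum, so that sum has to be differentiated termwise a second time.\<close>

lemma \<alpha>0_differentiable:
  assumes c: "c \<in> {cm<..<cp}" shows "\<exists>D. (\<alpha>0 has_real_derivative D) (at c)"
proof -
  have int: "s \<in> {1<..<cp}" "s \<in> {1<..cp}" "s \<in> {cm..cp}" if "s \<in> {cm<..<cp}" for s
    using that speeds by auto
  let ?P = "\<lambda>l s j. d 0 l s (real_of_int j) $ 2" and ?R = "\<lambda>l s j. d 0 l s (real_of_int j) $ 1"
  \<comment> \<open>The energy density at site \<open>j\<close>, followed by its first and second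
    derivative in the speed. The terms of \<open>H2\<close> keep the shape in which the product rule
    delivers them.\<close>
  define H where "H s j = 1/2 * (?P 0 s j)\<^sup>2 + 1/2 * (?R 0 s j)\<^sup>2 + 1/3 * (?R 0 s j)^3" for s j
  define H1 where "H1 s j = ?P 0 s j * ?P (Suc 0) s j + ?R 0 s j * ?R (Suc 0) s j
    + ?R 0 s j * (?R 0 s j * ?R (Suc 0) s j)" for s j
  define H2 where "H2 s j =
    ?P (Suc 0) s j * ?P (Suc 0) s j + ?P (Suc (Suc 0)) s j * ?P 0 s j
    + (?R (Suc 0) s j * ?R (Suc 0) s j + ?R (Suc (Suc 0)) s j * ?R 0 s j)
    + (?R (Suc 0) s j * (?R 0 s j * ?R (Suc 0) s j)
      + (?R (Suc 0) s j * ?R (Suc 0) s j + ?R (Suc (Suc 0)) s j * ?R 0 s j) * ?R 0 s j)" for s j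
  have dd: "((\<lambda>s. d 0 l s x $ i) has_real_derivative d 0 (Suc l) s x $ i) (at s)" if "s \<in> {cm<..<cp}" for l x i s
    using d_nth_c[OF int(1)[OF that]] .
  have H: "((\<lambda>s. H s j) has_real_derivative H1 s j) (at s)" if "s \<in> {cm<..<cp}" for s j
    unfolding H_def H1_def
    by (rule DERIV_cong, (rule DERIV_add DERIV_cmult DERIV_power dd[OF that])+) (simp add: power2_eq_square)
  have H1: "((\<lambda>s. H1 s j) has_real_derivative H2 s j) (at s)" if "s \<in> {cm<..<cp}" for s j
    unfolding H1_def H2_def by (intro DERIV_add DERIV_mult dd[OF that])
  have D: "\<bar>d 0 l s (real_of_int j) $ i\<bar> \<le> K 0 l * exp (- \<beta> * \<bar>real_of_int j\<bar>)" if "s \<in> {cm<..<cp}" for l s j i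
    by (rule d_nth_le[OF int(3)[OF that]])
  let ?k = "K 0 0" and ?l = "K 0 (Suc 0)" and ?m = "K 0 (Suc (Suc 0))"
  have nn: "0 \<le> ?k" "0 \<le> ?l" "0 \<le> ?m" by (rule K_nonneg)+
  have add: "\<bar>x + y\<bar> \<le> (A + B) * e" if "\<bar>x\<bar> \<le> A * e" "\<bar>y\<bar> \<le> B * e" for x y A B e :: real
    using that by (simp add: distrib_right)
  have H1_le: "\<bar>H1 s j\<bar> \<le> (?k * ?l + ?k * ?l + ?k * (?k * ?l)) * weight j" if "s \<in> {cm<..<cp}" for s j
    unfolding H1_def weight_def by (intro add exp_decay_mult D[OF that] mult_nonneg_nonneg nn)
  have H2_le: "\<bar>H2 s j\<bar> \<le> (?l * ?l + ?m * ?k + (?l * ?l + ?m * ?k) + (?l * (?k * ?l) + (?l * ?l + ?m * ?k) * ?k)) * weight j"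
    if "s \<in> {cm<..<cp}" for s j
    unfolding H2_def weight_def by (intro add exp_decay_mult D[OF that] mult_nonneg_nonneg add_nonneg_nonneg nn)
  have H0_le: "\<bar>H c j\<bar> \<le> (1/2 * (?k * ?k) + 1/2 * (?k * ?k) + 1/3 * (?k * (?k * ?k))) * weight j" for j
    unfolding H_def weight_def power2_eq_square power3_eq_cube mult.assoc
    using exp_decay_mult[OF D[OF c, of 0 j 2] D[OF c, of 0 j 2] nn(1)]
      exp_decay_mult[OF D[OF c, of 0 j 1] D[OF c, of 0 j 1] nn(1)]
      exp_decay_mult[OF D[OF c, of 0 j 1] exp_decay_mult[OF D[OF c, of 0 j 1] D[OF c, of 0 j 1] nn(1)]] nn(1)
    by (intro add) (auto simp: abs_mult)
  have sw: "(\<lambda>j. C * weight j) summable_on UNIV" for C by (rule summable_on_cmult_right[OF summable_weight])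
  have E: "((\<lambda>s. infsum (H s) UNIV) has_real_derivative infsum (H1 s) UNIV) (at s)" if "s \<in> {cm<..<cp}" for s
    by (rule has_real_derivative_infsum(2)[OF _ _ c that H sw H1_le summable_on_dominated[OF sw]])
       (use H0_le in \<open>simp_all\<close>)
  have E1: "((\<lambda>s. infsum (H1 s) UNIV) has_real_derivative infsum (H2 c) UNIV) (at c)"
    by (rule has_real_derivative_infsum(2)[OF _ _ c c H1 sw H2_le summable_on_dominated[OF sw]])
       (use H1_le[OF c] in \<open>simp_all\<close>)
  have "\<alpha>0 s = inverse s * infsum (H1 s) UNIV" if "s \<in> {cm<..<cp}" for s
    unfolding \<alpha>0_def inverse_eq_divide
    by (rule arg_cong, rule deriv_within_speeds_eq[OF that _ E[OF that]], rule infsum_cong)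
       (simp add: H_def p_def r_def d_00)
  note eq = this
  have "c \<noteq> 0" using c speeds by auto
  from DERIV_transform_speeds[OF DERIV_mult[OF DERIV_inverse[OF this] E1] c eq]
  show ?thesis by blast
qed

text \<open>Differentiation under the integral raises the index of \<open>I l\<close> by one, and
  \<open>\<alpha>1\<close> is a polynomial in the speed, \<open>I 0\<close> and
  \<open>I 1\<close>.\<close>

lemma \<alpha>1_differentiable:
  assumes c: "c \<in> {cm<..<cp}" shows "\<exists>D. (\<alpha>1 has_real_derivative D) (at c)"
proof -
  have int: "s \<in> {1<..<cp}" "s \<in> {1<..cp}" "s \<in> {cm..cp}" if "s \<in> {cm<..<cp}" for s
    using that speeds by auto
  define I where "I l s = (LBINT x. d 0 l s x $ 1)" for l s
  have meas: "(\<lambda>x. d 0 l s x $ 1) \<in> borel_measurable lborel" if "s \<in> {cm<..<cp}" for l s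
    using borel_measurable_continuous_onI[OF DERIV_continuous_on[OF d_nth_x[OF int(2)[OF that]]]] by auto
  have b: "integrable lborel (\<lambda>x. C * exp (- \<beta> * \<bar>x\<bar>))" for C
    using integrable_exp_abs[OF \<beta>_pos] by simp
  have le: "\<bar>d 0 l s x $ 1\<bar> \<le> K 0 l * exp (- \<beta> * \<bar>x\<bar>)" if "s \<in> {cm<..<cp}" for l s x
    by (rule d_nth_le[OF int(3)[OF that]])
  have "integrable lborel (\<lambda>x. d 0 l c x $ 1)" for l
    by (rule Bochner_Integration.integrable_bound[OF b meas[OF c]])
       (use le[OF c] in \<open>auto intro!: AE_I2 order_trans[OF _ abs_ge_self]\<close>)
  then have I: "(I l has_real_derivative I (Suc l) s) (at s)" if "s \<in> {cm<..<cp}" for l s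
    unfolding I_def
    by (intro has_real_derivative_integral(2)[OF _ _ c that meas _ b le] d_nth_c int) auto
  have eq: "\<alpha>1 s = - I 1 s * (I 0 s + s * I 1 s)" if s: "s \<in> {cm<..<cp}" for s
  proof -
    have "((\<lambda>s. s * I 0 s) has_real_derivative I 0 s + s * I 1 s) (at s)"
      using I[OF s, of 0] by (auto intro!: derivative_eq_intros)
    then show ?thesis
      unfolding \<alpha>1_def using I[OF s, of 0]
      by (subst (1 2) deriv_within_speeds_eq[OF s])
         (auto simp: I_def r_def d_00 intro!: Bochner_Integration.integral_cong)
  qed
  have "\<exists>D. ((\<lambda>s. - I 1 s * (I 0 s + s * I 1 s)) has_real_derivative D) (at c)"
    using I[OF c, of 0] I[OF c, of 1] by (intro exI) (rule derivative_eq_intros | assumption | rule refl)+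
  then obtain D where "((\<lambda>s. - I 1 s * (I 0 s + s * I 1 s)) has_real_derivative D) (at c)" ..
  from DERIV_transform_speeds[OF this c eq] show ?thesis by blast
qed

end

section \<open>Derivatives of \<open>V\<close> and explicit first-order corrections\<close>

lemma has_vector_derivative_vec2:
  assumes "(f has_real_derivative f') F" "(g has_real_derivative g') F"
  shows "((\<lambda>s. vec2 (f s) (g s)) has_vector_derivative vec2 f' g') F"
proof -
  have "((\<lambda>s. f s *\<^sub>R vec2 1 0 + g s *\<^sub>R vec2 0 1) has_vector_derivative f' *\<^sub>R vec2 1 0 + g' *\<^sub>R vec2 0 1) F"
    using assms unfolding has_real_derivative_iff_has_vector_derivative
    by (intro has_vector_derivative_add bounded_linear.has_vector_derivative[OF bounded_linear_scaleR_left])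
  then show ?thesis
    by (simp add: vec2_scaleR[symmetric])
qed

lemma has_real_derivative_vec_nth:
  "(f has_vector_derivative f') F \<Longrightarrow> ((\<lambda>s. f s $ i) has_real_derivative f' $ i) F"
  unfolding has_real_derivative_iff_has_vector_derivative
  by (rule bounded_linear.has_vector_derivative[OF bounded_linear_vec_nth])

lemma interval_integral_from_0_deriv:
  fixes g :: "real \<Rightarrow> real"
  assumes "continuous_on UNIV g"
  shows "((\<lambda>x. LBINT s=0..x. g s) has_real_derivative g x) (at x)"
proof -
  \<comment> \<open>The interval from \<open>-T\<close> to \<open>T\<close> contains 0 and has
    \<open>x\<close> in its interior whatever the sign of \<open>x\<close>, so the oriented integral
    is covered on both sides of 0.\<close>
  define T where "T = \<bar>x\<bar> + 1"
  have "((\<lambda>x. interval_lebesgue_integral lborel (ereal 0) (ereal x) g) has_vector_derivative g x) (at x within {-T..T})"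
    by (rule interval_integral_FTC2) (auto simp: T_def intro: continuous_on_subset[OF assms])
  moreover have "at x within {-T..T} = at x"
    by (rule at_within_interior) (auto simp: T_def)
  ultimately show ?thesis
    by (simp add: has_real_derivative_iff_has_vector_derivative zero_ereal_def)
qed

text \<open>\<open>y\<close> will be a given solution, differentiable only from the right at time 0,
  and \<open>z\<close> an explicit antiderivative defined on the whole line.\<close>

lemma deriv_eq_imp_eq_on_half_line:
  fixes y z :: "real \<Rightarrow> real"
  assumes "\<And>s. 0 \<le> s \<Longrightarrow> (y has_real_derivative y' s) (at s within {0..})"
    and "\<And>s. 0 \<le> s \<Longrightarrow> (z has_real_derivative y' s) (at s)"
    and "y 0 = z 0" "0 \<le> t"
  shows "y t = z t"
proof -
  have "\<exists>C. \<forall>s\<in>{0..}. y s - z s = C"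
  proof (rule has_field_derivative_zero_constant)
    fix s :: real assume "s \<in> {0..}"
    then have s: "0 \<le> s" by simp
    show "((\<lambda>s. y s - z s) has_real_derivative 0) (at s within {0..})"
      using DERIV_diff[OF assms(1)[OF s] has_field_derivative_at_within[OF assms(2)[OF s]]] by simp
  qed auto
  then obtain C where "\<And>s. 0 \<le> s \<Longrightarrow> y s - z s = C" by auto
  from this[of 0] this[of t] show ?thesis using assms(3,4) by simp
qed

context localized_waves
begin

lemma q_commute: "q k l k' l' = q k' l' k l"
  by (simp add: q_def fun_eq_iff mult.commute)

lemma Q_commute: "Q k l k' l' = Q k' l' k l"
  by (simp add: Q_def fun_eq_iff q_commute[of k l k' l'])

lemma D\<xi>_V:
  assumes c: "c \<in> {cm<..<cp}" and f: "\<And>j. \<bar>f j\<bar> \<le> \<alpha>"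
  shows "D\<xi> (\<lambda>\<xi> c. V \<xi> c f) \<xi> c = vec2
    (\<alpha>1 c / (\<alpha>0 c)\<^sup>2 * - (Q 1 0 1 0 \<xi> c f + Q 0 0 2 0 \<xi> c f) + - (Q 1 0 0 1 \<xi> c f + Q 0 0 1 1 \<xi> c f) / \<alpha>0 c)
    (- (Q 1 0 1 0 \<xi> c f + Q 0 0 2 0 \<xi> c f) / \<alpha>0 c)"
proof (rule D\<xi>_eq)
  have c': "c \<in> {1<..<cp}" using c speeds by auto
  have X: "((\<lambda>\<xi>. Q 0 0 1 0 \<xi> c f) has_real_derivative - (Q 1 0 1 0 \<xi> c f + Q 0 0 2 0 \<xi> c f)) (at \<xi>)"
    using Q_\<xi>[where f = f and \<alpha> = \<alpha> and k = 0 and l = 0 and k' = 1 and l' = 0 and \<xi> = \<xi>, OF f c] by (simp add: numeral_2_eq_2)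
  have Y: "((\<lambda>\<xi>. Q 0 0 0 1 \<xi> c f) has_real_derivative - (Q 1 0 0 1 \<xi> c f + Q 0 0 1 1 \<xi> c f)) (at \<xi>)"
    using Q_\<xi>[where f = f and \<alpha> = \<alpha> and k = 0 and l = 0 and k' = 0 and l' = 1 and \<xi> = \<xi>, OF f c] by simp
  show "((\<lambda>\<xi>. V \<xi> c f) has_vector_derivative vec2
    (\<alpha>1 c / (\<alpha>0 c)\<^sup>2 * - (Q 1 0 1 0 \<xi> c f + Q 0 0 2 0 \<xi> c f) + - (Q 1 0 0 1 \<xi> c f + Q 0 0 1 1 \<xi> c f) / \<alpha>0 c)
    (- (Q 1 0 1 0 \<xi> c f + Q 0 0 2 0 \<xi> c f) / \<alpha>0 c)) (at \<xi>)"
    unfolding V_eq[OF c']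
    by (intro has_vector_derivative_vec2 DERIV_add DERIV_cmult DERIV_cdivide X Y)
qed

text \<open>\<open>u'\<close> and \<open>v'\<close> are the derivatives of
  \<open>\<alpha>1 / (\<alpha>0)\<close> squared, in the sense of
  \<open>\<alpha>1 s / (\<alpha>0 s * \<alpha>0 s)\<close>, and of \<open>1 / \<alpha>0\<close>.
  Their values never matter; what matters is that they are chosen before \<open>f\<close>, so that
  the formula holds for all realizations at once and shows measurability.\<close>

lemma Dc_V:
  assumes c: "c \<in> {cm<..<cp}"
  shows "\<exists>u' v'. \<forall>\<xi> f \<alpha>. (\<forall>j. \<bar>f j\<bar> \<le> \<alpha>) \<longrightarrow> Dc (\<lambda>\<xi> c. V \<xi> c f) \<xi> c = vec2
    (u' * Q 0 0 1 0 \<xi> c f + (Q 0 1 1 0 \<xi> c f + Q 0 0 1 1 \<xi> c f) * (\<alpha>1 c / (\<alpha>0 c)\<^sup>2)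
     + (v' * Q 0 0 0 1 \<xi> c f + (Q 0 1 0 1 \<xi> c f + Q 0 0 0 2 \<xi> c f) * (1 / \<alpha>0 c)))
    (v' * Q 0 0 1 0 \<xi> c f + (Q 0 1 1 0 \<xi> c f + Q 0 0 1 1 \<xi> c f) * (1 / \<alpha>0 c))"
proof -
  have c': "c \<in> {1<..<cp}" "c \<in> {1<..cp}" using c speeds by auto
  have \<alpha>0: "\<alpha>0 c \<noteq> 0" using \<alpha>0_pos[OF c'(2)] by simp
  obtain a0 a1 where a: "(\<alpha>0 has_real_derivative a0) (at c)" "(\<alpha>1 has_real_derivative a1) (at c)"
    using \<alpha>0_differentiable[OF c] \<alpha>1_differentiable[OF c] by auto
  have "\<exists>v'. ((\<lambda>s. 1 / \<alpha>0 s) has_real_derivative v') (at c)"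
    using DERIV_divide[OF DERIV_const a(1) \<alpha>0] by blast
  then obtain v' where v: "((\<lambda>s. 1 / \<alpha>0 s) has_real_derivative v') (at c)" by blast
  have "\<exists>u'. ((\<lambda>s. \<alpha>1 s / (\<alpha>0 s)\<^sup>2) has_real_derivative u') (at c)"
    using DERIV_divide[OF a(2) DERIV_power[OF a(1), of 2]] \<alpha>0 by auto
  then obtain u' where u: "((\<lambda>s. \<alpha>1 s / (\<alpha>0 s)\<^sup>2) has_real_derivative u') (at c)" by blast
  have "Dc (\<lambda>\<xi> c. V \<xi> c f) \<xi> c = vec2
    (u' * Q 0 0 1 0 \<xi> c f + (Q 0 1 1 0 \<xi> c f + Q 0 0 1 1 \<xi> c f) * (\<alpha>1 c / (\<alpha>0 c)\<^sup>2)
     + (v' * Q 0 0 0 1 \<xi> c f + (Q 0 1 0 1 \<xi> c f + Q 0 0 0 2 \<xi> c f) * (1 / \<alpha>0 c)))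
    (v' * Q 0 0 1 0 \<xi> c f + (Q 0 1 1 0 \<xi> c f + Q 0 0 1 1 \<xi> c f) * (1 / \<alpha>0 c))" (is "_ = ?D")
    if f: "\<And>j. \<bar>f j\<bar> \<le> \<alpha>" for \<xi> f \<alpha>
  proof -
    let ?W = "\<lambda>s. vec2 (\<alpha>1 s / (\<alpha>0 s)\<^sup>2 * Q 0 0 1 0 \<xi> s f + 1 / \<alpha>0 s * Q 0 0 0 1 \<xi> s f)
                      (1 / \<alpha>0 s * Q 0 0 1 0 \<xi> s f)"
    have X: "((\<lambda>s. Q 0 0 1 0 \<xi> s f) has_real_derivative Q 0 1 1 0 \<xi> c f + Q 0 0 1 1 \<xi> c f) (at c)"
      using Q_c[where f = f and \<alpha> = \<alpha> and k = 0 and l = 0 and k' = 1 and l' = 0 and \<xi> = \<xi>, OF f c] by simp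
    have Y: "((\<lambda>s. Q 0 0 0 1 \<xi> s f) has_real_derivative Q 0 1 0 1 \<xi> c f + Q 0 0 0 2 \<xi> c f) (at c)"
      using Q_c[where f = f and \<alpha> = \<alpha> and k = 0 and l = 0 and k' = 0 and l' = 1 and \<xi> = \<xi>, OF f c] by (simp add: numeral_2_eq_2)
    have D: "(?W has_vector_derivative ?D) (at c)"
      by (intro has_vector_derivative_vec2 DERIV_add DERIV_mult X Y u v)
    have "((\<lambda>s. V \<xi> s f) has_vector_derivative ?D) (at c)"
      by (rule has_vector_derivative_transform_within_open[OF D, of "{1<..<cp}"])
         (use c' in \<open>auto simp: V_eq\<close>)
    then show ?thesis
      unfolding Dc_def at_within_speeds[OF c'(1)] by (rule vector_derivative_at)
  qed
  then show ?thesis by blast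
qed

text \<open>The antiderivative of \<open>Q\<close> in the position, vanishing at position 0. It
  supplies those parts of the corrections that are not increments of a \<open>Q\<close>.\<close>

definition N :: "nat \<Rightarrow> nat \<Rightarrow> nat \<Rightarrow> nat \<Rightarrow> real \<Rightarrow> real \<Rightarrow> (int \<Rightarrow> real) \<Rightarrow> real"
  where "N k l k' l' \<xi> c f = pairing (\<lambda>j. LBINT s=0..\<xi>. q k l k' l' c (real_of_int j - s)) f"

lemma q_reflect_continuous: "c \<in> {1<..cp} \<Longrightarrow> continuous_on X (\<lambda>s. q k l k' l' c (x - s))"
  by (rule DERIV_continuous_on, rule DERIV_subset[OF q_shift]) auto

lemma
  assumes f: "\<And>j. \<bar>f j\<bar> \<le> \<alpha>" and c: "c \<in> {cm<..<cp}"
  shows N_\<xi>: "((\<lambda>\<xi>. N k l k' l' \<xi> c f) has_real_derivative Q k l k' l' \<xi> c f) (at \<xi>)"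
    and summable_N: "(\<lambda>j. (LBINT s=0..\<xi>. q k l k' l' c (real_of_int j - s)) * f j) summable_on UNIV"
proof -
  have c': "c \<in> {1<..cp}" "c \<in> {cm..cp}" using c speeds by auto
  define T where "T = \<bar>\<xi>\<bar> + 1"
  have der: "((\<lambda>\<zeta>. (LBINT s=0..\<zeta>. q k l k' l' c (real_of_int j - s)) * f j) has_real_derivative
      q k l k' l' c (real_of_int j - \<zeta>) * f j) (at \<zeta>)" for \<zeta> j
    by (intro DERIV_cmult_right interval_integral_from_0_deriv q_reflect_continuous c')
  have b: "\<bar>q k l k' l' c (real_of_int j - \<zeta>) * f j\<bar> \<le> (K k l * K k' l' * exp (\<beta> * T)) * (\<bar>f j\<bar> * weight j)"
    if "\<zeta> \<in> {-T<..<T}" for \<zeta> j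
  proof -
    have "\<bar>q k l k' l' c (real_of_int j - \<zeta>)\<bar> * \<bar>f j\<bar> \<le> ((K k l * K k' l' * exp (\<beta> * T)) * weight j) * \<bar>f j\<bar>"
      using that by (intro mult_right_mono q_shift_le c') auto
    then show ?thesis by (simp only: abs_mult mult.assoc mult.commute[of "weight j"])
  qed
  \<comment> \<open>At position 0 all integrals vanish, which gives the parameter at which
    convergence of the series is trivial.\<close>
  have z: "(\<lambda>j. (LBINT s=0..0. q k l k' l' c (real_of_int j - s)) * f j) summable_on UNIV"
    by (simp add: zero_ereal_def)
  note * = has_real_derivative_infsum[of "{-T<..<T}" 0 \<xi>, OF _ _ _ _ der summable_weight_bounded[where f = f and \<alpha> = \<alpha>, OF f] b]
  show "((\<lambda>\<xi>. N k l k' l' \<xi> c f) has_real_derivative Q k l k' l' \<xi> c f) (at \<xi>)"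
    unfolding N_def Q_def pairing_def by (rule *(2)) (use z in \<open>auto simp: T_def zero_ereal_def\<close>)
  show "(\<lambda>j. (LBINT s=0..\<xi>. q k l k' l' c (real_of_int j - s)) * f j) summable_on UNIV"
    by (rule *(1)) (use z in \<open>auto simp: T_def zero_ereal_def\<close>)
qed

lemma N_0: "N k l k' l' 0 c f = 0"
  by (simp add: N_def pairing_def zero_ereal_def)

text \<open>Each right-hand side has the correct value at time 0 and the correct derivative. Since
  \<open>Q 0 0 0 0\<close> has position derivative \<open>-2 * Q 0 0 1 0\<close>, the
  \<open>Q 0 0 1 0\<close> terms of \<open>V\<close> integrate to increments of
  \<open>Q 0 0 0 0\<close>; the \<open>Q 0 0 0 1\<close> term and the time integral of
  \<open>c1\<close> need \<open>N\<close>. Every factor \<open>1 / c\<close> comes from the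
  substitution of \<open>c * t\<close> for the position.\<close>

lemma first_order_corrections:
  assumes f: "\<And>j. \<bar>f j\<bar> \<le> \<alpha>" and c: "c \<in> {cm<..<cp}" and sol: "solves_first c f \<gamma>1 c1" and t: "0 \<le> t"
  shows "c1 t = - (1 / (2 * c * \<alpha>0 c)) * (Q 0 0 0 0 (c * t) c f - Q 0 0 0 0 0 c f)"
    and "\<gamma>1 t = - (\<alpha>1 c / (2 * c * (\<alpha>0 c)\<^sup>2)) * (Q 0 0 0 0 (c * t) c f - Q 0 0 0 0 0 c f)
               + 1 / (c * \<alpha>0 c) * N 0 0 0 1 (c * t) c f"
    and "(LBINT s=0..t. c1 s) = - (1 / (2 * c\<^sup>2 * \<alpha>0 c)) * (N 0 0 0 0 (c * t) c f - c * t * Q 0 0 0 0 0 c f)"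
proof -
  have c': "c \<in> {1<..<cp}" "c \<in> {1<..cp}" "0 < c" using c speeds by auto
  have \<alpha>0: "0 < \<alpha>0 c" using \<alpha>0_pos[OF c'(2)] by simp
  have comp: "((\<lambda>s. F (c * s)) has_real_derivative F' (c * s) * c) (at s)"
    if "\<And>\<xi>. (F has_real_derivative F' \<xi>) (at \<xi>)" for F F' :: "real \<Rightarrow> real" and s
    using DERIV_chain2[OF that DERIV_cmult_Id[of c s]] by simp
  have Q0: "((\<lambda>\<xi>. Q 0 0 0 0 \<xi> c f) has_real_derivative - 2 * Q 0 0 1 0 \<xi> c f) (at \<xi>)" for \<xi>
    using Q_\<xi>[where f = f and \<alpha> = \<alpha> and k = 0 and l = 0 and k' = 0 and l' = 0 and \<xi> = \<xi>, OF f c] Q_commute[of 1 0 0 0] by simp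
  have V: "((\<lambda>s. vec2 (\<gamma>1 s) (c1 s)) has_vector_derivative V (c * s) c f) (at s within {0..})" if "0 \<le> s" for s
    using sol that by (simp add: solves_first_def)
  have init: "\<gamma>1 0 = 0" "c1 0 = 0" using sol by (auto simp: solves_first_def)
  let ?Y = "\<lambda>s. - (1 / (2 * c * \<alpha>0 c)) * (Q 0 0 0 0 (c * s) c f - Q 0 0 0 0 0 c f)"
  have Y: "(?Y has_real_derivative V (c * s) c f $ 2) (at s)" for s
    by (rule derivative_eq_intros comp[OF Q0] | rule refl)+
       (use \<alpha>0 c' in \<open>simp add: V_eq field_simps\<close>)
  have c1: "c1 s = ?Y s" if "0 \<le> s" for s
    by (rule deriv_eq_imp_eq_on_half_line[of _ "\<lambda>s. V (c * s) c f $ 2", OF _ Y])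
       (use has_real_derivative_vec_nth[OF V, of _ 2] init that in auto)
  then show "c1 t = ?Y t" using t by simp
  let ?G = "\<lambda>t. - (\<alpha>1 c / (2 * c * (\<alpha>0 c)\<^sup>2)) * (Q 0 0 0 0 (c * t) c f - Q 0 0 0 0 0 c f)
               + 1 / (c * \<alpha>0 c) * N 0 0 0 1 (c * t) c f"
  have G: "(?G has_real_derivative V (c * s) c f $ 1) (at s)" for s
    by (rule derivative_eq_intros comp[OF Q0] comp[OF N_\<xi>[where f = f and \<alpha> = \<alpha>, OF f c]] | rule refl)+
       (use \<alpha>0 c' in \<open>simp add: V_eq field_simps\<close>)
  show "\<gamma>1 t = ?G t"
    by (rule deriv_eq_imp_eq_on_half_line[of \<gamma>1 "\<lambda>s. V (c * s) c f $ 1" ?G, OF _ G])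
       (use has_real_derivative_vec_nth[OF V, of _ 1] init t in \<open>auto simp: N_0\<close>)
  let ?Z = "\<lambda>t. - (1 / (2 * c\<^sup>2 * \<alpha>0 c)) * (N 0 0 0 0 (c * t) c f - c * t * Q 0 0 0 0 0 c f)"
  have Z: "(?Z has_real_derivative ?Y s) (at s)" for s
    by (rule derivative_eq_intros comp[OF N_\<xi>[where f = f and \<alpha> = \<alpha>, OF f c]] | rule refl)+
       (use \<alpha>0 c' in \<open>simp add: field_simps power2_eq_square\<close>)
  have "interval_lebesgue_integral lborel (ereal 0) (ereal t) c1 = interval_lebesgue_integral lborel (ereal 0) (ereal t) ?Y"
    by (rule interval_integral_cong) (use t c1 in \<open>auto simp: min_def max_def einterval_def\<close>)
  also have "\<dots> = ?Z t - ?Z 0"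
  proof (rule interval_integral_FTC_finite)
    have "continuous_on UNIV ?Y" by (rule DERIV_continuous_on, rule DERIV_subset[OF Y]) auto
    then show "continuous_on {min 0 t..max 0 t} ?Y" by (rule continuous_on_subset) auto
    show "(?Z has_vector_derivative ?Y x) (at x within {min 0 t..max 0 t})" for x
      using has_field_derivative_at_within[OF Z] by (simp add: has_real_derivative_iff_has_vector_derivative)
  qed
  finally show "(LBINT s=0..t. c1 s) = ?Z t" by (simp add: N_0 zero_ereal_def)
qed

end

section \<open>Absolutely convergent quadratic forms in bounded coefficients\<close>

locale bounded_coefficients =
  fixes f h :: "int \<Rightarrow> real" and \<alpha> :: real
  assumes f_bounded: "\<And>j. \<bar>f j\<bar> \<le> \<alpha>"
    and h: "\<And>j. 0 \<le> h j" "h summable_on UNIV"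
begin

text \<open>The domination concerns the matrix \<open>F\<close> alone and does not mention
  \<open>f\<close>. It can therefore be obtained for one coefficient sequence and reused for every
  realization.\<close>

definition quad_expansion :: "(int \<Rightarrow> int \<Rightarrow> 'b::banach) \<Rightarrow> 'b \<Rightarrow> bool"
  where "quad_expansion F v \<longleftrightarrow> (\<exists>D. \<forall>m n. norm (F m n) \<le> D * (h m * h n)) \<and>
    v = (\<Sum>\<^sub>\<infinity>(m, n). (f m * f n) *\<^sub>R F m n)"

lemma \<alpha>_nonneg: "0 \<le> \<alpha>" using f_bounded[of 0] by linarith

lemma summable_h_h: "(\<lambda>(m, n). D * (h m * h n)) summable_on UNIV"
proof -
  have "(\<lambda>p. D * (case p of (m, n) \<Rightarrow> h m * h n)) summable_on UNIV"
    by (intro summable_on_cmult_right summable_on_product h)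
  then show ?thesis by (simp add: case_prod_unfold)
qed

lemma summable_quad:
  fixes F :: "int \<Rightarrow> int \<Rightarrow> 'b::banach"
  assumes "\<And>m n. norm (F m n) \<le> D * (h m * h n)"
  shows "(\<lambda>(m, n). (f m * f n) *\<^sub>R F m n) summable_on UNIV"
proof (rule summable_on_dominated[OF summable_h_h[of "\<alpha> * \<alpha> * D"]])
  fix p :: "int \<times> int"
  obtain m n where p: "p = (m, n)" by fastforce
  have "norm ((f m * f n) *\<^sub>R F m n) \<le> (\<alpha> * \<alpha>) * (D * (h m * h n))"
    unfolding norm_scaleR abs_mult
    using assms[of m n] f_bounded \<alpha>_nonneg by (intro mult_mono) auto
  then show "norm (case p of (m, n) \<Rightarrow> (f m * f n) *\<^sub>R F m n) \<le> (case p of (m, n) \<Rightarrow> \<alpha> * \<alpha> * D * (h m * h n))"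
    by (simp add: p mult.assoc)
qed

lemma quad_expansion_add:
  assumes "quad_expansion F v" "quad_expansion G w"
  shows "quad_expansion (\<lambda>m n. F m n + G m n) (v + w)"
proof -
  obtain D E where D: "\<And>m n. norm (F m n) \<le> D * (h m * h n)" and E: "\<And>m n. norm (G m n) \<le> E * (h m * h n)"
    using assms unfolding quad_expansion_def by blast
  have "norm (F m n + G m n) \<le> (D + E) * (h m * h n)" for m n
    using norm_triangle_ineq[of "F m n" "G m n"] D[of m n] E[of m n] by (simp add: distrib_right)
  moreover have "v + w = (\<Sum>\<^sub>\<infinity>(m, n). (f m * f n) *\<^sub>R (F m n + G m n))"
    using infsum_add[OF summable_quad[of F, OF D] summable_quad[of G, OF E]] assms
    by (simp add: quad_expansion_def case_prod_unfold scaleR_add_right)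
  ultimately show ?thesis unfolding quad_expansion_def by blast
qed

lemma quad_expansion_linear:
  assumes L: "bounded_linear L" and F: "quad_expansion F v"
  shows "quad_expansion (\<lambda>m n. L (F m n)) (L v)"
proof -
  obtain D where D: "\<And>m n. norm (F m n) \<le> D * (h m * h n)"
    using F unfolding quad_expansion_def by blast
  obtain C where C: "0 \<le> C" "\<And>x. norm (L x) \<le> norm x * C"
    using bounded_linear.nonneg_bounded[OF L] by blast
  have "norm (L (F m n)) \<le> (D * C) * (h m * h n)" for m n
    using order_trans[OF C(2)[of "F m n"] mult_right_mono[OF D C(1)]] by (simp add: ac_simps)
  moreover have "L v = (\<Sum>\<^sub>\<infinity>(m, n). (f m * f n) *\<^sub>R L (F m n))"
    using infsum_bounded_linear_image[OF L summable_quad[of F, OF D]] F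
    by (simp add: quad_expansion_def case_prod_unfold linear_scale[OF bounded_linear.linear[OF L]])
  ultimately show ?thesis unfolding quad_expansion_def by blast
qed

lemma quad_expansion_vec2:
  assumes "quad_expansion F v" "quad_expansion G w"
  shows "quad_expansion (\<lambda>m n. vec2 (F m n) (G m n)) (vec2 v w)"
  using quad_expansion_add[OF
      quad_expansion_linear[OF bounded_linear_scaleR_left[of "vec2 1 0"] assms(1)]
      quad_expansion_linear[OF bounded_linear_scaleR_left[of "vec2 0 1"] assms(2)]]
  by (simp add: vec2_scaleR[symmetric])

lemma quad_expansion_bilinear:
  fixes b :: "'a::banach \<Rightarrow> 'c::banach \<Rightarrow> 'b::banach"
  assumes b: "bounded_bilinear b"
    and x: "x = (\<Sum>\<^sub>\<infinity>m. f m *\<^sub>R X m)" "\<And>m. norm (X m) \<le> C * h m"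
    and y: "y = (\<Sum>\<^sub>\<infinity>n. f n *\<^sub>R Y n)" "\<And>n. norm (Y n) \<le> D * h n"
  shows "quad_expansion (\<lambda>m n. b (X m) (Y n)) (b x y)"
proof -
  interpret bounded_bilinear b by (rule b)
  obtain K where K: "0 \<le> K" "\<And>x y. norm (b x y) \<le> norm x * norm y * K"
    using nonneg_bounded by blast
  have s: "norm (f m *\<^sub>R Z m) \<le> \<alpha> * E * h m" if "norm (Z m) \<le> E * h m" for Z :: "int \<Rightarrow> 'd::banach" and E m
    using mult_mono[OF f_bounded[of m] that \<alpha>_nonneg norm_ge_zero] by (simp add: mult.assoc)
  have "b x y = (\<Sum>\<^sub>\<infinity>(m, n). b (f m *\<^sub>R X m) (f n *\<^sub>R Y n))"
    unfolding x(1) y(1)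
    by (rule bounded_bilinear_infsum(2)[OF b summable_on_cmult_right[OF h(2)] s summable_on_cmult_right[OF h(2)] s])
       (rule x y)+
  also have "\<dots> = (\<Sum>\<^sub>\<infinity>(m, n). (f m * f n) *\<^sub>R b (X m) (Y n))"
    by (simp add: scaleR_left scaleR_right mult.commute)
  finally have "b x y = (\<Sum>\<^sub>\<infinity>(m, n). (f m * f n) *\<^sub>R b (X m) (Y n))" .
  moreover have "norm (b (X m) (Y n)) \<le> (C * D * K) * (h m * h n)" for m n
  proof -
    have "norm (b (X m) (Y n)) \<le> norm (X m) * norm (Y n) * K" by (rule K)
    also have "\<dots> \<le> (C * h m) * (D * h n) * K"
      using x(2)[of m] y(2)[of n] K(1) order_trans[OF norm_ge_zero x(2)[of m]]
      by (intro mult_right_mono mult_mono) auto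
    finally show ?thesis by (simp add: ac_simps)
  qed
  ultimately show ?thesis unfolding quad_expansion_def by blast
qed

text \<open>Here \<open>f\<close> itself is one of the factors and need not be square summable, so
  the bilinear case does not apply. Testing with \<open>unit_seq m\<close> picks out
  \<open>w m\<close>, and the localization of \<open>w\<close> supplies the decay in
  \<open>m\<close>.\<close>

lemma quad_expansion_pairing:
  assumes w: "\<And>m. \<bar>w m\<bar> \<le> C * h m"
    and X: "\<And>m n. \<bar>X n m\<bar> \<le> D * h n" and x: "\<And>m. x m = (\<Sum>\<^sub>\<infinity>n. f n * X n m)"
  shows "quad_expansion (\<lambda>m n. pairing w (\<lambda>j. unit_seq m j * X n j)) (pairing w (\<lambda>j. f j * x j))"
proof -
  have unit: "pairing w (\<lambda>j. unit_seq m j * X n j) = w m * X n m" for m n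
  proof -
    have "pairing w (\<lambda>j. unit_seq m j * X n j) = (\<Sum>\<^sub>\<infinity>j\<in>{m}. w j * (unit_seq m j * X n j))"
      unfolding pairing_def by (rule infsum_cong_neutral) (auto simp: unit_seq_def)
    then show ?thesis by (simp add: unit_seq_def)
  qed
  have le: "norm (w m * X n m) \<le> (C * D) * (h m * h n)" for m n
  proof -
    have "norm (w m * X n m) \<le> (C * h m) * (D * h n)"
      unfolding real_norm_def abs_mult
      using w[of m] X[of n m] order_trans[OF abs_ge_zero w[of m]] by (intro mult_mono) auto
    then show ?thesis by (simp add: ac_simps)
  qed
  note s = summable_quad[of "\<lambda>m n. w m * X n m", OF le]
  have sX: "(\<lambda>n. f n * X n m) summable_on UNIV" for m
  proof (rule summable_on_dominated[OF summable_on_cmult_right[OF h(2), of "\<alpha> * D"]])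
    show "norm (f n * X n m) \<le> \<alpha> * D * h n" for n
      using mult_mono[OF f_bounded[of n] X[of n m] \<alpha>_nonneg] by (simp add: abs_mult mult.assoc)
  qed
  have "pairing w (\<lambda>j. f j * x j) = (\<Sum>\<^sub>\<infinity>m. \<Sum>\<^sub>\<infinity>n. (f m * f n) *\<^sub>R (w m * X n m))"
    unfolding pairing_def
  proof (rule infsum_cong)
    fix m
    have "w m * (f m * x m) = (w m * f m) * (\<Sum>\<^sub>\<infinity>n. f n * X n m)" by (simp add: x)
    also have "\<dots> = (\<Sum>\<^sub>\<infinity>n. (w m * f m) * (f n * X n m))" by (rule infsum_cmult_right'[symmetric])
    finally show "w m * (f m * x m) = (\<Sum>\<^sub>\<infinity>n. (f m * f n) *\<^sub>R (w m * X n m))"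
      by (simp add: ac_simps)
  qed
  also have "\<dots> = (\<Sum>\<^sub>\<infinity>(m, n). (f m * f n) *\<^sub>R (w m * X n m))"
    using infsum_Sigma'_banach[of "\<lambda>m n. (f m * f n) *\<^sub>R (w m * X n m)" UNIV "\<lambda>_. UNIV"] s by simp
  finally show ?thesis using le unfolding quad_expansion_def unit by blast
qed

end

section \<open>Symplectic products with the response and the second-order maps\<close>

context localized_waves
begin

lemma summable_half_decay: "(\<lambda>j. exp (- (\<gamma> / 2) * \<bar>real_of_int j\<bar>)) summable_on UNIV" if "0 < \<gamma>" for \<gamma>
  using summable_on_exp_abs_int[of "\<gamma> / 2"] that by simp

text \<open>Summation from minus infinity keeps the decay to the left only, so the symplectic form needs
  the weighted norm of its second argument to the right.\<close>

lemma Jinv_le: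
  assumes \<psi>: "\<And>j. norm (\<psi> j) \<le> C * weight j"
  shows "\<exists>D\<ge>0. \<forall>j. norm (Jinv \<psi> j) \<le> D * (if j \<le> 0 then weight j else 1)"
proof -
  have C: "0 \<le> C" using order_trans[OF norm_ge_zero \<psi>[of 0]] by (simp add: weight_def)
  let ?W = "infsum weight UNIV"
  have W: "0 \<le> ?W" using weight_pos by (intro infsum_nonneg) (auto simp: less_imp_le)
  have part: "\<bar>\<Sum>\<^sub>\<infinity>d\<in>I. g (j + d)\<bar> \<le> C * ?W * (if j \<le> 0 then weight j else 1)"
    if I: "I \<subseteq> {..0}" and g: "\<And>i. \<bar>g i\<bar> \<le> C * weight i" for g :: "int \<Rightarrow> real" and I j
  proof (cases "j \<le> 0")
    case True
    have "\<bar>\<Sum>\<^sub>\<infinity>d\<in>I. g (j + d)\<bar> \<le> (\<Sum>\<^sub>\<infinity>d\<in>I. (C * weight j) * weight d)"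
      unfolding real_norm_def[symmetric]
    proof (rule norm_infsum_le_infsum)
      show "(\<lambda>d. (C * weight j) * weight d) summable_on I"
        by (intro summable_on_cmult_right summable_on_subset_banach[OF summable_weight]) auto
      fix d assume "d \<in> I"
      then have "weight (j + d) = weight j * weight d"
        using True I by (auto simp: weight_def exp_add[symmetric] algebra_simps abs_if subset_iff)
      then show "norm (g (j + d)) \<le> (C * weight j) * weight d" using g[of "j + d"] by simp
    qed
    also have "\<dots> \<le> (\<Sum>\<^sub>\<infinity>d. (C * weight j) * weight d)"
      using C weight_pos
      by (intro infsum_mono2 summable_on_cmult_right summable_weight summable_on_subset_banach[OF summable_weight])
         (auto simp: less_imp_le)
    also have "\<dots> = C * weight j * ?W" by (rule infsum_cmult_right')
    finally show ?thesis using True by (simp add: ac_simps)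
  next
    case False
    have s: "(\<lambda>d. C * weight (j + d)) summable_on UNIV"
      using summable_weight by (intro summable_on_cmult_right) (simp add: summable_on_int_shift)
    have "\<bar>\<Sum>\<^sub>\<infinity>d\<in>I. g (j + d)\<bar> \<le> (\<Sum>\<^sub>\<infinity>d\<in>I. C * weight (j + d))"
      unfolding real_norm_def[symmetric]
      by (rule norm_infsum_le_infsum[OF summable_on_subset_banach[OF s]]) (use g in auto)
    also have "\<dots> \<le> (\<Sum>\<^sub>\<infinity>d. C * weight (j + d))"
      using C weight_pos by (intro infsum_mono2 s summable_on_subset_banach[OF s]) (auto simp: less_imp_le)
    also have "\<dots> = C * ?W" by (simp add: infsum_cmult_right' infsum_int_shift)
    finally show ?thesis using False by simp
  qed
  have "norm (Jinv \<psi> j) \<le> (2 * (C * ?W)) * (if j \<le> 0 then weight j else 1)" for j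
  proof -
    have \<psi>': "\<bar>\<psi> i $ k\<bar> \<le> C * weight i" for i k
      using component_le_norm_cart[of "\<psi> i" k] \<psi>[of i] by simp
    have "\<bar>Jinv \<psi> j $ 1\<bar> \<le> C * ?W * (if j \<le> 0 then weight j else 1)"
      "\<bar>Jinv \<psi> j $ 2\<bar> \<le> C * ?W * (if j \<le> 0 then weight j else 1)"
      unfolding Jinv_def dminus_inv_def dplus_inv_def vec2_nth by (intro part \<psi>'; auto)+
    then show ?thesis using norm_vec2_le[of "Jinv \<psi> j"] by linarith
  qed
  then show ?thesis using C W by (intro exI[of _ "2 * (C * ?W)"]) auto
qed

text \<open>For each entry there are two bounds: one decays in \<open>n\<close> and is uniform in
  \<open>j\<close>, the other decays in \<open>j\<close> and is uniform in \<open>n\<close>, being a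
  single term of the weighted norm. Their geometric mean decays in both, which is where the rates
  \<open>a / 2\<close> and \<open>\<beta> / 2\<close> come from. The weight helps only for
  nonnegative \<open>j\<close>.\<close>

lemma l2a_geometric_mean:
  assumes R: "\<And>n j. norm (R n j) \<le> C * weight n" and l2a: "in_l2a_Z2 a (\<lambda>j m. R m j)"
  shows "\<exists>D\<ge>0. \<forall>n j. 0 \<le> j \<longrightarrow> norm (R n j)
    \<le> D * (exp (- (a / 2) * \<bar>real_of_int j\<bar>) * exp (- (\<beta> / 2) * \<bar>real_of_int n\<bar>))"
proof -
  have C: "0 \<le> C" using order_trans[OF norm_ge_zero R[of 0 0]] by (simp add: weight_def)
  define S where "S = (\<Sum>\<^sub>\<infinity>(j, m). exp (2 * a * real_of_int j) * ((R m j $ 1)\<^sup>2 + (R m j $ 2)\<^sup>2))"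
  have S: "0 \<le> S" unfolding S_def by (intro infsum_nonneg) auto
  have "norm (R n j) \<le> sqrt (C * sqrt S) * (exp (- (a / 2) * \<bar>real_of_int j\<bar>) * exp (- (\<beta> / 2) * \<bar>real_of_int n\<bar>))"
    if j: "0 \<le> j" for n j
  proof -
    have "sum (\<lambda>(j, m). exp (2 * a * real_of_int j) * ((R m j $ 1)\<^sup>2 + (R m j $ 2)\<^sup>2)) {(j, n)} \<le> S"
      unfolding S_def using l2a by (intro finite_sum_le_infsum) (auto simp: in_l2a_Z2_def)
    then have "(exp (a * real_of_int j) * norm (R n j))\<^sup>2 \<le> S"
      by (simp add: norm_real2 power_mult_distrib exp_double[symmetric] mult.assoc)
    then have "exp (a * real_of_int j) * norm (R n j) \<le> sqrt S" by (rule real_le_rsqrt)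
    then have 1: "norm (R n j) \<le> sqrt S * exp (- a * real_of_int j)"
      by (simp add: exp_minus field_simps)
    \<comment> \<open>One factor is estimated by each of the two bounds.\<close>
    have "norm (R n j) * norm (R n j) \<le> (C * weight n) * (sqrt S * exp (- a * real_of_int j))"
      using R[of n j] 1 C by (intro mult_mono) (auto simp: weight_def)
    also have "\<dots> = (C * sqrt S) * (exp (- (a / 2) * \<bar>real_of_int j\<bar>) * exp (- (\<beta> / 2) * \<bar>real_of_int n\<bar>))\<^sup>2"
      using j by (simp add: weight_def power_mult_distrib exp_double[symmetric])
    finally have "(norm (R n j))\<^sup>2 \<le> (C * sqrt S) * (exp (- (a / 2) * \<bar>real_of_int j\<bar>) * exp (- (\<beta> / 2) * \<bar>real_of_int n\<bar>))\<^sup>2"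
      by (simp add: power2_eq_square)
    then have "norm (R n j) \<le> sqrt ((C * sqrt S) * (exp (- (a / 2) * \<bar>real_of_int j\<bar>) * exp (- (\<beta> / 2) * \<bar>real_of_int n\<bar>))\<^sup>2)"
      by (rule real_le_rsqrt)
    then show ?thesis by (simp add: real_sqrt_mult)
  qed
  then show ?thesis using C S by (intro exI[of _ "sqrt (C * sqrt S)"]) auto
qed

lemma weight_le_half: "weight n \<le> exp (- (\<beta> / 2) * \<bar>real_of_int n\<bar>)"
  using \<beta>_pos by (simp add: weight_def)

text \<open>To the left \<open>Jinv \<psi>\<close> decays, to the right it is merely bounded but
  \<open>R n j\<close> decays in \<open>j\<close>. Since \<open>a / 2\<close> is below
  \<open>\<beta>\<close>, both sides fit under one product of a function of \<open>j\<close> and a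
  function of \<open>n\<close>, and the two summations may be exchanged.\<close>

lemma \<Omega>_expansion:
  assumes \<psi>: "\<And>j. norm (\<psi> j) \<le> C0 * weight j"
    and R: "\<And>n j. norm (R n j) \<le> C * weight n" and l2a: "in_l2a_Z2 a (\<lambda>j m. R m j)"
  shows "\<exists>D. \<forall>n. \<bar>\<Omega> \<psi> (R n)\<bar> \<le> D * exp (- (\<beta> / 2) * \<bar>real_of_int n\<bar>)"
    and "(\<And>j. \<bar>f j\<bar> \<le> \<alpha>) \<Longrightarrow> (\<And>j. ((\<lambda>n. f n *\<^sub>R R n j) has_sum x j) UNIV) \<Longrightarrow>
      \<Omega> \<psi> x = (\<Sum>\<^sub>\<infinity>n. f n * \<Omega> \<psi> (R n))"
proof -
  let ?g = "\<lambda>j. exp (- (a / 2) * \<bar>real_of_int j\<bar>)" and ?h = "\<lambda>n. exp (- (\<beta> / 2) * \<bar>real_of_int n\<bar>)"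
  have C: "0 \<le> C" using order_trans[OF norm_ge_zero R[of 0 0]] by (simp add: weight_def)
  obtain D where D: "0 \<le> D" "\<And>j. norm (Jinv \<psi> j) \<le> D * (if j \<le> 0 then weight j else 1)"
    using Jinv_le[of \<psi>, OF \<psi>] by blast
  obtain E where E: "0 \<le> E" "\<And>n j. 0 \<le> j \<Longrightarrow> norm (R n j) \<le> E * (?g j * ?h n)"
    using l2a_geometric_mean[of R, OF R l2a] by blast
  have weight_le: "weight j \<le> ?g j" for j
    using mult_right_mono[of "a / 2" \<beta> "\<bar>real_of_int j\<bar>"] rates by (simp add: weight_def)
  define M where "M = D * C + D * E"
  have M: "0 \<le> M" using C D E by (simp add: M_def)
  have le: "\<bar>inner (Jinv \<psi> j) (R n j)\<bar> \<le> M * (?g j * ?h n)" for j n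
  proof (cases "j \<le> 0")
    case True
    have "\<bar>inner (Jinv \<psi> j) (R n j)\<bar> \<le> norm (Jinv \<psi> j) * norm (R n j)" by (rule Cauchy_Schwarz_ineq2)
    also have "\<dots> \<le> (D * ?g j) * (C * ?h n)"
    proof (rule mult_mono)
      show "norm (Jinv \<psi> j) \<le> D * ?g j"
        using D(2)[of j] mult_left_mono[OF weight_le[of j] D(1)] True by simp
      show "norm (R n j) \<le> C * ?h n"
        using R[of n j] mult_left_mono[OF weight_le_half[of n] C] by simp
    qed (use D in auto)
    also have "\<dots> = (D * C) * (?g j * ?h n)" by (simp add: ac_simps)
    also have "\<dots> \<le> M * (?g j * ?h n)" using D E by (intro mult_right_mono) (auto simp: M_def)
    finally show ?thesis .
  next
    case False
    have "\<bar>inner (Jinv \<psi> j) (R n j)\<bar> \<le> norm (Jinv \<psi> j) * norm (R n j)" by (rule Cauchy_Schwarz_ineq2)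
    also have "\<dots> \<le> D * (E * (?g j * ?h n))"
      using D(2)[of j] E(2)[of j n] D(1) False by (intro mult_mono) auto
    also have "\<dots> = (D * E) * (?g j * ?h n)" by (simp add: ac_simps)
    also have "\<dots> \<le> M * (?g j * ?h n)" using D C by (intro mult_right_mono) (auto simp: M_def)
    finally show ?thesis .
  qed
  have sg: "?g summable_on UNIV" and sh: "?h summable_on UNIV"
    using summable_half_decay[OF rates(1)] summable_half_decay[OF \<beta>_pos] by auto
  have sM: "(\<lambda>j. (M * ?h n) * ?g j) summable_on UNIV" for n by (rule summable_on_cmult_right[OF sg])
  show "\<exists>D. \<forall>n. \<bar>\<Omega> \<psi> (R n)\<bar> \<le> D * ?h n"
  proof (intro exI allI)
    fix n
    have "norm (\<Omega> \<psi> (R n)) \<le> (\<Sum>\<^sub>\<infinity>j. (M * ?h n) * ?g j)"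
      unfolding \<Omega>_def
      by (rule norm_infsum_le_infsum[OF sM]) (use le in \<open>simp add: ac_simps\<close>)
    then show "\<bar>\<Omega> \<psi> (R n)\<bar> \<le> (M * infsum ?g UNIV) * ?h n"
      by (simp add: infsum_cmult_right' ac_simps)
  qed
  assume f: "\<And>j. \<bar>f j\<bar> \<le> \<alpha>" and x: "\<And>j. ((\<lambda>n. f n *\<^sub>R R n j) has_sum x j) UNIV"
  have \<alpha>: "0 \<le> \<alpha>" using f[of 0] by linarith
  have s: "(\<lambda>(j, n). f n * inner (Jinv \<psi> j) (R n j)) summable_on UNIV \<times> UNIV"
    unfolding UNIV_Times_UNIV
  proof (rule summable_on_dominated[OF summable_on_product[of "\<lambda>j. (\<alpha> * M) * ?g j" ?h]])
    fix p :: "int \<times> int"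
    obtain j n where p: "p = (j, n)" by fastforce
    show "norm (case p of (j, n) \<Rightarrow> f n * inner (Jinv \<psi> j) (R n j)) \<le> (case p of (j, n) \<Rightarrow> (\<alpha> * M) * ?g j * ?h n)"
      using mult_mono[OF f[of n] le[of j n] \<alpha>] by (simp add: p abs_mult mult.assoc)
  qed (use sg sh \<alpha> M in \<open>auto intro!: summable_on_cmult_right\<close>)
  have "\<Omega> \<psi> x = (\<Sum>\<^sub>\<infinity>j. \<Sum>\<^sub>\<infinity>n. f n * inner (Jinv \<psi> j) (R n j))"
    unfolding \<Omega>_def
  proof (rule infsum_cong)
    fix j
    have "((\<lambda>n. inner (Jinv \<psi> j) (f n *\<^sub>R R n j)) has_sum inner (Jinv \<psi> j) (x j)) UNIV"
      by (rule has_sum_bounded_linear[OF bounded_linear_inner_right x])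
    from infsumI[OF this] show "inner (Jinv \<psi> j) (x j) = (\<Sum>\<^sub>\<infinity>n. f n * inner (Jinv \<psi> j) (R n j))"
      by simp
  qed
  also have "\<dots> = (\<Sum>\<^sub>\<infinity>n. \<Sum>\<^sub>\<infinity>j. f n * inner (Jinv \<psi> j) (R n j))"
    by (rule infsum_swap_banach[OF s])
  finally show "\<Omega> \<psi> x = (\<Sum>\<^sub>\<infinity>n. f n * \<Omega> \<psi> (R n))"
    by (simp add: \<Omega>_def infsum_cmult_right')
qed

lemma Q_has_sum:
  assumes f: "\<And>j. \<bar>f j\<bar> \<le> \<alpha>" and c: "c \<in> {cm..cp}"
  shows "((\<lambda>m. f m * Q k l k' l' \<xi> c (unit_seq m)) has_sum Q k l k' l' \<xi> c f) UNIV"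
proof -
  let ?q = "\<lambda>j. q k l k' l' c (real_of_int j - \<xi>)"
  have "Q k l k' l' \<xi> c (unit_seq m) = ?q m" for m
  proof -
    have "Q k l k' l' \<xi> c (unit_seq m) = (\<Sum>\<^sub>\<infinity>j\<in>{m}. ?q j * unit_seq m j)"
      unfolding Q_def pairing_def by (rule infsum_cong_neutral) (auto simp: unit_seq_def)
    then show ?thesis by (simp add: unit_seq_def)
  qed
  moreover have "(\<lambda>j. ?q j * f j) summable_on UNIV"
    by (rule summable_pairing[OF f q_shift_le[OF c order_refl]])
  ultimately show ?thesis
    by (simp add: Q_def pairing_def mult.commute)
qed

lemma V_has_sum:
  assumes f: "\<And>j. \<bar>f j\<bar> \<le> \<alpha>" and c: "c \<in> {cm<..<cp}"
  shows "((\<lambda>m. f m *\<^sub>R V \<xi> c (unit_seq m) $ i) has_sum V \<xi> c f $ i) UNIV"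
proof -
  have c': "c \<in> {1<..<cp}" "c \<in> {cm..cp}" using c speeds by auto
  note Q = Q_has_sum[where f = f and \<alpha> = \<alpha>, OF f c'(2)]
  have 1: "((\<lambda>m. \<alpha>1 c / (\<alpha>0 c)\<^sup>2 * (f m * Q 0 0 1 0 \<xi> c (unit_seq m)) + f m * Q 0 0 0 1 \<xi> c (unit_seq m) * (1 / \<alpha>0 c))
    has_sum \<alpha>1 c / (\<alpha>0 c)\<^sup>2 * Q 0 0 1 0 \<xi> c f + Q 0 0 0 1 \<xi> c f * (1 / \<alpha>0 c)) UNIV"
    by (intro has_sum_add has_sum_cmult_right has_sum_cmult_left Q)
  have 2: "((\<lambda>m. f m * Q 0 0 1 0 \<xi> c (unit_seq m) * (1 / \<alpha>0 c)) has_sum Q 0 0 1 0 \<xi> c f * (1 / \<alpha>0 c)) UNIV"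
    by (intro has_sum_cmult_left Q)
  consider "i = 1" | "i = 2" using exhaust_2 by blast
  then show ?thesis
    by cases (use 1 2 in \<open>simp_all add: V_eq[OF c'(1)] algebra_simps\<close>)
qed

text \<open>Three mechanisms give decay in both indices: a component of \<open>V\<close> times a
  symplectic product, the pairing of \<open>f\<close> with the tail against a localized weight, and
  the form on \<open>ell2\<close> quadratic in the tail. All are stated with the slowest rate
  \<open>\<beta> / 2\<close>, dictated by the symplectic products.\<close>

lemma second_order_expansion:
  fixes R :: "int \<Rightarrow> ell2" and x :: ell2
  assumes f: "\<And>j. \<bar>f j\<bar> \<le> \<alpha>" and c: "c \<in> {cm<..<cp}"
    and R: "\<And>m. norm (R m) \<le> C * weight m" and l2a: "in_l2a_Z2 a (\<lambda>j m. seq (R m) j)"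
    and x: "((\<lambda>m. f m *\<^sub>R R m) has_sum x) UNIV"
  shows "bounded_coefficients.quad_expansion f (\<lambda>n. exp (- (\<beta> / 2) * \<bar>real_of_int n\<bar>))
    (\<lambda>m n. \<Gamma>C11 \<xi> c (unit_seq m) (seq (R n))) (\<Gamma>C11 \<xi> c f (seq x))" (is ?\<Gamma>C11)
    and "bounded_coefficients.quad_expansion f (\<lambda>n. exp (- (\<beta> / 2) * \<bar>real_of_int n\<bar>))
    (\<lambda>m n. \<Gamma>C02 \<xi> c (\<lambda>j. seq (R m) j $ 1) (\<lambda>j. seq (R n) j $ 1))
    (\<Gamma>C02 \<xi> c (\<lambda>j. seq x j $ 1) (\<lambda>j. seq x j $ 1))" (is ?\<Gamma>C02)
proof -
  let ?h = "\<lambda>n. exp (- (\<beta> / 2) * \<bar>real_of_int n\<bar>)"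
  interpret bounded_coefficients f ?h \<alpha>
    by unfold_locales (use f summable_half_decay[OF \<beta>_pos] in auto)
  have c': "c \<in> {1<..<cp}" "c \<in> {1<..cp}" "c \<in> {cm..cp}" using c speeds by auto
  have C: "0 \<le> C" using order_trans[OF norm_ge_zero R[of 0]] by (simp add: weight_def)
  have le_h: "D * weight n \<le> D * ?h n" if "0 \<le> D" for D n
    by (rule mult_left_mono[OF weight_le_half that])
  have Rh: "norm (R m) \<le> C * ?h m" for m using R[of m] le_h[OF C, of m] by simp
  have Rj: "norm (seq (R m) j) \<le> C * weight m" for m j using norm_seq_le[of "R m" j] R[of m] by simp
  have xj: "((\<lambda>n. f n *\<^sub>R seq (R n) j) has_sum seq x j) UNIV" for j
    using has_sum_bounded_linear[OF bounded_linear_seq x] by simp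
  have xr: "seq x j $ 1 = (\<Sum>\<^sub>\<infinity>n. f n * seq (R n) j $ 1)" for j
    using infsumI[OF has_sum_bounded_linear[OF bounded_linear_vec_nth xj]] by simp
  have unit: "\<bar>unit_seq m j\<bar> \<le> 1" for m j by (simp add: unit_seq_def)

  obtain CV where CV: "0 \<le> CV"
    "\<forall>\<zeta> f \<alpha> i. \<bar>\<zeta>\<bar> \<le> \<bar>\<xi>\<bar> \<longrightarrow> (\<forall>j. \<bar>f j\<bar> \<le> \<alpha>) \<longrightarrow> \<bar>V \<zeta> c f $ i\<bar> \<le> CV * wsum f"
    using V_le[OF c abs_ge_zero[of \<xi>]] by (elim exE conjE)
  have Vh: "norm (V \<xi> c (unit_seq m) $ i) \<le> CV * ?h m" for m i
  proof -
    have "\<bar>V \<xi> c (unit_seq m) $ i\<bar> \<le> CV * wsum (unit_seq m)"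
      by (rule CV(2)[rule_format, of \<xi> _ 1]) (simp_all add: unit)
    then show ?thesis using le_h[OF CV(1), of m] by (simp add: wsum_unit_seq)
  qed
  have Vsum: "V \<xi> c f $ i = (\<Sum>\<^sub>\<infinity>m. f m *\<^sub>R V \<xi> c (unit_seq m) $ i)" for i
    using infsumI[OF V_has_sum[where f = f and \<alpha> = \<alpha>, OF f c]] by simp
  \<comment> \<open>A product of two scalar series: \<open>V\<close> supplies the decay in
    \<open>m\<close>, the symplectic product the decay in \<open>n\<close>.\<close>
  have V\<Omega>: "quad_expansion (\<lambda>m n. V \<xi> c (unit_seq m) $ i * \<Omega> \<psi> (seq (R n))) (V \<xi> c f $ i * \<Omega> \<psi> (seq x))"
    if \<psi>: "\<And>j. norm (\<psi> j) \<le> C0 * weight j" for \<psi> C0 i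
  proof -
    obtain D where "\<forall>n. \<bar>\<Omega> \<psi> (seq (R n))\<bar> \<le> D * ?h n"
      using \<Omega>_expansion(1)[of \<psi> C0 "\<lambda>n. seq (R n)", OF \<psi> Rj l2a] by auto
    moreover have "\<Omega> \<psi> (seq x) = (\<Sum>\<^sub>\<infinity>n. f n *\<^sub>R \<Omega> \<psi> (seq (R n)))"
      using \<Omega>_expansion(2)[of \<psi> C0 "\<lambda>n. seq (R n)" C f \<alpha> "seq x", OF \<psi> Rj l2a f xj] by simp
    ultimately show ?thesis
      by (intro quad_expansion_bilinear[OF bounded_bilinear_mult Vsum Vh]) auto
  qed
  have \<psi>: "norm (\<phi>\<xi>\<xi> \<xi> c j) \<le> (K 2 0 * exp (\<beta> * \<bar>\<xi>\<bar>)) * weight j"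
    "norm (\<phi>c\<xi> \<xi> c j) \<le> (K 1 1 * exp (\<beta> * \<bar>\<xi>\<bar>)) * weight j"
    "norm (\<phi>\<xi>c \<xi> c j) \<le> (K 1 1 * exp (\<beta> * \<bar>\<xi>\<bar>)) * weight j"
    "norm (\<phi>cc \<xi> c j) \<le> (K 0 2 * exp (\<beta> * \<bar>\<xi>\<bar>)) * weight j" for j
    unfolding tangent_eq[OF c'(2)] norm_minus_cancel by (rule d_shift_le[OF c'(3) order_refl])+
  have B: "B \<xi> c h *v v = vec2 (v $ 1 * \<Omega> (\<phi>\<xi>\<xi> \<xi> c) h + v $ 2 * \<Omega> (\<phi>c\<xi> \<xi> c) h)
                            (v $ 1 * \<Omega> (\<phi>\<xi>c \<xi> c) h + v $ 2 * \<Omega> (\<phi>cc \<xi> c) h)" for h v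
    by (simp add: B_def matrix_vector_mult_def vec2_eq_iff sum_2 mult.commute)
  have 1: "quad_expansion (\<lambda>m n. matrix_inv (A c) *v (B \<xi> c (seq (R n)) *v V \<xi> c (unit_seq m)))
      (matrix_inv (A c) *v (B \<xi> c (seq x) *v V \<xi> c f))"
    unfolding B
    by (intro quad_expansion_linear[OF matrix_vector_mul_bounded_linear] quad_expansion_vec2 quad_expansion_add)
       (rule V\<Omega>[OF \<psi>(1)] V\<Omega>[OF \<psi>(2)] V\<Omega>[OF \<psi>(3)] V\<Omega>[OF \<psi>(4)])+

  let ?w1 = "\<lambda>j. D\<xi> (rwave j) \<xi> c" and ?w2 = "\<lambda>j. Dc (rwave j) \<xi> c"
  have w: "\<bar>?w1 j\<bar> \<le> (K 1 0 * exp (\<beta> * \<bar>\<xi>\<bar>)) * weight j" "\<bar>?w2 j\<bar> \<le> (K 0 1 * exp (\<beta> * \<bar>\<xi>\<bar>)) * weight j" for j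
    unfolding D\<xi>_rwave[OF c'(2)] Dc_rwave[OF c'(1)] abs_minus_cancel
    by (rule order_trans[OF component_le_norm_cart d_shift_le[OF c'(3) order_refl]])+
  have wh: "\<bar>?w1 j\<bar> \<le> (K 1 0 * exp (\<beta> * \<bar>\<xi>\<bar>)) * ?h j" "\<bar>?w2 j\<bar> \<le> (K 0 1 * exp (\<beta> * \<bar>\<xi>\<bar>)) * ?h j" for j
  proof -
    have nn: "0 \<le> K 1 0 * exp (\<beta> * \<bar>\<xi>\<bar>)" "0 \<le> K 0 1 * exp (\<beta> * \<bar>\<xi>\<bar>)" using K_nonneg by auto
    show "\<bar>?w1 j\<bar> \<le> (K 1 0 * exp (\<beta> * \<bar>\<xi>\<bar>)) * ?h j" "\<bar>?w2 j\<bar> \<le> (K 0 1 * exp (\<beta> * \<bar>\<xi>\<bar>)) * ?h j"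
      by (fact order_trans[OF w(1) le_h[OF nn(1)]], fact order_trans[OF w(2) le_h[OF nn(2)]])
  qed
  have w1: "\<bar>?w1 j\<bar> \<le> K 1 0 * exp (\<beta> * \<bar>\<xi>\<bar>)" "\<bar>?w2 j\<bar> \<le> K 0 1 * exp (\<beta> * \<bar>\<xi>\<bar>)" for j
  proof -
    have le1: "D * weight j \<le> D" if "0 \<le> D" for D
      using that \<beta>_pos by (simp add: weight_def mult_left_le)
    have nn: "0 \<le> K 1 0 * exp (\<beta> * \<bar>\<xi>\<bar>)" "0 \<le> K 0 1 * exp (\<beta> * \<bar>\<xi>\<bar>)" using K_nonneg by auto
    show "\<bar>?w1 j\<bar> \<le> K 1 0 * exp (\<beta> * \<bar>\<xi>\<bar>)" "\<bar>?w2 j\<bar> \<le> K 0 1 * exp (\<beta> * \<bar>\<xi>\<bar>)"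
      by (fact order_trans[OF w(1) le1[OF nn(1)]], fact order_trans[OF w(2) le1[OF nn(2)]])
  qed
  have Rjh: "\<bar>seq (R n) j $ 1\<bar> \<le> C * ?h n" for n j
    using component_le_norm_cart[of "seq (R n) j" 1] Rj[of n j] le_h[OF C, of n] by simp
  note lin = bounded_linear_minus[OF matrix_vector_mul_bounded_linear[of "matrix_inv (A c)"]]
  have 2: "quad_expansion (\<lambda>m n. \<Gamma>C02 \<xi> c (unit_seq m) (\<lambda>j. seq (R n) j $ 1)) (\<Gamma>C02 \<xi> c f (\<lambda>j. seq x j $ 1))"
    unfolding \<Gamma>C02_def
    by (intro quad_expansion_linear[OF lin] quad_expansion_vec2 quad_expansion_pairing[OF wh(1) Rjh xr]
        quad_expansion_pairing[OF wh(2) Rjh xr])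
  show ?\<Gamma>C11
    using quad_expansion_add[OF 1 2] by (simp add: \<Gamma>C11_def)
  show ?\<Gamma>C02
    unfolding \<Gamma>C02_def
    by (intro quad_expansion_linear[OF lin] quad_expansion_vec2
        quad_expansion_bilinear[OF bounded_bilinear_pairing[OF w1(1)] infsumI[OF x, symmetric] Rh infsumI[OF x, symmetric] Rh]
        quad_expansion_bilinear[OF bounded_bilinear_pairing[OF w1(2)] infsumI[OF x, symmetric] Rh infsumI[OF x, symmetric] Rh])
qed

text \<open>Identifies the series inside the parts of \<open>M10\<close> with the expressions in the
  first-order corrections. The factor 2 comes from differentiating the square of the profile in the
  speed.\<close>

lemma wave_square_sums:
  assumes f: "\<And>j. \<bar>f j\<bar> \<le> \<alpha>" and c: "c \<in> {cm<..<cp}"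
  shows "(\<Sum>\<^sub>\<infinity>j. f j * ((r c (real_of_int j - \<xi>))\<^sup>2 - (r c (real_of_int j))\<^sup>2))
      = Q 0 0 0 0 \<xi> c f - Q 0 0 0 0 0 c f"
    and "(\<Sum>\<^sub>\<infinity>j. f j * (LBINT s=0..\<xi>. Dc (\<lambda>x c. (r c x)\<^sup>2) (real_of_int j - s) c)) = 2 * N 0 0 0 1 \<xi> c f"
    and "(\<Sum>\<^sub>\<infinity>j. f j * ((LBINT s=0..\<xi>. (r c (real_of_int j - s))\<^sup>2) - \<xi> * (r c (real_of_int j))\<^sup>2))
      = N 0 0 0 0 \<xi> c f - \<xi> * Q 0 0 0 0 0 c f"
proof -
  have c': "c \<in> {1<..<cp}" "c \<in> {1<..cp}" "c \<in> {cm..cp}" using c speeds by auto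
  have r: "(r c x)\<^sup>2 = q 0 0 0 0 c x" for x
    by (simp add: r_def q_def d_00[OF c'(2)] power2_eq_square)
  have Dc: "Dc (\<lambda>x c. (r c x)\<^sup>2) x c = 2 * q 0 0 0 1 c x" for x
    using q_c[OF c'(1), of 0 0 0 0 x] q_commute[of 0 1 0 0]
    by (intro Dc_eq[OF c'(2), where G = "\<lambda>c. q 0 0 0 0 c x"])
       (auto simp: at_within_speeds[OF c'(1)] r_def q_def d_00 power2_eq_square
         simp flip: has_real_derivative_iff_has_vector_derivative)
  have sQ: "(\<lambda>j. f j * q 0 0 0 0 c (real_of_int j - \<xi>)) summable_on UNIV" for \<xi>
    using summable_pairing[OF f q_shift_le[OF c'(3) order_refl]] by (simp add: mult.commute)
  have Q: "Q k l k' l' \<xi> c f = (\<Sum>\<^sub>\<infinity>j. f j * q k l k' l' c (real_of_int j - \<xi>))" for k l k' l' \<xi>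
    by (simp add: Q_def pairing_def mult.commute)
  have N: "N k l k' l' \<xi> c f = (\<Sum>\<^sub>\<infinity>j. f j * (LBINT s=0..\<xi>. q k l k' l' c (real_of_int j - s)))" for k l k' l'
    by (simp add: N_def pairing_def mult.commute)
  have sN: "(\<lambda>j. f j * (LBINT s=0..\<xi>. q 0 0 0 0 c (real_of_int j - s))) summable_on UNIV"
    using summable_N[where f = f and \<alpha> = \<alpha>, OF f c] by (simp add: mult.commute)
  have diff: "(\<Sum>\<^sub>\<infinity>j. f j * (u j - k * v j)) = (\<Sum>\<^sub>\<infinity>j. f j * u j) - k * (\<Sum>\<^sub>\<infinity>j. f j * v j)"
    if "(\<lambda>j. f j * u j) summable_on UNIV" "(\<lambda>j. f j * v j) summable_on UNIV" for u v :: "int \<Rightarrow> real" and k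
  proof -
    have "(\<Sum>\<^sub>\<infinity>j. f j * (u j - k * v j)) = (\<Sum>\<^sub>\<infinity>j. f j * u j + (- k) * (f j * v j))"
      by (rule infsum_cong) (simp add: algebra_simps)
    also have "\<dots> = (\<Sum>\<^sub>\<infinity>j. f j * u j) + (- k) * (\<Sum>\<^sub>\<infinity>j. f j * v j)"
      by (simp only: infsum_add[OF that(1) summable_on_cmult_right[OF that(2)]] infsum_cmult_right')
    finally show ?thesis by simp
  qed
  show "(\<Sum>\<^sub>\<infinity>j. f j * ((r c (real_of_int j - \<xi>))\<^sup>2 - (r c (real_of_int j))\<^sup>2)) = Q 0 0 0 0 \<xi> c f - Q 0 0 0 0 0 c f"
    using diff[OF sQ[of \<xi>] sQ[of 0], of 1] by (simp add: r Q)
  show "(\<Sum>\<^sub>\<infinity>j. f j * (LBINT s=0..\<xi>. Dc (\<lambda>x c. (r c x)\<^sup>2) (real_of_int j - s) c)) = 2 * N 0 0 0 1 \<xi> c f"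
    by (simp add: Dc N mult.left_commute[of _ 2] infsum_cmult_right')
  show "(\<Sum>\<^sub>\<infinity>j. f j * ((LBINT s=0..\<xi>. (r c (real_of_int j - s))\<^sup>2) - \<xi> * (r c (real_of_int j))\<^sup>2))
      = N 0 0 0 0 \<xi> c f - \<xi> * Q 0 0 0 0 0 c f"
    using diff[OF sN sQ[of 0], of \<xi>] by (simp add: r Q N)
qed

end

section \<open>Random coefficients\<close>

context finite_measure
begin

text \<open>An enumeration turns the sum into a series over the naturals, to which termwise
  integration applies; infinitude of the index type makes the enumeration a bijection.\<close>

lemma
  fixes f :: "'i \<Rightarrow> 'a \<Rightarrow> 'b::{banach, second_countable_topology}"
  assumes I: "countable (UNIV :: 'i set)" "infinite (UNIV :: 'i set)"
    and meas: "\<And>i. f i \<in> borel_measurable M"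
    and b: "b summable_on UNIV" "\<And>i x. norm (f i x) \<le> b i"
  shows borel_measurable_infsum_dominated: "(\<lambda>x. \<Sum>\<^sub>\<infinity>i. f i x) \<in> borel_measurable M" (is ?m)
    and integral_infsum_dominated: "(\<integral>x. (\<Sum>\<^sub>\<infinity>i. f i x) \<partial>M) = (\<Sum>\<^sub>\<infinity>i. \<integral>x. f i x \<partial>M)" (is ?i)
proof -
  note bij = bij_betw_from_nat_into[OF I]
  let ?e = "from_nat_into (UNIV :: 'i set)"
  have sb: "summable (\<lambda>n. b (?e n))"
    using summable_on_reindex_bij_betw[OF bij, of b] b(1) by (simp add: summable_on_imp_summable)
  have b0: "0 \<le> b i" for i using order_trans[OF norm_ge_zero b(2)] .
  have sums: "infsum g UNIV = (\<Sum>n. g (?e n))"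
    if "g summable_on UNIV" for g :: "'i \<Rightarrow> 'b"
  proof -
    have "((\<lambda>n. g (?e n)) has_sum infsum g UNIV) UNIV"
      using has_sum_reindex_bij_betw[OF bij, of g "infsum g UNIV"] has_sum_infsum[OF that] by simp
    then show ?thesis using has_sum_imp_sums sums_unique by blast
  qed
  have eq: "(\<Sum>\<^sub>\<infinity>i. f i x) = (\<Sum>n. f (?e n) x)" for x
    by (rule sums[OF summable_on_dominated[OF b(1)]]) (rule b)
  have int: "integrable M (f i)" for i
    by (rule integrable_const_bound[of _ "b i"]) (use meas b in auto)
  have norm_sum: "summable (\<lambda>n. norm (f (?e n) x))" for x
    by (rule summable_comparison_test'[OF sb]) (simp add: b)
  have le: "norm (\<integral>x. norm (f i x) \<partial>M) \<le> b i * measure M (space M)" for i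
  proof -
    have "(\<integral>x. norm (f i x) \<partial>M) \<le> (\<integral>x. b i \<partial>M)"
      using int b by (intro integral_mono) auto
    moreover have "0 \<le> (\<integral>x. norm (f i x) \<partial>M)"
      by (rule Bochner_Integration.integral_nonneg) simp
    ultimately show ?thesis
      unfolding real_norm_def by (simp only: abs_of_nonneg lebesgue_integral_const real_scaleR_def mult.commute)
  qed
  have norm_int: "summable (\<lambda>n. \<integral>x. norm (f (?e n) x) \<partial>M)"
    by (rule summable_comparison_test'[OF summable_mult2[OF sb]]) (rule le)
  show ?m unfolding eq using meas by (intro borel_measurable_suminf) auto
  have "(\<lambda>i. \<integral>x. f i x \<partial>M) summable_on UNIV"
  proof (rule summable_on_dominated)
    show "(\<lambda>i. b i * measure M (space M)) summable_on UNIV" by (rule summable_on_cmult_left[OF b(1)])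
    show "norm (\<integral>x. f i x \<partial>M) \<le> b i * measure M (space M)" for i
      by (rule order_trans[OF integral_norm_bound order_trans[OF abs_ge_self le[unfolded real_norm_def]]])
  qed
  then show ?i
    unfolding eq
    using sums integral_suminf[of M "\<lambda>n. f (?e n)", OF int _ norm_int] norm_sum by auto
qed

text \<open>The bound holds everywhere, not just almost everywhere. The class is closed under sums
  and products and consists of integrable functions, which suits products of two random
  series.\<close>

definition bounded_measurable :: "('a \<Rightarrow> 'b::{banach, second_countable_topology}) \<Rightarrow> bool"
  where "bounded_measurable X \<longleftrightarrow> X \<in> borel_measurable M \<and> (\<exists>C. \<forall>x. norm (X x) \<le> C)"

lemma bounded_measurable_integrable: "bounded_measurable X \<Longrightarrow> integrable M X"
  unfolding bounded_measurable_def by (auto intro!: integrable_const_bound)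

lemma bounded_measurable_const: "bounded_measurable (\<lambda>_. k)"
  unfolding bounded_measurable_def by auto

lemma bounded_measurable_add:
  assumes "bounded_measurable X" "bounded_measurable Y"
  shows "bounded_measurable (\<lambda>x. X x + Y x)"
proof -
  obtain C D where "\<And>x. norm (X x) \<le> C" "\<And>x. norm (Y x) \<le> D"
    using assms unfolding bounded_measurable_def by blast
  then have "norm (X x + Y x) \<le> C + D" for x
    by (rule norm_triangle_le[OF add_mono])
  then show ?thesis using assms unfolding bounded_measurable_def by auto
qed

lemma bounded_measurable_scaleR:
  fixes X :: "'a \<Rightarrow> real"
  assumes "bounded_measurable X" "bounded_measurable Y"
  shows "bounded_measurable (\<lambda>x. X x *\<^sub>R Y x)"
proof -
  obtain C D where C: "\<And>x. norm (X x) \<le> C" and D: "\<And>x. norm (Y x) \<le> D"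
    using assms unfolding bounded_measurable_def by blast
  have "norm (X x *\<^sub>R Y x) \<le> C * D" for x
    unfolding norm_scaleR using C[of x] D[of x] by (intro mult_mono) (auto intro: order_trans[OF abs_ge_zero])
  then show ?thesis using assms unfolding bounded_measurable_def by auto
qed

lemma bounded_measurable_mult:
  fixes X Y :: "'a \<Rightarrow> real"
  shows "bounded_measurable X \<Longrightarrow> bounded_measurable Y \<Longrightarrow> bounded_measurable (\<lambda>x. X x * Y x)"
  using bounded_measurable_scaleR[of X Y] by simp

lemma bounded_measurable_uminus: "bounded_measurable X \<Longrightarrow> bounded_measurable (\<lambda>x. - X x)"
  using bounded_measurable_scaleR[OF bounded_measurable_const[of "-1"]] by force

lemma bounded_measurable_diff:
  "bounded_measurable X \<Longrightarrow> bounded_measurable Y \<Longrightarrow> bounded_measurable (\<lambda>x. X x - Y x)"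
  using bounded_measurable_add[OF _ bounded_measurable_uminus, of X Y] by simp

lemma bounded_measurable_divide:
  fixes X :: "'a \<Rightarrow> real"
  shows "bounded_measurable X \<Longrightarrow> bounded_measurable (\<lambda>x. X x / k)"
  using bounded_measurable_mult[OF _ bounded_measurable_const[of "1 / k"]] by force

lemma bounded_measurable_vec2:
  assumes "bounded_measurable X" "bounded_measurable Y"
  shows "bounded_measurable (\<lambda>x. vec2 (X x) (Y x))"
  using bounded_measurable_add[OF bounded_measurable_scaleR[OF assms(1) bounded_measurable_const[of "vec2 1 0"]]
    bounded_measurable_scaleR[OF assms(2) bounded_measurable_const[of "vec2 0 1"]]]
  by (simp add: vec2_scaleR[symmetric])

lemma bounded_measurable_infsum:
  fixes f :: "'i \<Rightarrow> 'a \<Rightarrow> 'b::{banach, second_countable_topology}"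
  assumes "countable (UNIV :: 'i set)" "infinite (UNIV :: 'i set)"
    and "\<And>i. f i \<in> borel_measurable M" "b summable_on UNIV" "\<And>i x. norm (f i x) \<le> b i"
  shows "bounded_measurable (\<lambda>x. \<Sum>\<^sub>\<infinity>i. f i x)"
  unfolding bounded_measurable_def
proof (intro conjI exI allI)
  show "(\<lambda>x. \<Sum>\<^sub>\<infinity>i. f i x) \<in> borel_measurable M"
    by (rule borel_measurable_infsum_dominated[OF assms])
  show "norm (\<Sum>\<^sub>\<infinity>i. f i x) \<le> infsum b UNIV" for x
    by (rule norm_infsum_le_infsum[OF assms(4)]) (rule assms(5))
qed

end

text \<open>\<open>Y\<close> carries no measurability assumption: in the completion, agreement with
  \<open>X\<close> outside a null set makes its preimages measurable. This fits solutions that are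
  prescribed only for almost every realization.\<close>

lemma
  fixes X :: "'a \<Rightarrow> 'b::{banach, second_countable_topology}"
  assumes X: "integrable M X" and eq: "AE x in M. Y x = X x"
  shows integrable_completion_AE: "integrable (completion M) Y"
    and integral_completion_AE: "integral\<^sup>L (completion M) Y = integral\<^sup>L M X"
proof -
  have Xm: "X \<in> borel_measurable M" using X by (rule borel_measurable_integrable)
  have ae: "AE x in completion M. Y x = X x" using eq by (rule AE_completion)
  have Ym: "Y \<in> borel_measurable (completion M)"
  proof (rule measurableI)
    fix S :: "'b set" assume S: "S \<in> sets borel"
    show "Y -` S \<inter> space (completion M) \<in> sets (completion M)"
    proof (rule completion.in_sets_AE)
      show "X -` S \<inter> space M \<in> sets (completion M)"
        using measurable_sets[OF Xm S] by (simp add: sets_completionI_sub)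
      show "AE x in completion M. x \<in> X -` S \<inter> space M \<longleftrightarrow> x \<in> Y -` S \<inter> space (completion M)"
        using ae by eventually_elim auto
    qed auto
  qed auto
  have Xc: "X \<in> borel_measurable (completion M)" using Xm by (rule measurable_completion)
  have "integrable (completion M) X" using X integrable_completion[OF Xm] by simp
  then show "integrable (completion M) Y"
    using integrable_cong_AE[OF Ym Xc ae] by simp
  show "integral\<^sup>L (completion M) Y = integral\<^sup>L M X"
    using integral_cong_AE[OF Ym Xc ae] integral_completion[OF Xm] by simp
qed

lemma (in prob_space) expectation_mult_indep:
  fixes X :: "'i \<Rightarrow> 'a \<Rightarrow> real"
  assumes "indep_vars (\<lambda>_. borel) X UNIV" "i \<noteq> j" "\<And>i. integrable M (X i)"
  shows "expectation (\<lambda>x. X i x * X j x) = expectation (X i) * expectation (X j)"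
  using indep_vars_lebesgue_integral[of "{i, j}" X, OF _ indep_vars_subset[OF assms(1)]] assms(2,3) by simp

text \<open>Only the diagonal survives in the expectation of a quadratic form in uncorrelated variables.\<close>

lemma (in prob_space) expectation_quadratic:
  fixes X :: "'a \<Rightarrow> int \<Rightarrow> real" and F :: "int \<Rightarrow> int \<Rightarrow> 'b::{banach, second_countable_topology}"
  assumes meas: "\<And>j. (\<lambda>x. X x j) \<in> borel_measurable M" and X: "\<And>x j. \<bar>X x j\<bar> \<le> \<alpha>"
    and cov: "\<And>i j. expectation (\<lambda>x. X x i * X x j) = (if i = j then 1 else 0)"
    and h: "\<And>j. 0 \<le> h j" "h summable_on UNIV" and F: "\<And>m n. norm (F m n) \<le> D * (h m * h n)"
  shows "bounded_measurable (\<lambda>x. \<Sum>\<^sub>\<infinity>(m, n). (X x m * X x n) *\<^sub>R F m n)"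
    and "expectation (\<lambda>x. \<Sum>\<^sub>\<infinity>(m, n). (X x m * X x n) *\<^sub>R F m n) = (\<Sum>\<^sub>\<infinity>m. F m m)"
proof -
  have bc: "bounded_coefficients (X x) h \<alpha>" for x by unfold_locales (use X h in auto)
  define G where "G p x = (X x (fst p) * X x (snd p)) *\<^sub>R F (fst p) (snd p)" for p x
  define b where "b p = \<alpha> * \<alpha> * D * (h (fst p) * h (snd p))" for p
  have \<alpha>: "0 \<le> \<alpha>" using X[of undefined 0] by linarith
  have G: "norm (G p x) \<le> b p" for p x
  proof -
    have "norm (G p x) = \<bar>X x (fst p)\<bar> * \<bar>X x (snd p)\<bar> * norm (F (fst p) (snd p))"
      by (simp add: G_def abs_mult)
    also have "\<dots> \<le> (\<alpha> * \<alpha>) * (D * (h (fst p) * h (snd p)))"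
      using X F \<alpha> by (intro mult_mono) auto
    finally show ?thesis by (simp add: b_def mult.assoc)
  qed
  have b: "b summable_on UNIV"
    using bounded_coefficients.summable_h_h[OF bc, of "\<alpha> * \<alpha> * D"] by (simp add: b_def[abs_def] case_prod_unfold)
  have I: "countable (UNIV :: (int \<times> int) set)" "infinite (UNIV :: (int \<times> int) set)"
    by (auto simp: finite_prod)
  have Gm: "G p \<in> borel_measurable M" for p
    unfolding G_def using meas by measurable
  have eq: "(\<Sum>\<^sub>\<infinity>(m, n). (X x m * X x n) *\<^sub>R F m n) = (\<Sum>\<^sub>\<infinity>p. G p x)" for x
    by (simp add: G_def case_prod_unfold)
  show "bounded_measurable (\<lambda>x. \<Sum>\<^sub>\<infinity>(m, n). (X x m * X x n) *\<^sub>R F m n)"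
    unfolding eq by (rule bounded_measurable_infsum[OF I Gm b G])
  have "expectation (\<lambda>x. \<Sum>\<^sub>\<infinity>(m, n). (X x m * X x n) *\<^sub>R F m n) = (\<Sum>\<^sub>\<infinity>p. expectation (G p))"
    unfolding eq by (rule integral_infsum_dominated[OF I Gm b G])
  also have "(\<lambda>p. expectation (G p)) = (\<lambda>p. if fst p = snd p then F (fst p) (snd p) else 0)"
  proof
    fix p
    have "integrable M (\<lambda>x. X x (fst p) * X x (snd p))"
    proof (rule integrable_const_bound[of _ "\<alpha> * \<alpha>"])
      show "AE x in M. norm (X x (fst p) * X x (snd p)) \<le> \<alpha> * \<alpha>"
        unfolding real_norm_def abs_mult using X \<alpha> by (intro AE_I2 mult_mono) auto
    qed (use meas in measurable)
    then have "expectation (G p) = expectation (\<lambda>x. X x (fst p) * X x (snd p)) *\<^sub>R F (fst p) (snd p)"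
      unfolding G_def by (rule integral_scaleR_left)
    then show "expectation (G p) = (if fst p = snd p then F (fst p) (snd p) else 0)" by (simp add: cov)
  qed
  also have "(\<Sum>\<^sub>\<infinity>p. if fst p = snd p then F (fst p) (snd p) else 0) = (\<Sum>\<^sub>\<infinity>p\<in>range (\<lambda>m. (m, m)). F (fst p) (snd p))"
    by (rule infsum_cong_neutral) (auto simp: image_iff)
  also have "\<dots> = (\<Sum>\<^sub>\<infinity>m. F m m)"
    by (subst infsum_reindex) (auto simp: inj_on_def o_def)
  finally show "expectation (\<lambda>x. \<Sum>\<^sub>\<infinity>(m, n). (X x m * X x n) *\<^sub>R F m n) = (\<Sum>\<^sub>\<infinity>m. F m m)" .
qed

section \<open>Measurability of the random lattice sums and the drift of a single
  realization\<close>

context localized_waves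
begin

context
  fixes P :: "'w measure" and X :: "'w \<Rightarrow> int \<Rightarrow> real" and \<alpha> :: real
  assumes prob: "prob_space P"
    and meas: "\<And>j. (\<lambda>\<omega>. X \<omega> j) \<in> borel_measurable P" and X: "\<And>\<omega> j. \<bar>X \<omega> j\<bar> \<le> \<alpha>"
begin

interpretation prob_space P by (rule prob)

lemma bounded_measurable_pairing:
  assumes w: "w summable_on UNIV"
  shows "bounded_measurable (\<lambda>\<omega>. pairing w (X \<omega>))"
  unfolding pairing_def
proof (rule bounded_measurable_infsum)
  show "(\<lambda>\<omega>. w j * X \<omega> j) \<in> borel_measurable P" for j using meas by measurable
  have "(\<lambda>j. \<bar>w j\<bar>) summable_on UNIV"
    using w summable_on_iff_abs_summable_on_real[of w UNIV] by simp
  then show "(\<lambda>j. \<bar>w j\<bar> * \<alpha>) summable_on UNIV" by (rule summable_on_cmult_left)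
  show "norm (w j * X \<omega> j) \<le> \<bar>w j\<bar> * \<alpha>" for j \<omega>
    using X[of \<omega> j] by (simp add: abs_mult mult_left_mono)
qed auto

lemma bounded_measurable_Q:
  assumes c: "c \<in> {cm<..<cp}"
  shows "bounded_measurable (\<lambda>\<omega>. Q k l k' l' \<xi> c (X \<omega>))"
  unfolding Q_def
proof (rule bounded_measurable_pairing)
  have "\<bar>q k l k' l' c (real_of_int j - \<xi>)\<bar> \<le> (K k l * K k' l' * exp (\<beta> * \<bar>\<xi>\<bar>)) * weight j" for j
    using c by (intro q_shift_le) auto
  from summable_pairing[of "\<lambda>_. 1" 1, OF _ this]
  show "(\<lambda>j. q k l k' l' c (real_of_int j - \<xi>)) summable_on UNIV" by simp
qed

lemma bounded_measurable_N:
  assumes c: "c \<in> {cm<..<cp}"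
  shows "bounded_measurable (\<lambda>\<omega>. N k l k' l' \<xi> c (X \<omega>))"
  unfolding N_def
  using summable_N[of "\<lambda>_. 1" 1, OF _ c] by (intro bounded_measurable_pairing) simp

text \<open>The explicit formulas for the derivatives have coefficients independent of the
  realization, so only finitely many random sums \<open>Q\<close> need to be measurable.\<close>

lemma bounded_measurable_D_V:
  assumes c: "c \<in> {cm<..<cp}"
  shows "bounded_measurable (\<lambda>\<omega>. D\<xi> (\<lambda>\<xi> c. V \<xi> c (X \<omega>)) \<xi> c)"
    and "bounded_measurable (\<lambda>\<omega>. Dc (\<lambda>\<xi> c. V \<xi> c (X \<omega>)) \<xi> c)"
proof -
  note intros = bounded_measurable_vec2 bounded_measurable_add bounded_measurable_mult bounded_measurable_divide
    bounded_measurable_uminus bounded_measurable_const bounded_measurable_Q[OF c]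
  have eq: "D\<xi> (\<lambda>\<xi> c. V \<xi> c (X \<omega>)) \<xi> c = vec2
      (\<alpha>1 c / (\<alpha>0 c)\<^sup>2 * - (Q 1 0 1 0 \<xi> c (X \<omega>) + Q 0 0 2 0 \<xi> c (X \<omega>))
        + - (Q 1 0 0 1 \<xi> c (X \<omega>) + Q 0 0 1 1 \<xi> c (X \<omega>)) / \<alpha>0 c)
      (- (Q 1 0 1 0 \<xi> c (X \<omega>) + Q 0 0 2 0 \<xi> c (X \<omega>)) / \<alpha>0 c)" for \<omega>
    by (rule D\<xi>_V[OF c]) (rule X)
  show "bounded_measurable (\<lambda>\<omega>. D\<xi> (\<lambda>\<xi> c. V \<xi> c (X \<omega>)) \<xi> c)"
    unfolding eq by (rule intros)+
  obtain u' v' where uv: "\<forall>\<xi> f \<alpha>. (\<forall>j. \<bar>f j\<bar> \<le> \<alpha>) \<longrightarrow> Dc (\<lambda>\<xi> c. V \<xi> c f) \<xi> c = vec2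
    (u' * Q 0 0 1 0 \<xi> c f + (Q 0 1 1 0 \<xi> c f + Q 0 0 1 1 \<xi> c f) * (\<alpha>1 c / (\<alpha>0 c)\<^sup>2)
     + (v' * Q 0 0 0 1 \<xi> c f + (Q 0 1 0 1 \<xi> c f + Q 0 0 0 2 \<xi> c f) * (1 / \<alpha>0 c)))
    (v' * Q 0 0 1 0 \<xi> c f + (Q 0 1 1 0 \<xi> c f + Q 0 0 1 1 \<xi> c f) * (1 / \<alpha>0 c))"
    using Dc_V[OF c] by (elim exE)
  have eq: "Dc (\<lambda>\<xi> c. V \<xi> c (X \<omega>)) \<xi> c = vec2
    (u' * Q 0 0 1 0 \<xi> c (X \<omega>) + (Q 0 1 1 0 \<xi> c (X \<omega>) + Q 0 0 1 1 \<xi> c (X \<omega>)) * (\<alpha>1 c / (\<alpha>0 c)\<^sup>2)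
     + (v' * Q 0 0 0 1 \<xi> c (X \<omega>) + (Q 0 1 0 1 \<xi> c (X \<omega>) + Q 0 0 0 2 \<xi> c (X \<omega>)) * (1 / \<alpha>0 c)))
    (v' * Q 0 0 1 0 \<xi> c (X \<omega>) + (Q 0 1 1 0 \<xi> c (X \<omega>) + Q 0 0 1 1 \<xi> c (X \<omega>)) * (1 / \<alpha>0 c))" for \<omega>
    by (rule uv[rule_format, of _ \<alpha>]) (rule X)
  show "bounded_measurable (\<lambda>\<omega>. Dc (\<lambda>\<xi> c. V \<xi> c (X \<omega>)) \<xi> c)"
    unfolding eq by (rule intros)+
qed

end

text \<open>Deterministic form of the claim for one realization. The two parts of
  \<open>\<gamma>1\<close> give the first two summands, the time integral of \<open>c1\<close> the
  third, \<open>c1\<close> itself the fourth: these are the integrands of \<open>M10_I\<close> to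
  \<open>M10_IV\<close>. The double series is the rest, to be reduced to its diagonal by the
  expectation.\<close>

lemma second_order_drift:
  fixes R :: "int \<Rightarrow> ell2"
  assumes f: "\<And>j. \<bar>f j\<bar> \<le> \<alpha>" and c: "c \<in> {cm<..<cp}" and t: "0 \<le> t"
    and first: "solves_first c f \<gamma>1 c1" and second: "solves_second c f \<eta> \<gamma>1 c1 \<gamma>2 c2"
    and R: "\<And>m. norm (R m) \<le> C * weight m" and l2a: "in_l2a_Z2 a (\<lambda>j m. seq (R m) j)"
    and \<eta>: "((\<lambda>m. f m *\<^sub>R R m) has_sum \<eta> t) UNIV"
  shows "vector_derivative (\<lambda>s. vec2 (\<gamma>2 s) (c2 s)) (at t within {0..})
    = - (\<alpha>1 c / (2 * c * (\<alpha>0 c)\<^sup>2)) *\<^sub>R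
        ((Q 0 0 0 0 (c * t) c f - Q 0 0 0 0 0 c f) *\<^sub>R D\<xi> (\<lambda>\<xi> c. V \<xi> c f) (c * t) c)
      + (1 / (2 * c * \<alpha>0 c)) *\<^sub>R ((2 * N 0 0 0 1 (c * t) c f) *\<^sub>R D\<xi> (\<lambda>\<xi> c. V \<xi> c f) (c * t) c)
      + - (1 / (2 * c\<^sup>2 * \<alpha>0 c)) *\<^sub>R
        ((N 0 0 0 0 (c * t) c f - c * t * Q 0 0 0 0 0 c f) *\<^sub>R D\<xi> (\<lambda>\<xi> c. V \<xi> c f) (c * t) c)
      + - (1 / (2 * c * \<alpha>0 c)) *\<^sub>R
        ((Q 0 0 0 0 (c * t) c f - Q 0 0 0 0 0 c f) *\<^sub>R Dc (\<lambda>\<xi> c. V \<xi> c f) (c * t) c)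
      + (\<Sum>\<^sub>\<infinity>(m, n). (f m * f n) *\<^sub>R (\<Gamma>C11 (c * t) c (unit_seq m) (seq (R n))
          + \<Gamma>C02 (c * t) c (\<lambda>j. seq (R m) j $ 1) (\<lambda>j. seq (R n) j $ 1)))"
proof -
  let ?h = "\<lambda>n. exp (- (\<beta> / 2) * \<bar>real_of_int n\<bar>)"
  interpret bounded_coefficients f ?h \<alpha>
    by unfold_locales (use f summable_half_decay[OF \<beta>_pos] in auto)
  have quad: "\<Gamma>C11 (c * t) c f (seq (\<eta> t)) + \<Gamma>C02 (c * t) c (\<lambda>j. seq (\<eta> t) j $ 1) (\<lambda>j. seq (\<eta> t) j $ 1)
    = (\<Sum>\<^sub>\<infinity>(m, n). (f m * f n) *\<^sub>R (\<Gamma>C11 (c * t) c (unit_seq m) (seq (R n))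
          + \<Gamma>C02 (c * t) c (\<lambda>j. seq (R m) j $ 1) (\<lambda>j. seq (R n) j $ 1)))"
    using quad_expansion_add[OF second_order_expansion[where f = f and \<alpha> = \<alpha> and \<xi> = "c * t", OF f c R l2a \<eta>]]
    unfolding quad_expansion_def by (rule conjunct2)
  note corr = first_order_corrections[where f = f and \<alpha> = \<alpha>, OF f c first t]
  \<comment> \<open>The half-line filter is nontrivial at every nonnegative \<open>t\<close>,
    including 0, so the derivative is unique.\<close>
  have "at_right t \<le> at t within {0..}" by (rule at_le) (use t in auto)
  then have "at t within {0..} \<noteq> bot" using trivial_limit_at_right_real[of t] by (auto simp: bot_unique)
  then have "vector_derivative (\<lambda>s. vec2 (\<gamma>2 s) (c2 s)) (at t within {0..})
    = (\<gamma>1 t + (LBINT s=0..t. c1 s)) *\<^sub>R D\<xi> (\<lambda>\<xi> c. V \<xi> c f) (c * t) c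
      + c1 t *\<^sub>R Dc (\<lambda>\<xi> c. V \<xi> c f) (c * t) c
      + \<Gamma>C11 (c * t) c f (seq (\<eta> t)) + \<Gamma>C02 (c * t) c (\<lambda>j. seq (\<eta> t) j $ 1) (\<lambda>j. seq (\<eta> t) j $ 1)"
    using second t by (intro vector_derivative_within) (auto simp: solves_second_def)
  \<comment> \<open>Redistributes a factor 2 to match \<open>M10_II\<close>, whose integrand is the
    speed derivative of the squared profile and not half of it.\<close>
  moreover have "1 / (c * \<alpha>0 c) * x = 1 / (2 * c * \<alpha>0 c) * (2 * x)" for x by simp
  ultimately show ?thesis
    unfolding corr quad[symmetric] by (simp only: scaleR_add_left scaleR_scaleR add.assoc)
qed

end

theorem proposition5p2:
  fixes cp cm cs a \<alpha> \<sigma> :: real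
    and \<phi> :: "real \<Rightarrow> real \<Rightarrow> real^2"
    and \<A> :: "real \<Rightarrow> ell2 \<Rightarrow> ell2"
    and P :: "'w measure"
    and \<kappa> :: "int \<Rightarrow> 'w \<Rightarrow> real"
    and \<eta> :: "'w \<Rightarrow> real \<Rightarrow> ell2"
    and R :: "int \<Rightarrow> real \<Rightarrow> ell2"
    and \<gamma>1 c1 \<gamma>2 c2 :: "'w \<Rightarrow> real \<Rightarrow> real"
    and t :: real
  assumes waves: "waves.solitary_waves cp \<phi>"
    and cm: "1 < cm" "cm < cp"
    and a: "0 < a" "waves.stability_weight cp \<phi> a cm" "waves.localized cp \<phi> a cm"
    and cs: "cm < cs" "cs < cp"
    and LS: "waves.LS cp \<phi> a cs \<A>"
    and prob: "prob_space P"
    and indep: "prob_space.indep_vars P (\<lambda>_. borel) \<kappa> UNIV"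
    and ident: "\<And>i j. distr P borel (\<kappa> i) = distr P borel (\<kappa> j)"
    and mean: "\<And>j. prob_space.expectation P (\<kappa> j) = 0"
    and var: "\<And>j. prob_space.variance P (\<kappa> j) = 1"
    and supp: "\<And>j. AE \<omega> in P. \<kappa> j \<omega> \<in> {-\<alpha>..\<alpha>}"
    and \<sigma>: "0 \<le> \<sigma>" "\<sigma> * \<alpha> < 1"
    and \<eta>: "AE \<omega> in P. waves.solves_tail cp \<phi> cs \<A> (\<lambda>j. \<kappa> j \<omega>) (\<eta> \<omega>)"
    and R: "\<And>m. waves.solves_tail cp \<phi> cs \<A> (unit_seq m) (R m)"
    and R_l2a: "\<And>s. 0 \<le> s \<Longrightarrow> in_l2a_Z2 a (\<lambda>j m. seq (R m s) j)"
    and first: "AE \<omega> in P. waves.solves_first cp \<phi> cs (\<lambda>j. \<kappa> j \<omega>) (\<gamma>1 \<omega>) (c1 \<omega>)"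
    and second: "AE \<omega> in P. waves.solves_second cp \<phi> cs (\<lambda>j. \<kappa> j \<omega>) (\<eta> \<omega>)
                   (\<gamma>1 \<omega>) (c1 \<omega>) (\<gamma>2 \<omega>) (c2 \<omega>)"
    and t: "0 \<le> t"
  shows "integrable (completion P)
      (\<lambda>\<omega>. vector_derivative (\<lambda>s. vec2 (\<gamma>2 \<omega> s) (c2 \<omega> s)) (at t within {0..}))
    \<and> expect P (\<lambda>\<omega>. vector_derivative (\<lambda>s. vec2 (\<gamma>2 \<omega> s) (c2 \<omega> s)) (at t within {0..}))
      = waves.M10 cp \<phi> P \<kappa> (cs * t) cs
        + waves.M02 cp \<phi> (cs * t) cs (\<lambda>j m. seq (R m t) j) (\<lambda>j m. seq (R m t) j)
        + waves.M11 cp \<phi> (cs * t) cs (\<lambda>j m. seq (R m t) j)"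
proof -
  interpret prob_space P by (rule prob)
  obtain d \<beta> where d: "waves.all_derivatives cp \<phi> d" "a < \<beta>"
    "\<forall>k l. \<exists>K. \<forall>c\<in>{cm..cp}. \<forall>x. norm (d k l c x) \<le> K * exp (- \<beta> * \<bar>x\<bar>)"
    using a(3) unfolding waves.localized_def by blast
  then obtain K where K: "\<And>k l c x. c \<in> {cm..cp} \<Longrightarrow> norm (d k l c x) \<le> K k l * exp (- \<beta> * \<bar>x\<bar>)"
    by metis
  interpret localized_waves cp \<phi> cm a \<beta> d K
    by unfold_locales (use cm a(1) d(1,2) K waves in \<open>auto simp: waves.solitary_waves_def\<close>)
  have c: "cs \<in> {cm<..<cp}" using cs by simp
  have lin: "linear (\<A> (cs * t))" for t
    using LS by (simp add: LS_def bounded_linear.linear)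
  obtain U where U: "generates (\<lambda>t w. J_ell2 (\<A> (cs * t) w)) U" using LS unfolding LS_def by blast
  note expansion = tail_expansion[OF c U t lin R]
  obtain C where C: "\<And>m. norm (R m t) \<le> C * weight m" using expansion(1) by blast

  text \<open>Truncation makes all random series converge everywhere.\<close>
  define X where "X \<omega> j = max (- \<bar>\<alpha>\<bar>) (min \<bar>\<alpha>\<bar> (\<kappa> j \<omega>))" for \<omega> j
  have X: "\<bar>X \<omega> j\<bar> \<le> \<bar>\<alpha>\<bar>" for \<omega> j by (auto simp: X_def)
  have \<kappa>m: "\<kappa> j \<in> borel_measurable P" for j using indep by (simp add: indep_vars_def2)
  have Xm: "(\<lambda>\<omega>. X \<omega> j) \<in> borel_measurable P" for j unfolding X_def using \<kappa>m by measurable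
  have X_eq: "AE \<omega> in P. (\<lambda>j. \<kappa> j \<omega>) = X \<omega>"
  proof -
    have clamp: "max (- \<bar>\<alpha>\<bar>) (min \<bar>\<alpha>\<bar> k) = k" if "k \<in> {-\<alpha>..\<alpha>}" for k
      using that by simp
    have "AE \<omega> in P. \<forall>j. \<kappa> j \<omega> \<in> {-\<alpha>..\<alpha>}" using supp by (simp add: AE_all_countable)
    then show ?thesis by eventually_elim (simp add: X_def fun_eq_iff clamp)
  qed
  have \<kappa>i: "integrable P (\<kappa> j)" for j
  proof (rule integrable_const_bound[OF _ \<kappa>m])
    show "AE \<omega> in P. norm (\<kappa> j \<omega>) \<le> \<alpha>" using supp[of j] by eventually_elim auto
  qed
  \<comment> \<open>Mean zero turns the variance into the second moment on the diagonal, and with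
    independence it annihilates the other products. Truncation changes the variables only on a null
    set.\<close>
  have cov: "expectation (\<lambda>\<omega>. X \<omega> i * X \<omega> j) = (if i = j then 1 else 0)" for i j
  proof -
    have "expectation (\<lambda>\<omega>. X \<omega> i * X \<omega> j) = expectation (\<lambda>\<omega>. \<kappa> i \<omega> * \<kappa> j \<omega>)"
      by (rule integral_cong_AE) (use X_eq Xm \<kappa>m in \<open>auto elim!: eventually_mono simp: fun_eq_iff\<close>)
    also have "\<dots> = (if i = j then 1 else 0)"
      using var[of j] mean expectation_mult_indep[OF indep _ \<kappa>i, of i j] by (simp add: power2_eq_square)
    finally show ?thesis .
  qed

  define \<xi> where "\<xi> = cs * t"
  define D1 where "D1 \<omega> = D\<xi> (\<lambda>\<xi> c. V \<xi> c (X \<omega>)) \<xi> cs" for \<omega>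
  define D2 where "D2 \<omega> = Dc (\<lambda>\<xi> c. V \<xi> c (X \<omega>)) \<xi> cs" for \<omega>
  define Y0 where "Y0 \<omega> = Q 0 0 0 0 \<xi> cs (X \<omega>) - Q 0 0 0 0 0 cs (X \<omega>)" for \<omega>
  define Y1 where "Y1 \<omega> = 2 * N 0 0 0 1 \<xi> cs (X \<omega>)" for \<omega>
  define Y2 where "Y2 \<omega> = N 0 0 0 0 \<xi> cs (X \<omega>) - \<xi> * Q 0 0 0 0 0 cs (X \<omega>)" for \<omega>
  define F where "F m n = \<Gamma>C11 \<xi> cs (unit_seq m) (seq (R n t))
      + \<Gamma>C02 \<xi> cs (\<lambda>j. seq (R m t) j $ 1) (\<lambda>j. seq (R n t) j $ 1)" for m n
  define W where "W \<omega> = (\<Sum>\<^sub>\<infinity>(m, n). (X \<omega> m * X \<omega> n) *\<^sub>R F m n)" for \<omega>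
  note bm = bounded_measurable_scaleR bounded_measurable_diff bounded_measurable_mult bounded_measurable_const
    bounded_measurable_Q[OF prob Xm X c] bounded_measurable_N[OF prob Xm X c] bounded_measurable_D_V[OF prob Xm X c]
  have YD: "bounded_measurable (\<lambda>\<omega>. Y0 \<omega> *\<^sub>R D1 \<omega>)" "bounded_measurable (\<lambda>\<omega>. Y1 \<omega> *\<^sub>R D1 \<omega>)"
    "bounded_measurable (\<lambda>\<omega>. Y2 \<omega> *\<^sub>R D1 \<omega>)" "bounded_measurable (\<lambda>\<omega>. Y0 \<omega> *\<^sub>R D2 \<omega>)"
    unfolding Y0_def Y1_def Y2_def D1_def D2_def by (rule bm)+

  let ?h = "\<lambda>n. exp (- (\<beta> / 2) * \<bar>real_of_int n\<bar>)"
  \<comment> \<open>On the diagonal the two half-rate factors combine to \<open>weight m\<close>,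
    which makes both diagonal series summable and allows them to be separated into
    \<open>M11\<close> and \<open>M02\<close>.\<close>
  have hh: "?h m * ?h m = weight m" for m by (simp add: weight_def exp_add[symmetric])
  \<comment> \<open>Zero coefficients, whose response series sums trivially to 0, suffice here: only
    the bounds on the matrix entries are extracted, and these do not involve the
    coefficients.\<close>
  have bc: "bounded_coefficients (\<lambda>_. 0) ?h 0"
    by unfold_locales (use summable_half_decay[OF \<beta>_pos] in auto)
  note coeff = second_order_expansion[of "\<lambda>_. 0" 0 cs "\<lambda>m. R m t" C 0 \<xi>, OF _ c C R_l2a[OF t],
      unfolded bounded_coefficients.quad_expansion_def[OF bc]]
  obtain E1 where E1: "\<And>m n. norm (\<Gamma>C11 \<xi> cs (unit_seq m) (seq (R n t))) \<le> E1 * (?h m * ?h n)"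
    using coeff(1) by auto
  obtain E2 where E2: "\<And>m n. norm (\<Gamma>C02 \<xi> cs (\<lambda>j. seq (R m t) j $ 1) (\<lambda>j. seq (R n t) j $ 1)) \<le> E2 * (?h m * ?h n)"
    using coeff(2) by auto
  have F: "norm (F m n) \<le> (E1 + E2) * (?h m * ?h n)" for m n
    unfolding F_def distrib_right by (rule norm_triangle_le[OF add_mono[OF E1 E2]])
  have "0 \<le> ?h j" for j by simp
  note quad = expectation_quadratic[of X "\<bar>\<alpha>\<bar>" ?h F, OF Xm X cov this summable_half_decay[OF \<beta>_pos] F, folded W_def]
  have "(\<Sum>\<^sub>\<infinity>m. F m m) = M11 \<xi> cs (\<lambda>j m. seq (R m t) j) + M02 \<xi> cs (\<lambda>j m. seq (R m t) j) (\<lambda>j m. seq (R m t) j)"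
    unfolding F_def M11_def M02_def
  proof (rule infsum_add)
    show "(\<lambda>m. \<Gamma>C11 \<xi> cs (unit_seq m) (seq (R m t))) summable_on UNIV"
      by (rule summable_on_dominated[OF summable_on_cmult_right[OF summable_weight, of E1]]) (use E1 hh in metis)
    show "(\<lambda>m. \<Gamma>C02 \<xi> cs (\<lambda>j. seq (R m t) j $ 1) (\<lambda>j. seq (R m t) j $ 1)) summable_on UNIV"
      by (rule summable_on_dominated[OF summable_on_cmult_right[OF summable_weight, of E2]]) (use E2 hh in metis)
  qed
  with quad(2) have EW: "expectation W = M11 \<xi> cs (\<lambda>j m. seq (R m t) j)
      + M02 \<xi> cs (\<lambda>j m. seq (R m t) j) (\<lambda>j m. seq (R m t) j)" by simp

  \<comment> \<open>A measurable version of the drift, built from the truncated variables and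
    integrable with respect to \<open>P\<close> itself; the actual drift agrees with it almost
    surely.\<close>
  define Z where "Z \<omega> = - (\<alpha>1 cs / (2 * cs * (\<alpha>0 cs)\<^sup>2)) *\<^sub>R (Y0 \<omega> *\<^sub>R D1 \<omega>)
      + (1 / (2 * cs * \<alpha>0 cs)) *\<^sub>R (Y1 \<omega> *\<^sub>R D1 \<omega>)
      + - (1 / (2 * cs\<^sup>2 * \<alpha>0 cs)) *\<^sub>R (Y2 \<omega> *\<^sub>R D1 \<omega>)
      + - (1 / (2 * cs * \<alpha>0 cs)) *\<^sub>R (Y0 \<omega> *\<^sub>R D2 \<omega>) + W \<omega>" for \<omega>
  note int = YD[THEN bounded_measurable_integrable] quad(1)[THEN bounded_measurable_integrable]
  have Z: "integrable P Z"
    unfolding Z_def by (intro Bochner_Integration.integrable_add integrable_scaleR_right int)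
  have EZ: "expectation Z = - (\<alpha>1 cs / (2 * cs * (\<alpha>0 cs)\<^sup>2)) *\<^sub>R expectation (\<lambda>\<omega>. Y0 \<omega> *\<^sub>R D1 \<omega>)
      + (1 / (2 * cs * \<alpha>0 cs)) *\<^sub>R expectation (\<lambda>\<omega>. Y1 \<omega> *\<^sub>R D1 \<omega>)
      + - (1 / (2 * cs\<^sup>2 * \<alpha>0 cs)) *\<^sub>R expectation (\<lambda>\<omega>. Y2 \<omega> *\<^sub>R D1 \<omega>)
      + - (1 / (2 * cs * \<alpha>0 cs)) *\<^sub>R expectation (\<lambda>\<omega>. Y0 \<omega> *\<^sub>R D2 \<omega>) + expectation W"
    unfolding Z_def using int
    by (simp only: Bochner_Integration.integral_add Bochner_Integration.integrable_add integrable_scaleR_right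
        Bochner_Integration.integral_scaleR_right)

  have drift: "AE \<omega> in P. vector_derivative (\<lambda>s. vec2 (\<gamma>2 \<omega> s) (c2 \<omega> s)) (at t within {0..}) = Z \<omega>"
    using X_eq \<eta> first second
  proof eventually_elim
    case (elim \<omega>)
    have "((\<lambda>m. X \<omega> m *\<^sub>R R m t) has_sum \<eta> \<omega> t) UNIV"
      using expansion(2)[of "X \<omega>" "\<bar>\<alpha>\<bar>" "\<eta> \<omega>"] X elim by simp
    then show ?case
      unfolding Z_def W_def F_def Y0_def Y1_def Y2_def D1_def D2_def \<xi>_def
      by (intro second_order_drift[where f = "X \<omega>" and \<alpha> = "\<bar>\<alpha>\<bar>" and \<eta> = "\<eta> \<omega>", OF X c t _ _ C R_l2a[OF t]])
         (use elim in simp_all)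
  qed
  \<comment> \<open>\<open>M10\<close> is defined with the original variables, for which the series
    are under control only almost surely. The completion again absorbs the null set.\<close>
  have sums: "AE \<omega> in P. (\<Sum>\<^sub>\<infinity>j. \<kappa> j \<omega> * ((r cs (real_of_int j - \<xi>))\<^sup>2 - (r cs (real_of_int j))\<^sup>2)) = Y0 \<omega> \<and>
      (\<Sum>\<^sub>\<infinity>j. \<kappa> j \<omega> * (LBINT s=0..\<xi>. Dc (\<lambda>x c. (r c x)\<^sup>2) (real_of_int j - s) cs)) = Y1 \<omega> \<and>
      (\<Sum>\<^sub>\<infinity>j. \<kappa> j \<omega> * ((LBINT s=0..\<xi>. (r cs (real_of_int j - s))\<^sup>2) - \<xi> * (r cs (real_of_int j))\<^sup>2)) = Y2 \<omega> \<and>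
      D\<xi> (\<lambda>\<xi> c. V \<xi> c (\<lambda>j. \<kappa> j \<omega>)) \<xi> cs = D1 \<omega> \<and> Dc (\<lambda>\<xi> c. V \<xi> c (\<lambda>j. \<kappa> j \<omega>)) \<xi> cs = D2 \<omega>"
    using X_eq
  proof eventually_elim
    case (elim \<omega>)
    then have "\<kappa> j \<omega> = X \<omega> j" for j by (simp add: fun_eq_iff)
    then show ?case
      using wave_square_sums[where f = "X \<omega>" and \<alpha> = "\<bar>\<alpha>\<bar>" and \<xi> = \<xi>, OF X c]
      by (simp add: Y0_def Y1_def Y2_def D1_def D2_def)
  qed
  \<comment> \<open>Subtracting the expectation of \<open>W\<close> from that of \<open>Z\<close>
    leaves four expectations, which match the four parts of \<open>M10\<close> one by one.\<close>
  have M10: "M10 P \<kappa> \<xi> cs = expectation Z - expectation W"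
    unfolding M10_def M10_I_def M10_II_def M10_III_def M10_IV_def EZ add_diff_cancel_right'
    by (intro arg_cong2[where f = "(+)"] arg_cong2[where f = "(*\<^sub>R)"] refl integral_completion_AE int)
       (rule eventually_mono[OF sums], simp)+
  show ?thesis
    unfolding integral_completion_AE[OF Z drift] \<xi>_def[symmetric] M10 EW
    using integrable_completion_AE[OF Z drift] by simp
qed

end
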